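(* Let $I=(-1,1)$ and let $\rho>0$. There exists a non-trivial non-negative solution $u=u_\rho$ to $$(-\Delta)^{\frac12}u=\rho\frac{e^{u}}{\int_I e^{u}\,dx}\ \text{ in } I,\qquad u\equiv 0\ \text{ in }\mathbb{R}\setminus I,$$ if and only if $\rho\in(0,2\pi)$. Moreover, denoting by $u_\rho$, for $\rho\in(0,2\pi)$, such a solution, one has $$u_\rho(0)\to\infty\quad\text{as }\rho\uparrow 2\pi.$$
   Context: Solutions are understood to be functions $u\in C^{0,\frac12}(\mathbb{R})\cap C^\infty(I)$ (there is no loss of generality in this), and for such functions vanishing outside $I=(-1,1)$ the half-Laplacian is $$(-\Delta)^{\frac12}u(x)=\frac1\pi\,P.V.\int_{\mathbb{R}}\frac{u(x)-u(y)}{(x-y)^2}\,dy,\qquad x\in I.$$ *)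

theory Defs
  imports "HOL-Analysis.Analysis"
begin

definition hoelder_space :: "real \<Rightarrow> (real \<Rightarrow> real) set" where
  "hoelder_space \<alpha> =
     {u. bounded (range u) \<and> (\<exists>C. \<forall>x y. \<bar>u x - u y\<bar> \<le> C * \<bar>x - y\<bar> powr \<alpha>)}"

text \<open>Intended for open sets \<open>S\<close>: the iterates of \<^const>\<open>deriv\<close> on \<open>S\<close> then
  depend only on the values of \<open>u\<close> on \<open>S\<close>.\<close>

definition smooth_on_open :: "real set \<Rightarrow> (real \<Rightarrow> real) \<Rightarrow> bool" where
  "smooth_on_open S u \<longleftrightarrow> (\<forall>k. \<forall>x\<in>S. (deriv ^^ k) u field_differentiable (at x))"

text \<open>Principal value over the real line for a singularity at \<open>x\<close>. The truncated integrals
  are required to converge absolutely and their limit is required to exist, so that no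
  default value of an undefined integral or limit enters.\<close>

definition has_pv_integral :: "(real \<Rightarrow> real) \<Rightarrow> real \<Rightarrow> real \<Rightarrow> bool" where
  "has_pv_integral f x L \<longleftrightarrow>
     (\<forall>\<epsilon>>0. set_integrable lborel {y. \<bar>y - x\<bar> > \<epsilon>} f) \<and>
     ((\<lambda>\<epsilon>. LINT y:{y. \<bar>y - x\<bar> > \<epsilon>}|lborel. f y) \<longlongrightarrow> L) (at_right 0)"

definition has_half_laplacian :: "(real \<Rightarrow> real) \<Rightarrow> real \<Rightarrow> real \<Rightarrow> bool" where
  "has_half_laplacian u x l \<longleftrightarrow>
     (\<exists>L. has_pv_integral (\<lambda>y. (u x - u y) / (x - y)\<^sup>2) x L \<and> l = 1 / pi * L)"

definition liouville_solution :: "real \<Rightarrow> (real \<Rightarrow> real) \<Rightarrow> bool" where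
  "liouville_solution \<rho> u \<longleftrightarrow>
     u \<in> hoelder_space (1/2) \<and> smooth_on_open {-1<..<1} u \<and>
     (\<forall>x\<in>{-1<..<1}. has_half_laplacian u x
        (\<rho> * (exp (u x) / (LINT y:{-1<..<1}|lborel. exp (u y))))) \<and>
     (\<forall>x. x \<notin> {-1<..<1} \<longrightarrow> u x = 0)"

definition nontrivial_nonneg_solution :: "real \<Rightarrow> (real \<Rightarrow> real) \<Rightarrow> bool" where
  "nontrivial_nonneg_solution \<rho> u \<longleftrightarrow>
     liouville_solution \<rho> u \<and> (\<forall>x. u x \<ge> 0) \<and> (\<exists>x. u x \<noteq> 0)"

end

theory Submission
  imports Defs "HOL-Complex_Analysis.Complex_Analysis"
begin

text \<open>Every solution is \<open>u = G f\<close> with \<open>f = \<lambda> e\<^sup>u\<close>, where \<open>G\<close> is the explicit Green function of the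
  interval: \<open>G f\<close> inverts the half-Laplacian and the maximum principle gives uniqueness.

  Comparing the energy \<open>\<langle>f, G f\<rangle>\<close> with that of the dilated density \<open>f (x / s) / s\<close> as \<open>s \<up> 1\<close> gives the
  Pohozaev type inequality \<open>\<rho>\<^sup>2 + \<eta>\<^sup>2 (P\<^sup>2 + N\<^sup>2) \<le> 2\<pi> (\<rho> - 2\<lambda>)\<close>, with \<open>P\<close> and \<open>N\<close> the masses of
  \<open>f\<close> to the right of \<open>\<eta>\<close> and to the left of \<open>-\<eta>\<close>. Hence \<open>\<rho> < 2\<pi>\<close>. As \<open>\<rho>\<close> tends to \<open>2\<pi>\<close> both masses
  vanish for every \<open>\<eta>\<close>, so \<open>f\<close> concentrates at the origin, where the Green function is singular, and
  \<open>u 0\<close> diverges.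

  For existence, iterate \<open>v \<mapsto> \<rho> G (e\<^sup>v / \<integral> e\<^sup>v)\<close> from \<open>0\<close>. As \<open>G\<close> is positive definite, the free energy
  decreases along the iteration; for \<open>\<rho> < 2\<pi>\<close> it controls the entropy, because \<open>e\<close> to the power \<open>c G\<close>
  is integrable for \<open>c < \<pi>\<close>. The iterates are therefore bounded and equi-Hoelder, and a limit point is a
  fixed point. In the variable \<open>artanh x\<close> the Green function becomes the convolution kernel
  \<open>ln coth (\<bar>t\<bar> / 2) / \<pi>\<close>, and bootstrapping makes the fixed point smooth.\<close>

section \<open>The Green function of the interval\<close>

text \<open>The threshold 2\<pi> comes from the diagonal singularity
  \<open>- ln \<bar>x - y\<bar> / pi\<close>. A dilation by s = 1 - \<delta> adds at least
  \<open>- ln s / pi\<close> to the interaction of each pair, so the energy grows by at least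
  \<delta> \<rho>^2 / \<pi>, while convexity of exp bounds the linear part of the growth by about 2
  \<delta> (\<rho> - 2\<lambda>). The gap 2\<lambda> is mass lost at the two endpoints. The obstacle
  is the boundary: u is controlled there only as Hoelder 1/2 and f jumps, so an integration by parts
  against x u' is delicate. A finite dilation avoids it, at the price of a quadratic remainder that
  has to be o(\<delta>) although the increment of f has order 1 on strips of width \<delta>.
  Potentials are O(sqrt \<delta>) on these strips, and differentiability inside improves the bulk
  from O(\<delta>) to o(\<delta>). The same constant returns for existence: the entropy absorbs
  \<rho>/2 times the energy if \<rho>/2 < c < \<pi>. Each step lowers the free energy by at least a
  squared Hellinger distance, so consecutive densities merge. In the variable artanh x the kernel is
  translation invariant, so derivatives can be moved onto weight and density, away from singularity
  and endpoints.\<close>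

text \<open>The arguments are clamped to \<open>[-1,1]\<close> so that \<open>green\<close> vanishes as soon as one of them lies outside \<open>I\<close>;
  on the diagonal \<open>x / 0 = 0\<close> and \<open>ln 0 = 0\<close> give the junk value \<open>0\<close>.\<close>

definition unit_clamp :: "real \<Rightarrow> real" where
  "unit_clamp x = max (-1) (min 1 x)"

definition semicircle :: "real \<Rightarrow> real" where
  "semicircle x = sqrt (max 0 (1 - x\<^sup>2))"

definition green :: "real \<Rightarrow> real \<Rightarrow> real" where
  "green x y =
     ln ((1 - unit_clamp x * unit_clamp y + semicircle x * semicircle y) / \<bar>unit_clamp x - unit_clamp y\<bar>) / pi"

lemma unit_clamp_eq [simp]: "\<bar>x\<bar> \<le> 1 \<Longrightarrow> unit_clamp x = x"
  by (auto simp: unit_clamp_def)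

lemma continuous_on_unit_clamp: "continuous_on S unit_clamp"
  unfolding unit_clamp_def by (intro continuous_intros)

lemma continuous_on_semicircle: "continuous_on S semicircle"
  unfolding semicircle_def by (intro continuous_intros)

lemma borel_measurable_unit_clamp [measurable]: "unit_clamp \<in> borel_measurable borel"
  by (intro borel_measurable_continuous_onI continuous_on_unit_clamp)

lemma borel_measurable_semicircle [measurable]: "semicircle \<in> borel_measurable borel"
  by (intro borel_measurable_continuous_onI continuous_on_semicircle)

lemma semicircle_eq: "\<bar>x\<bar> \<le> 1 \<Longrightarrow> semicircle x = sqrt (1 - x\<^sup>2)"
  by (auto simp: semicircle_def max_def abs_square_le_1)

lemma semicircle_nonneg [simp]: "0 \<le> semicircle x"
  by (simp add: semicircle_def)

lemma semicircle_le_1: "semicircle x \<le> 1"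
  by (simp add: semicircle_def)

lemma semicircle_pos: "\<bar>x\<bar> < 1 \<Longrightarrow> 0 < semicircle x"
  by (simp add: semicircle_def abs_square_less_1)

lemma semicircle_outside: "1 \<le> \<bar>x\<bar> \<Longrightarrow> semicircle x = 0"
  by (metis abs_one abs_le_square_iff diff_ge_0_iff_ge max.absorb1 one_power2 real_sqrt_zero semicircle_def le_iff_diff_le_0)

lemma semicircle_sq: "\<bar>x\<bar> \<le> 1 \<Longrightarrow> (semicircle x)\<^sup>2 = 1 - x\<^sup>2"
  by (simp add: semicircle_eq abs_square_le_1)

lemma unit_clamp_outside: "1 \<le> \<bar>x\<bar> \<Longrightarrow> unit_clamp x = 1 \<or> unit_clamp x = -1"
  by (auto simp: unit_clamp_def)

lemma abs_unit_clamp_le: "\<bar>unit_clamp x\<bar> \<le> 1"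
  by (auto simp: unit_clamp_def)

lemma green_sym: "green x y = green y x"
  by (simp add: green_def mult.commute abs_minus_commute)

lemma green_diag [simp]: "green x x = 0"
  by (simp add: green_def)

lemma green_outside: assumes "1 \<le> \<bar>x\<bar>" shows "green x y = 0"
proof -
  have "\<bar>unit_clamp y\<bar> \<le> 1" by (rule abs_unit_clamp_le)
  then show ?thesis
    using unit_clamp_outside[OF assms] semicircle_outside[OF assms]
    by (auto simp: green_def abs_if)
qed

lemma green_outside': "1 \<le> \<bar>y\<bar> \<Longrightarrow> green x y = 0"
  using green_outside green_sym by metis

text \<open>The products \<open>(1 - x) * (1 + y)\<close> and \<open>(1 + x) * (1 - y)\<close> are
  \<open>1 - x * y\<close> minus and plus \<open>x - y\<close>, and both are nonnegative on the
  square. So off the diagonal the argument of the logarithm in \<open>green\<close> is at least 1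
  and its numerator is positive.\<close>

lemma green_numerator_ge:
  assumes "\<bar>x\<bar> \<le> 1" "\<bar>y\<bar> \<le> 1"
  shows "\<bar>x - y\<bar> \<le> 1 - x * y + semicircle x * semicircle y"
proof -
  have "0 \<le> (1 - x) * (1 + y)" "0 \<le> (1 + x) * (1 - y)"
    using assms by (auto intro!: mult_nonneg_nonneg)
  moreover have "0 \<le> semicircle x * semicircle y" by simp
  ultimately show ?thesis unfolding abs_le_iff right_diff_distrib left_diff_distrib distrib_left distrib_right
    by linarith
qed

text \<open>The gap between 2 and the left side is half the sum of
  \<open>(semicircle x - semicircle y)\<^sup>2\<close> and \<open>(x + y)\<^sup>2\<close>.\<close>

lemma green_numerator_le:
  assumes "\<bar>x\<bar> \<le> 1" "\<bar>y\<bar> \<le> 1"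
  shows "1 - x * y + semicircle x * semicircle y \<le> 2"
proof -
  have "0 \<le> (semicircle x - semicircle y)\<^sup>2" "0 \<le> (x + y)\<^sup>2" by auto
  then show ?thesis
    using semicircle_sq[of x] semicircle_sq[of y] assms
    by (auto simp: power2_eq_square algebra_simps)
qed

lemma green_eq:
  assumes "\<bar>x\<bar> \<le> 1" "\<bar>y\<bar> \<le> 1" "x \<noteq> y"
  shows "green x y = (ln (1 - x * y + semicircle x * semicircle y) - ln \<bar>x - y\<bar>) / pi"
proof -
  have "0 < \<bar>x - y\<bar>" using assms by simp
  then show ?thesis
    using assms green_numerator_ge[OF assms(1,2)] by (simp add: green_def ln_div)
qed

lemma green_nonneg [simp]: "0 \<le> green x y"
proof (cases "\<bar>x\<bar> \<le> 1 \<and> \<bar>y\<bar> \<le> 1 \<and> x \<noteq> y")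
  case True
  then have "0 < \<bar>x - y\<bar>" by simp
  then have "ln \<bar>x - y\<bar> \<le> ln (1 - x * y + semicircle x * semicircle y)"
    using green_numerator_ge[of x y] True by (subst ln_le_cancel_iff) auto
  with True show ?thesis by (simp add: green_eq)
next
  case False
  then show ?thesis using green_outside[of x y] green_outside'[of y x]
    by (cases "x = y") auto
qed

lemma green_le:
  assumes "\<bar>x\<bar> \<le> 1" "\<bar>y\<bar> \<le> 1" "x \<noteq> y"
  shows "green x y \<le> ln (2 / \<bar>x - y\<bar>) / pi"
proof -
  have "0 < \<bar>x - y\<bar>" using assms by simp
  then have "ln (1 - x * y + semicircle x * semicircle y) \<le> ln 2"
    using green_numerator_ge[of x y] green_numerator_le[of x y] assms by (subst ln_le_cancel_iff) auto
  with assms \<open>0 < \<bar>x - y\<bar>\<close> show ?thesis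
    by (auto simp: green_eq ln_div divide_right_mono)
qed

lemma ln_le_two_sqrt: "0 < z \<Longrightarrow> ln z \<le> 2 * sqrt z"
  using ln_le_minus_one[of "sqrt z"] by (simp add: ln_sqrt)

text \<open>A power majorant of the logarithm that holds everywhere, junk values included: on the
  diagonal both sides are 0. The exponent 1/2 makes \<open>(t - y) * green t y\<close> of size
  \<open>sqrt \<bar>t - y\<bar>\<close>, which fits the Hoelder exponent of the potentials.\<close>

lemma green_le_inverse_sqrt: "green x y \<le> 1 / sqrt \<bar>x - y\<bar>"
proof (cases "\<bar>x\<bar> \<le> 1 \<and> \<bar>y\<bar> \<le> 1 \<and> x \<noteq> y")
  case True
  then have p: "0 < \<bar>x - y\<bar>" by simp
  have "ln (2 / \<bar>x - y\<bar>) \<le> 2 * sqrt (2 / \<bar>x - y\<bar>)"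
    using p by (intro ln_le_two_sqrt) simp
  also have "\<dots> = 2 * sqrt 2 / sqrt \<bar>x - y\<bar>" by (simp add: real_sqrt_divide)
  also have "\<dots> \<le> pi / sqrt \<bar>x - y\<bar>"
  proof (rule divide_right_mono)
    have "sqrt 2 \<le> 3 / 2" by (rule real_le_lsqrt) (auto simp: power2_eq_square)
    then show "2 * sqrt 2 \<le> pi" using pi_gt3 by linarith
  qed simp
  finally have "ln (2 / \<bar>x - y\<bar>) / pi \<le> 1 / sqrt \<bar>x - y\<bar>"
    by (simp add: field_simps)
  then show ?thesis using green_le[of x y] True by linarith
next
  case False
  then have "green x y = 0" using green_outside[of x y] green_outside'[of y x]
    by (cases "x = y") auto
  then show ?thesis by simp
qed

lemma borel_measurable_green [measurable]:
  "(\<lambda>p. green (fst p) (snd p)) \<in> borel_measurable (borel \<Otimes>\<^sub>M borel)"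
  unfolding green_def by measurable

lemma borel_measurable_green_comp [measurable (raw)]:
  assumes [measurable]: "f \<in> borel_measurable M" "g \<in> borel_measurable M"
  shows "(\<lambda>x. green (f x) (g x)) \<in> borel_measurable M"
  unfolding green_def by measurable

section \<open>Derivative and primitive of the Green function in one variable\<close>

lemma green_has_derivative:
  assumes t: "\<bar>t\<bar> < 1" and y: "\<bar>y\<bar> < 1" and ne: "t \<noteq> y"
  shows "((\<lambda>t. green t y) has_real_derivative
           - (semicircle y / (pi * semicircle t * (t - y)))) (at t)"
proof -
  let ?Q = "sqrt (1 - t\<^sup>2)" and ?P = "semicircle y"
  let ?g = "\<lambda>t. (ln (1 - t * y + sqrt (1 - t\<^sup>2) * ?P) - ln \<bar>t - y\<bar>) / pi"
  have Q: "semicircle t = ?Q" "0 < ?Q" "?Q\<^sup>2 = 1 - t\<^sup>2"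
    using t semicircle_eq[of t] semicircle_pos[of t] semicircle_sq[of t] by auto
  have P: "0 < ?P" "?P\<^sup>2 = 1 - y\<^sup>2"
    using y semicircle_pos[of y] semicircle_sq[of y] by auto
  let ?A = "1 - t * y + ?Q * ?P"
  have A: "0 < ?A"
    using green_numerator_ge[of t y] t y ne by (simp add: Q)
  have t2: "0 < 1 - t\<^sup>2" using Q(2) by simp
  have d1: "((\<lambda>t. sqrt (1 - t\<^sup>2)) has_real_derivative - t / ?Q) (at t)"
    using t2 by (auto intro!: derivative_eq_intros simp: field_simps)
  \<comment> \<open>Written as half of \<open>ln ((t - y)\<^sup>2)\<close>, the logarithm is
    differentiated without a case split on the sign of t - y.\<close>
  have d2: "((\<lambda>t. ln \<bar>t - y\<bar>) has_real_derivative 1 / (t - y)) (at t)"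
  proof -
    have "((\<lambda>t. ln (sqrt ((t - y)\<^sup>2))) has_real_derivative 1 / (t - y)) (at t)"
    proof -
      have "0 < (t - y)\<^sup>2" using ne by simp
      then have "((\<lambda>t. ln ((t - y)\<^sup>2) / 2) has_real_derivative (inverse ((t - y)\<^sup>2) * (2 * (t - y)) / 2)) (at t)"
        by (intro DERIV_cdivide DERIV_chain2[OF DERIV_ln]) (auto intro!: derivative_eq_intros)
      moreover have "inverse ((t - y)\<^sup>2) * (2 * (t - y)) / 2 = 1 / (t - y)"
      proof -
        have "inverse (d\<^sup>2) * (2 * d) / 2 = 1 / d" if "d \<noteq> 0" for d :: real
          using that by (simp add: field_simps power2_eq_square)
        then show ?thesis using ne by (metis right_minus_eq)
      qed
      ultimately have "((\<lambda>t. ln ((t - y)\<^sup>2) / 2) has_real_derivative 1 / (t - y)) (at t)"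
        by (simp only:)
      moreover have "(\<lambda>t. ln (sqrt ((t - y)\<^sup>2))) = (\<lambda>t. ln ((t - y)\<^sup>2) / 2)"
      proof
        fix t show "ln (sqrt ((t - y)\<^sup>2)) = ln ((t - y)\<^sup>2) / 2"
          using ln_sqrt[of "(t - y)\<^sup>2"] by (cases "t = y") auto
      qed
      ultimately show ?thesis by simp
    qed
    then show ?thesis by simp
  qed
  have d3: "((\<lambda>t. ln (1 - t * y + sqrt (1 - t\<^sup>2) * ?P)) has_real_derivative
              (- y - t / ?Q * ?P) / ?A) (at t)"
  proof -
    have "((\<lambda>t. 1 - t * y + sqrt (1 - t\<^sup>2) * ?P) has_real_derivative (0 - 1 * y + (- t / ?Q) * ?P)) (at t)"
      by (intro DERIV_add DERIV_diff DERIV_const DERIV_cmult_right DERIV_ident d1)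
    from DERIV_chain2[OF DERIV_ln[OF A] this] show ?thesis
      by (simp add: divide_inverse mult.commute)
  qed
  have d: "(?g has_real_derivative ((- y - t / ?Q * ?P) / ?A - 1 / (t - y)) / pi) (at t)"
    by (rule DERIV_cdivide[OF DERIV_diff[OF d3 d2]])
  \<comment> \<open>After clearing denominators the numerator of the derivative is a multiple of the
    argument \<open>?A\<close> of the logarithm, by \<open>?Q\<^sup>2 = 1 - t\<^sup>2\<close> and
    \<open>?P\<^sup>2 = 1 - y\<^sup>2\<close>. Hence \<open>?A\<close> cancels and only the pole at
    t = y and the two semicircles remain.\<close>
  have key: "((- y * ?Q - t * ?P) * (t - y) - ?A * ?Q) = - ?P * ?A"
  proof -
    have "?A * (?P - ?Q) = (1 - t * y) * (?P - ?Q) + ?Q * ?P\<^sup>2 - ?Q\<^sup>2 * ?P"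
      by (simp add: algebra_simps power2_eq_square)
    also have "\<dots> = ?P * (t * (t - y)) + ?Q * (y * (t - y))"
      unfolding Q P by (simp add: algebra_simps power2_eq_square)
    finally show ?thesis by (simp add: algebra_simps)
  qed
  have gen: "((- y - t / q * p) / A - 1 / d) / pi = ((- y * q - t * p) * d - A * q) / (q * A * d) / pi"
    "- p * A / (q * A * d) / pi = - (p / (pi * q * d))"
    if "q \<noteq> 0" "A \<noteq> 0" "d \<noteq> 0" for p q A d :: real
    using that by (simp_all add: field_simps)
  have "?Q \<noteq> 0" "?A \<noteq> 0" "t - y \<noteq> 0" using Q(2) A ne by auto
  note gen = gen[OF this]
  have e: "((- y - t / ?Q * ?P) / ?A - 1 / (t - y)) / pi = - (?P / (pi * ?Q * (t - y)))"
    unfolding gen(1) key by (rule gen(2))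
  have op: "open ({-1<..<1} - {y})" by (intro open_Diff) auto
  show ?thesis
  proof (rule has_field_derivative_transform_within_open[OF d[unfolded e, folded Q(1)] op])
    show "t \<in> {-1<..<1} - {y}" using t ne by auto
    fix s assume s: "s \<in> {-1<..<1} - {y}"
    then show "?g s = green s y"
      using green_eq[of s y] y semicircle_eq[of s] by (auto simp: abs_if)
  qed
qed

lemma isCont_green:
  assumes y: "\<bar>y\<bar> < 1" and ne: "t \<noteq> y"
  shows "isCont (\<lambda>t. green t y) t"
proof -
  have ne': "unit_clamp t \<noteq> unit_clamp y" using y ne by (auto simp: unit_clamp_def max_def min_def)
  have c: "isCont unit_clamp t" "isCont semicircle t"
    using continuous_on_unit_clamp[of UNIV] continuous_on_semicircle[of UNIV]
    by (auto simp: continuous_on_eq_continuous_at)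
  have "isCont (\<lambda>t. (1 - unit_clamp t * unit_clamp y + semicircle t * semicircle y)) t"
    by (intro continuous_intros c)
  moreover have "isCont (\<lambda>t. \<bar>unit_clamp t - unit_clamp y\<bar>) t"
    by (intro continuous_intros c)
  moreover have "0 < 1 - unit_clamp t * unit_clamp y + semicircle t * semicircle y"
  proof -
    have "semicircle t = semicircle (unit_clamp t)"
      by (auto simp: unit_clamp_def max_def min_def semicircle_outside)
    then show ?thesis
      using green_numerator_ge[of "unit_clamp t" "unit_clamp y"] ne' y by (simp add: abs_unit_clamp_le)
  qed
  ultimately show ?thesis
    unfolding green_def continuous_at using ne'
    by (intro tendsto_divide tendsto_ln tendsto_const) auto
qed

lemma continuous_on_mult_green:
  assumes y: "\<bar>y\<bar> < 1"
  shows "continuous_on S (\<lambda>t. (t - y) * green t y)"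
proof (rule continuous_at_imp_continuous_on, rule ballI)
  fix t
  show "isCont (\<lambda>t. (t - y) * green t y) t"
  proof (cases "t = y")
    case False
    then show ?thesis by (intro continuous_intros isCont_green y)
  next
    case True
    have "((\<lambda>t. (t - y) * green t y) \<longlongrightarrow> 0) (at y)"
    proof (rule Lim_null_comparison)
      have "\<bar>(t - y) * green t y\<bar> \<le> sqrt \<bar>t - y\<bar>" for t
      proof -
        have "\<bar>(t - y) * green t y\<bar> = \<bar>t - y\<bar> * green t y" by (simp add: abs_mult)
        also have "\<dots> \<le> \<bar>t - y\<bar> * (1 / sqrt \<bar>t - y\<bar>)"
          by (intro mult_left_mono green_le_inverse_sqrt) auto
        also have "\<dots> = sqrt \<bar>t - y\<bar>" by (simp add: real_div_sqrt)
        finally show ?thesis .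
      qed
      then show "\<forall>\<^sub>F t in at y. norm ((t - y) * green t y) \<le> sqrt \<bar>t - y\<bar>" by simp
      have "((\<lambda>t. sqrt \<bar>t - y\<bar>) \<longlongrightarrow> sqrt \<bar>y - y\<bar>) (at y)" by (intro tendsto_intros)
      then show "((\<lambda>t. sqrt \<bar>t - y\<bar>) \<longlongrightarrow> 0) (at y)" by simp
    qed
    then show ?thesis using True by (simp add: isCont_def)
  qed
qed

text \<open>Integration by parts: in the derivative of \<open>(t - y) * green t y\<close> the pole
  cancels and leaves \<open>- semicircle y / (pi * semicircle t)\<close>, which the
  \<open>arcsin\<close> term removes.\<close>

definition green_primitive :: "real \<Rightarrow> real \<Rightarrow> real" where
  "green_primitive y t = (t - y) * green t y + semicircle y / pi * arcsin t"

lemma green_has_integral: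
  assumes y: "\<bar>y\<bar> < 1" and ab: "-1 \<le> a" "a \<le> b" "b \<le> 1"
  shows "((\<lambda>t. green t y) has_integral (green_primitive y b - green_primitive y a)) {a..b}"
proof (rule fundamental_theorem_of_calculus_interior_strong[of "{y}"])
  show "a \<le> b" by fact
  show "continuous_on {a..b} (green_primitive y)"
    unfolding green_primitive_def
    using ab by (intro continuous_intros continuous_on_mult_green y) auto
  fix t assume "t \<in> {a<..<b} - {y}"
  then have t: "\<bar>t\<bar> < 1" "t \<noteq> y" using ab by auto
  have "0 < 1 - t\<^sup>2" using t by (simp add: abs_square_less_1)
  then have Q: "semicircle t = sqrt (1 - t\<^sup>2)" "0 < sqrt (1 - t\<^sup>2)"
    using t by (auto simp: semicircle_eq)
  have "((\<lambda>t. (t - y) * green t y + semicircle y / pi * arcsin t) has_real_derivative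
      (green t y + (t - y) * (- (semicircle y / (pi * semicircle t * (t - y)))) +
        semicircle y / pi * inverse (sqrt (1 - t\<^sup>2)))) (at t)"
    using t y by (auto intro!: derivative_eq_intros green_has_derivative DERIV_arcsin)
  moreover have "green t y + (t - y) * (- (semicircle y / (pi * semicircle t * (t - y)))) +
        semicircle y / pi * inverse (sqrt (1 - t\<^sup>2)) = green t y"
  proof -
    define q where "q = sqrt (1 - t\<^sup>2)"
    have "0 < q" using Q by (simp add: q_def)
    then have "(t - y) * (semicircle y / (pi * q * (t - y))) = semicircle y / pi * inverse q"
      using t by (simp add: field_simps)
    then show ?thesis unfolding Q(1) q_def[symmetric] by simp
  qed
  ultimately show "(green_primitive y has_vector_derivative green t y) (at t)"
    unfolding green_primitive_def has_real_derivative_iff_has_vector_derivative[symmetric]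
    by simp
qed auto

lemma has_bochner_integral_of_has_integral:
  fixes f :: "real \<Rightarrow> real"
  assumes "f \<in> borel_measurable borel" "\<And>x. x \<in> S \<Longrightarrow> 0 \<le> f x" "(f has_integral I) S" "S \<in> sets borel"
  shows "has_bochner_integral lborel (\<lambda>x. indicator S x * f x) I"
proof (rule has_bochner_integral_nn_integral)
  show "0 \<le> I" using has_integral_nonneg[OF assms(3,2)] .
  show "(\<integral>\<^sup>+x. ennreal (indicator S x * f x) \<partial>lborel) = ennreal I"
    using nn_integral_has_integral_lebesgue[OF assms(2,3)] by simp
  show "AE x in lborel. 0 \<le> indicator S x * f x"
    using assms(2) by (auto simp: indicator_def)
  show "(\<lambda>x. indicator S x * f x) \<in> borel_measurable lborel"
    using assms(1,4) by measurable
qed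

lemma green_primitive_1 [simp]: "green_primitive y 1 = semicircle y / 2"
  by (simp add: green_primitive_def green_outside)

lemma green_primitive_m1 [simp]: "green_primitive y (-1) = - semicircle y / 2"
  by (simp add: green_primitive_def green_outside arcsin_minus_1)

lemma has_bochner_integral_green_Icc:
  assumes y: "\<bar>y\<bar> < 1" and ab: "-1 \<le> a" "a \<le> b" "b \<le> 1"
  shows "has_bochner_integral lborel (\<lambda>t. indicator {a..b} t * green t y)
           (green_primitive y b - green_primitive y a)"
  by (intro has_bochner_integral_of_has_integral green_has_integral y ab) auto

text \<open>At the endpoints \<open>green\<close> vanishes and only the \<open>arcsin\<close> term
  of the primitive survives, where \<open>arcsin\<close> increases by \<pi> in total. Thus
  \<open>semicircle\<close> is the potential of the constant density 1, and
  \<open>green_op_bound\<close> is comparison with it.\<close>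

lemma has_bochner_integral_green: "has_bochner_integral lborel (\<lambda>t. green t y) (semicircle y)"
proof (cases "\<bar>y\<bar> < 1")
  case True
  have "(\<lambda>t. indicator {-1..1} t * green t y) = (\<lambda>t. green t y)"
  proof
    fix t show "indicator {-1..1} t * green t y = green t y"
      by (cases "t \<in> {-1..1}") (auto simp: green_outside)
  qed
  then show ?thesis using has_bochner_integral_green_Icc[OF True, of "-1" 1] by simp
next
  case False
  then show ?thesis
    using has_bochner_integral_zero[of lborel] by (simp add: green_outside' semicircle_outside)
qed

lemma integrable_green [simp]: "integrable lborel (\<lambda>t. green t y)"
  and integral_green [simp]: "(\<integral>t. green t y \<partial>lborel) = semicircle y"
  using has_bochner_integral_green[of y] by (auto simp: has_bochner_integral_iff)

lemma integrable_green' [simp]: "integrable lborel (\<lambda>t. green y t)"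
  and integral_green' [simp]: "(\<integral>t. green y t \<partial>lborel) = semicircle y"
  unfolding green_sym[of y] by simp_all

section \<open>Modulus of continuity of the Green function in the L1 norm\<close>

lemma semicircle_holder: "\<bar>semicircle x - semicircle y\<bar> \<le> sqrt 2 * sqrt \<bar>x - y\<bar>"
proof -
  have *: "semicircle x - semicircle y \<le> sqrt 2 * sqrt \<bar>x - y\<bar>" for x y
  proof (cases "\<bar>x\<bar> < 1")
    case False
    then have "semicircle x = 0" by (simp add: semicircle_outside)
    moreover have "0 \<le> sqrt 2 * sqrt \<bar>x - y\<bar>" by simp
    ultimately show ?thesis using semicircle_nonneg[of y] by linarith
  next
    case True
    have "1 - x\<^sup>2 \<le> max 0 (1 - y\<^sup>2) + 2 * \<bar>x - y\<bar>"
    proof (cases "\<bar>y\<bar> \<le> 1")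
      case y: True
      have "y\<^sup>2 - x\<^sup>2 \<le> \<bar>y - x\<bar> * \<bar>y + x\<bar>"
        by (metis abs_ge_self abs_mult power2_eq_square square_diff_square_factored mult.commute)
      also have "\<dots> \<le> \<bar>y - x\<bar> * 2" using y True by (intro mult_left_mono) auto
      finally show ?thesis by (simp add: abs_minus_commute)
    next
      case y: False
      have "1 - x\<^sup>2 = (1 - \<bar>x\<bar>) * (1 + \<bar>x\<bar>)" by (simp add: power2_eq_square algebra_simps)
      also have "\<dots> \<le> (1 - \<bar>x\<bar>) * 2" using True by (intro mult_left_mono) auto
      also have "\<dots> \<le> 2 * \<bar>x - y\<bar>"
        using y abs_triangle_ineq2[of y x] by (simp add: abs_minus_commute)
      finally show ?thesis by auto
    qed
    then have "semicircle x \<le> sqrt (max 0 (1 - y\<^sup>2) + 2 * \<bar>x - y\<bar>)"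
      unfolding semicircle_def by (intro real_sqrt_le_mono) auto
    also have "\<dots> \<le> sqrt (max 0 (1 - y\<^sup>2)) + sqrt (2 * \<bar>x - y\<bar>)"
      by (intro sqrt_add_le_add_sqrt) auto
    finally show ?thesis by (simp add: semicircle_def real_sqrt_mult)
  qed
  show ?thesis using *[of x y] *[of y x] by (auto simp: abs_le_iff abs_minus_commute)
qed

text \<open>From sin w \<ge> w cos w at w = z/2 and the double angle formula;
  \<open>(cos w)\<^sup>2\<close> is at least 1/2 because cos z is nonnegative.\<close>

lemma half_le_sin:
  assumes "0 \<le> z" "z \<le> pi / 2"
  shows "z / 2 \<le> sin z"
proof -
  define w where "w = z / 2"
  have w: "0 \<le> w" "w \<le> pi / 4" using assms by (auto simp: w_def)
  have "sin 0 - 0 * cos 0 \<le> sin w - w * cos w"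
  proof (rule DERIV_nonneg_imp_nondecreasing[OF w(1)])
    fix v assume v: "0 \<le> v" "v \<le> w"
    have "((\<lambda>v. sin v - v * cos v) has_real_derivative v * sin v) (at v)"
      by (auto intro!: derivative_eq_intros)
    moreover have "0 \<le> v * sin v"
      using v w pi_gt_zero by (intro mult_nonneg_nonneg sin_ge_zero) linarith+
    ultimately show "\<exists>d. ((\<lambda>v. sin v - v * cos v) has_real_derivative d) (at v) \<and> 0 \<le> d"
      by blast
  qed
  then have *: "w * cos w \<le> sin w" by simp
  have c: "0 \<le> cos w" using w pi_gt_zero by (intro cos_ge_zero) linarith+
  have "0 \<le> cos z" using assms by (intro cos_ge_zero) auto
  then have "1 / 2 \<le> (cos w)\<^sup>2" using cos_double_cos[of w] by (simp add: w_def)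
  then have "w * (1 / 2) \<le> w * (cos w)\<^sup>2" using w by (intro mult_left_mono)
  also have "\<dots> \<le> sin w * cos w"
    using mult_right_mono[OF * c] by (simp add: power2_eq_square mult_ac)
  finally show ?thesis using sin_double[of w] by (simp add: w_def)
qed

text \<open>The slope of arcsin blows up at the endpoints, so the bound must be of square root type.
  With D the difference and m the mean of the two angles, y - x is 2 sin (D/2) cos m. As
  \<bar>m\<bar> is at most \<pi>/2 - D/2, the cosine is at least sin (D/2), and y - x dominates
  \<open>(D / 4)\<^sup>2\<close>.\<close>

lemma arcsin_holder:
  assumes "-1 \<le> x" "x \<le> y" "y \<le> 1"
  shows "arcsin y - arcsin x \<le> 4 * sqrt (y - x)"
proof -
  define D where "D = arcsin y - arcsin x"
  have b: "-pi/2 \<le> arcsin x" "arcsin x \<le> arcsin y" "arcsin y \<le> pi/2"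
    using assms arcsin_lbound[of x] arcsin_ubound[of y] by (auto intro!: arcsin_le_arcsin)
  then have D: "0 \<le> D" "D \<le> pi" by (auto simp: D_def)
  have e: "y - x = 2 * sin (D / 2) * cos ((arcsin y + arcsin x) / 2)"
    using sin_diff_sin[of "arcsin y" "arcsin x"] assms by (simp add: D_def)
  have s0: "0 \<le> sin (D/2)" using D by (intro sin_ge_zero) auto
  have "sin (D/2) \<le> cos ((arcsin y + arcsin x) / 2)"
  proof -
    have "sin (D/2) = cos (pi/2 - D/2)" by (simp add: sin_cos_eq)
    also have "\<dots> \<le> cos \<bar>(arcsin y + arcsin x) / 2\<bar>"
    proof (rule cos_monotone_0_pi_le)
      show "\<bar>(arcsin y + arcsin x) / 2\<bar> \<le> pi / 2 - D / 2"
        using b by (simp add: D_def abs_le_iff) argo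
    qed (use D in auto)
    finally show ?thesis by (simp only: cos_abs_real)
  qed
  then have "2 * (sin (D/2))\<^sup>2 \<le> y - x"
    unfolding e power2_eq_square using s0 by (simp add: mult_left_mono)
  moreover have "(D / 4)\<^sup>2 \<le> (sin (D/2))\<^sup>2"
    using half_le_sin[of "D/2"] D by (intro power_mono) auto
  ultimately have "(D / 4)\<^sup>2 \<le> y - x" using zero_le_power2[of "D/4"] by linarith
  then have "D / 4 \<le> sqrt (y - x)" by (rule real_le_rsqrt)
  then show ?thesis by (simp add: D_def field_simps)
qed

lemma green_antimono:
  assumes y: "\<bar>y\<bar> < 1" and "y < a" "a \<le> b" "b < 1"
  shows "green b y \<le> green a y"
proof (rule DERIV_nonpos_imp_nonincreasing[of a b])
  show "a \<le> b" by fact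
  fix t assume t: "a \<le> t" "t \<le> b"
  have "0 \<le> semicircle y / (pi * semicircle t * (t - y))"
    using t assms by (intro divide_nonneg_nonneg mult_nonneg_nonneg) auto
  then have "- (semicircle y / (pi * semicircle t * (t - y))) \<le> 0" by simp
  then show "\<exists>d. ((\<lambda>t. green t y) has_real_derivative d) (at t) \<and> d \<le> 0"
    using green_has_derivative[of t y] t assms by fastforce
qed

lemma green_minus: "green (- x) (- y) = green x y"
proof -
  have "unit_clamp (- z) = - unit_clamp z" for z by (auto simp: unit_clamp_def)
  moreover have "semicircle (- z) = semicircle z" for z by (simp add: semicircle_def)
  moreover have "\<bar>- unit_clamp x + unit_clamp y\<bar> = \<bar>unit_clamp x - unit_clamp y\<bar>"
    by (simp add: abs_minus_commute)
  ultimately show ?thesis by (simp add: green_def)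
qed

lemma green_mono:
  assumes y: "\<bar>y\<bar> < 1" and "b < y" "a \<le> b" "-1 < a"
  shows "green a y \<le> green b y"
  using green_antimono[of "- y" "- b" "- a"] assms by (simp add: green_minus)

text \<open>Uniformity up to the endpoints is the point: it makes every potential of a bounded
  density globally Hoelder 1/2. The integral can be taken with exact primitives because monotonicity
  fixes the sign of the difference except for y between x and x', where the sum of the two values is
  used instead.\<close>

lemma integral_green_diff_le:
  "(\<integral>y. \<bar>green x y - green x' y\<bar> \<partial>lborel) \<le> 9 * sqrt \<bar>x - x'\<bar>"
proof -
  have outside: "(\<integral>y. \<bar>green x y - green x' y\<bar> \<partial>lborel) \<le> 9 * sqrt \<bar>x - x'\<bar>"
    if "1 \<le> \<bar>x'\<bar>" for x x'
  proof -
    have "(\<integral>y. \<bar>green x y - green x' y\<bar> \<partial>lborel) = semicircle x"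
      using that by (simp add: green_outside)
    also have "\<dots> \<le> sqrt 2 * sqrt \<bar>x - x'\<bar>"
      using semicircle_holder[of x x'] that by (simp add: semicircle_outside)
    also have "\<dots> \<le> 9 * sqrt \<bar>x - x'\<bar>"
      by (intro mult_right_mono real_le_lsqrt) auto
    finally show ?thesis .
  qed
  have inside: "(\<integral>y. \<bar>green x y - green x' y\<bar> \<partial>lborel) \<le> 9 * sqrt \<bar>x - x'\<bar>"
    if x: "-1 < x" "x < x'" "x' < 1" for x x'
  proof -
    have x1: "\<bar>x\<bar> < 1" "\<bar>x'\<bar> < 1" using x by auto
    let ?P = green_primitive and ?Q = semicircle
    let ?L = "\<lambda>y. indicator {-1..x} y * green y x - indicator {-1..x} y * green y x'
        + (indicator {x..x'} y * green y x + indicator {x..x'} y * green y x')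
        + (indicator {x'..1} y * green y x' - indicator {x'..1} y * green y x)"
    have L: "has_bochner_integral lborel ?L
        ((?P x x - ?P x (-1)) - (?P x' x - ?P x' (-1))
         + ((?P x x' - ?P x x) + (?P x' x' - ?P x' x))
         + ((?P x' 1 - ?P x' x') - (?P x 1 - ?P x x')))"
      using x x1
      by (intro has_bochner_integral_add has_bochner_integral_diff has_bochner_integral_green_Icc) auto
    have "(\<integral>y. \<bar>green x y - green x' y\<bar> \<partial>lborel) \<le> (\<integral>y. ?L y \<partial>lborel)"
    proof (rule integral_mono_AE)
      show "integrable lborel ?L" using L by (rule integrable.intros)
      show "integrable lborel (\<lambda>y. \<bar>green x y - green x' y\<bar>)" by simp
      have "AE y in lborel. y \<noteq> x \<and> y \<noteq> x'"
        using AE_lborel_singleton[of x] AE_lborel_singleton[of x'] by eventually_elim auto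
      then show "AE y in lborel. \<bar>green x y - green x' y\<bar> \<le> ?L y"
      proof eventually_elim
        case (elim y)
        consider "1 \<le> \<bar>y\<bar>" | "\<bar>y\<bar> < 1" "y < x" | "\<bar>y\<bar> < 1" "x < y" "y < x'" | "\<bar>y\<bar> < 1" "x' < y"
          using elim by linarith
        then show ?case
        proof cases
          case 1
          then show ?thesis using x by (auto simp: green_outside' green_outside)
        next
          case 2
          then have "green x' y \<le> green x y" using x by (intro green_antimono) auto
          with 2 x show ?thesis by (auto simp: green_sym[of y])
        next
          case 3
          have "\<bar>green x y - green x' y\<bar> \<le> green x y + green x' y"
            using green_nonneg[of x y] green_nonneg[of x' y] by linarith
          with 3 x show ?thesis by (auto simp: green_sym[of y])
        next
          case 4
          then have "green x y \<le> green x' y" using x by (intro green_mono) auto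
          with 4 x show ?thesis by (auto simp: green_sym[of y])
        qed
      qed
    qed
    \<comment> \<open>The contributions of -1 and 1 cancel. What remains combines
      \<open>(x' - x) * green x' x\<close> with increments of \<open>arcsin\<close> and of
      \<open>semicircle\<close>, each of order \<open>sqrt (x' - x)\<close>.\<close>
    also have "\<dots> = 2 * ?P x x' - 2 * ?P x' x"
      using has_bochner_integral_integral_eq[OF L] by simp
    also have "\<dots> = 4 * ((x' - x) * green x' x) + 2 / pi * (?Q x * (arcsin x' - arcsin x) + (?Q x - ?Q x') * arcsin x)"
      by (simp add: green_primitive_def green_sym[of x x'] field_simps)
    also have "\<dots> \<le> 4 * sqrt (x' - x) + 2 / pi * (1 * (4 * sqrt (x' - x)) + (sqrt 2 * sqrt (x' - x)) * (pi / 2))"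
    proof (intro add_mono mult_left_mono)
      have "(x' - x) * green x' x \<le> (x' - x) * (1 / sqrt \<bar>x' - x\<bar>)"
        using x by (intro mult_left_mono green_le_inverse_sqrt) auto
      also have "\<dots> = sqrt (x' - x)" using x by (simp add: real_div_sqrt)
      finally show "(x' - x) * green x' x \<le> sqrt (x' - x)" .
      show "?Q x * (arcsin x' - arcsin x) \<le> 1 * (4 * sqrt (x' - x))"
        using x by (intro mult_mono semicircle_le_1 arcsin_holder) (auto intro!: arcsin_le_arcsin)
      have "(?Q x - ?Q x') * arcsin x \<le> \<bar>?Q x - ?Q x'\<bar> * \<bar>arcsin x\<bar>"
        by (metis abs_ge_self abs_mult)
      also have "\<dots> \<le> (sqrt 2 * sqrt \<bar>x - x'\<bar>) * (pi / 2)"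
        using x arcsin_lbound[of x] arcsin_ubound[of x]
        by (intro mult_mono semicircle_holder) auto
      finally show "(?Q x - ?Q x') * arcsin x \<le> (sqrt 2 * sqrt (x' - x)) * (pi / 2)"
        using x by simp
    qed auto
    also have "\<dots> = (4 + 8 / pi + sqrt 2) * sqrt (x' - x)" by (simp add: field_simps)
    also have "\<dots> \<le> 9 * sqrt (x' - x)"
    proof (intro mult_right_mono)
      have "sqrt 2 \<le> 3 / 2" by (rule real_le_lsqrt) (auto simp: power2_eq_square)
      moreover have "8 / pi \<le> 8 / 3" using pi_gt3 by (intro divide_left_mono) auto
      ultimately show "4 + 8 / pi + sqrt 2 \<le> 9" by linarith
    qed (use x in auto)
    finally show ?thesis using x by simp
  qed
  consider "1 \<le> \<bar>x\<bar>" | "1 \<le> \<bar>x'\<bar>" | "x = x'" | "-1 < x" "x < x'" "x' < 1" | "-1 < x'" "x' < x" "x < 1"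
    by linarith
  then show ?thesis
  proof cases
    case 1
    then show ?thesis using outside[of x x'] by (simp add: abs_minus_commute)
  next
    case 2
    then show ?thesis by (rule outside)
  next
    case 3
    then show ?thesis by simp
  next
    case 4
    then show ?thesis by (rule inside)
  next
    case 5
    then show ?thesis using inside[of x' x] by (simp add: abs_minus_commute)
  qed
qed

section \<open>Green potentials: bounds, Hoelder continuity, self-adjointness\<close>

definition green_op :: "(real \<Rightarrow> real) \<Rightarrow> real \<Rightarrow> real" where
  "green_op f x = (\<integral>y. green x y * f y \<partial>lborel)"

lemma integrable_green_mult:
  assumes [measurable]: "f \<in> borel_measurable borel" and "\<And>y. \<bar>f y\<bar> \<le> M"
  shows "integrable lborel (\<lambda>y. green x y * f y)"
proof (rule Bochner_Integration.integrable_bound)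
  show "integrable lborel (\<lambda>y. M * green x y)" by simp
  show "AE y in lborel. norm (green x y * f y) \<le> norm (M * green x y)"
  proof (intro AE_I2)
    fix y
    have "\<bar>green x y\<bar> * \<bar>f y\<bar> \<le> \<bar>green x y\<bar> * \<bar>M\<bar>"
      using assms(2)[of y] by (intro mult_left_mono) auto
    then show "norm (green x y * f y) \<le> norm (M * green x y)"
      by (simp add: abs_mult mult.commute)
  qed
qed simp

lemma green_op_outside: "1 \<le> \<bar>x\<bar> \<Longrightarrow> green_op f x = 0"
  by (simp add: green_op_def green_outside)

lemma green_op_const: "green_op (\<lambda>_. c) x = c * semicircle x"
  by (simp add: green_op_def)

lemma green_op_nonneg: "(\<And>y. 0 \<le> f y) \<Longrightarrow> 0 \<le> green_op f x"
  unfolding green_op_def by (intro integral_nonneg_AE) auto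

lemma green_op_diff:
  assumes "f \<in> borel_measurable borel" "\<And>y. \<bar>f y\<bar> \<le> M"
    and "g \<in> borel_measurable borel" "\<And>y. \<bar>g y\<bar> \<le> N"
  shows "green_op (\<lambda>y. f y - g y) x = green_op f x - green_op g x"
  unfolding green_op_def right_diff_distrib
  by (intro Bochner_Integration.integral_diff integrable_green_mult[OF assms(1,2)] integrable_green_mult[OF assms(3,4)])

lemma green_op_cmult: "green_op (\<lambda>y. c * f y) x = c * green_op f x"
  unfolding green_op_def by (simp add: mult.left_commute)

lemma green_op_mono:
  assumes "f \<in> borel_measurable borel" "\<And>y. \<bar>f y\<bar> \<le> M"
    and "g \<in> borel_measurable borel" "\<And>y. \<bar>g y\<bar> \<le> N" and "\<And>y. \<bar>y\<bar> < 1 \<Longrightarrow> f y \<le> g y"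
  shows "green_op f x \<le> green_op g x"
  unfolding green_op_def
proof (intro integral_mono integrable_green_mult[OF assms(1,2)] integrable_green_mult[OF assms(3,4)])
  fix y show "green x y * f y \<le> green x y * g y"
    using assms(5)[of y] by (cases "\<bar>y\<bar> < 1") (auto intro!: mult_left_mono simp: green_outside')
qed

lemma green_op_bound:
  assumes "f \<in> borel_measurable borel" "\<And>y. \<bar>f y\<bar> \<le> M"
  shows "\<bar>green_op f x\<bar> \<le> M * semicircle x"
proof -
  have le: "f y \<le> M" "- M \<le> f y" for y using assms(2)[of y] by auto
  have "green_op f x \<le> green_op (\<lambda>_. M) x" "green_op (\<lambda>_. - M) x \<le> green_op f x"
    using le by (intro green_op_mono[OF assms, of _ "\<bar>M\<bar>"] green_op_mono[OF _ _ assms, of _ "\<bar>M\<bar>"]; simp)+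
  then show ?thesis by (simp add: green_op_const)
qed

lemma green_op_holder:
  assumes [measurable]: "f \<in> borel_measurable borel" and M: "\<And>y. \<bar>f y\<bar> \<le> M"
  shows "\<bar>green_op f x - green_op f x'\<bar> \<le> 9 * M * sqrt \<bar>x - x'\<bar>"
proof -
  note i = integrable_green_mult[OF assms]
  have "green_op f x - green_op f x' = (\<integral>y. (green x y - green x' y) * f y \<partial>lborel)"
    unfolding green_op_def left_diff_distrib by (intro Bochner_Integration.integral_diff[symmetric] i)
  also have "\<bar>\<dots>\<bar> \<le> (\<integral>y. \<bar>(green x y - green x' y) * f y\<bar> \<partial>lborel)"
    by (rule integral_abs_bound)
  also have "\<dots> \<le> (\<integral>y. \<bar>green x y - green x' y\<bar> * M \<partial>lborel)"
  proof (rule integral_mono)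
    show "integrable lborel (\<lambda>y. \<bar>(green x y - green x' y) * f y\<bar>)"
      unfolding left_diff_distrib by (intro integrable_abs Bochner_Integration.integrable_diff i)
    show "\<bar>(green x y - green x' y) * f y\<bar> \<le> \<bar>green x y - green x' y\<bar> * M" for y
      using M[of y] by (simp add: abs_mult mult_left_mono)
  qed simp
  also have "\<dots> = (\<integral>y. \<bar>green x y - green x' y\<bar> \<partial>lborel) * M" by simp
  also have "\<dots> \<le> (9 * sqrt \<bar>x - x'\<bar>) * M"
    using M[of 0] by (intro mult_right_mono integral_green_diff_le) auto
  finally show ?thesis by (simp add: mult_ac)
qed

lemma continuous_on_of_holder:
  fixes u :: "real \<Rightarrow> real"
  assumes "\<And>x y. \<bar>u x - u y\<bar> \<le> C * sqrt \<bar>x - y\<bar>"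
  shows "continuous_on S u"
proof (rule continuous_at_imp_continuous_on, rule ballI)
  fix x
  have "((\<lambda>y. u y - u x) \<longlongrightarrow> 0) (at x)"
  proof (rule Lim_null_comparison)
    show "\<forall>\<^sub>F y in at x. norm (u y - u x) \<le> C * sqrt \<bar>y - x\<bar>" using assms by simp
    have "((\<lambda>y. C * sqrt \<bar>y - x\<bar>) \<longlongrightarrow> C * sqrt \<bar>x - x\<bar>) (at x)" by (intro tendsto_intros)
    then show "((\<lambda>y. C * sqrt \<bar>y - x\<bar>) \<longlongrightarrow> 0) (at x)" by simp
  qed
  then show "isCont u x" unfolding isCont_def by (subst LIM_zero_iff[symmetric])
qed

lemma continuous_on_green_op:
  assumes "f \<in> borel_measurable borel" "\<And>y. \<bar>f y\<bar> \<le> M"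
  shows "continuous_on S (green_op f)"
  by (rule continuous_on_of_holder[OF green_op_holder[OF assms]])

lemma borel_measurable_green_op:
  assumes "f \<in> borel_measurable borel" "\<And>y. \<bar>f y\<bar> \<le> M"
  shows "green_op f \<in> borel_measurable borel"
  by (intro borel_measurable_continuous_onI continuous_on_green_op[OF assms])

lemma integrable_bounded_on_unit:
  fixes f :: "real \<Rightarrow> real"
  assumes [measurable]: "f \<in> borel_measurable borel" and M: "\<And>y. \<bar>f y\<bar> \<le> M"
    and "\<And>y. 1 < \<bar>y\<bar> \<Longrightarrow> f y = 0"
  shows "integrable lborel f"
proof (rule Bochner_Integration.integrable_bound)
  show "integrable lborel (\<lambda>y. indicator {-1..1::real} y * M)" by (intro integrable_mult_left) simp
  show "AE y in lborel. norm (f y) \<le> norm (indicator {-1..1::real} y * M)"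
  proof (intro AE_I2)
    fix y show "norm (f y) \<le> norm (indicator {-1..1::real} y * M)"
      using M[of y] assms(3)[of y] by (cases "y \<in> {-1..1}") auto
  qed
qed simp

lemma integrable_semicircle [simp]: "integrable lborel semicircle"
  by (rule integrable_bounded_on_unit[where M=1]) (auto simp: semicircle_le_1 semicircle_outside)

lemma integrable_green_prod:
  assumes [measurable]: "f \<in> borel_measurable borel" and M: "\<And>y. \<bar>f y\<bar> \<le> M"
    and [measurable]: "g \<in> borel_measurable borel" and N: "\<And>y. \<bar>g y\<bar> \<le> N"
  shows "integrable (lborel \<Otimes>\<^sub>M lborel) (\<lambda>(x, y). g x * (green x y * f y))"
proof (rule lborel_pair.Fubini_integrable)
  show "(\<lambda>(x, y). g x * (green x y * f y)) \<in> borel_measurable (lborel \<Otimes>\<^sub>M lborel)"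
    by measurable
  show "AE x in lborel. integrable lborel (\<lambda>y. case (x, y) of (x, y) \<Rightarrow> g x * (green x y * f y))"
    using integrable_green_mult[OF assms(1,2)] by simp
  have eq: "(\<integral>y. norm (case (x, y) of (x, y) \<Rightarrow> g x * (green x y * f y)) \<partial>lborel)
     = \<bar>g x\<bar> * green_op (\<lambda>y. \<bar>f y\<bar>) x" for x
    by (simp add: abs_mult green_op_def)
  show "integrable lborel (\<lambda>x. \<integral>y. norm (case (x, y) of (x, y) \<Rightarrow> g x * (green x y * f y)) \<partial>lborel)"
    unfolding eq
  proof (rule integrable_bounded_on_unit[where M="N * (M * 1)"])
    have [measurable]: "green_op (\<lambda>y. \<bar>f y\<bar>) \<in> borel_measurable borel"
      by (rule borel_measurable_green_op[where M=M]) (use M in auto)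
    show "(\<lambda>x. \<bar>g x\<bar> * green_op (\<lambda>y. \<bar>f y\<bar>) x) \<in> borel_measurable borel" by measurable
    fix y
    have "\<bar>green_op (\<lambda>y. \<bar>f y\<bar>) y\<bar> \<le> M * semicircle y"
      by (rule green_op_bound) (use M in auto)
    also have "\<dots> \<le> M * 1" using M[of 0] by (intro mult_left_mono semicircle_le_1) auto
    finally show "\<bar>\<bar>g y\<bar> * green_op (\<lambda>y. \<bar>f y\<bar>) y\<bar> \<le> N * (M * 1)"
      unfolding abs_mult using N[of y] by (intro mult_mono) auto
  qed (auto simp: green_op_outside)
qed

lemma integrable_mult_green_op:
  assumes "f \<in> borel_measurable borel" "\<And>y. \<bar>f y\<bar> \<le> M"
    and "g \<in> borel_measurable borel" "\<And>y. \<bar>g y\<bar> \<le> N"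
  shows "integrable lborel (\<lambda>x. g x * green_op f x)"
  using lborel_pair.integrable_fst'[OF integrable_green_prod[OF assms]] by (simp add: green_op_def)

lemma green_op_selfadjoint:
  assumes "f \<in> borel_measurable borel" "\<And>y. \<bar>f y\<bar> \<le> M"
    and "g \<in> borel_measurable borel" "\<And>y. \<bar>g y\<bar> \<le> N"
  shows "(\<integral>x. g x * green_op f x \<partial>lborel) = (\<integral>x. f x * green_op g x \<partial>lborel)"
proof -
  have "(\<integral>x. g x * green_op f x \<partial>lborel) = (\<integral>x. (\<integral>y. g x * (green x y * f y) \<partial>lborel) \<partial>lborel)"
    by (simp add: green_op_def)
  also have "\<dots> = (\<integral>y. (\<integral>x. g x * (green x y * f y) \<partial>lborel) \<partial>lborel)"
    by (rule lborel_pair.Fubini_integral[symmetric]) (rule integrable_green_prod[OF assms])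
  also have "\<dots> = (\<integral>y. f y * green_op g y \<partial>lborel)"
    unfolding green_op_def by (simp add: mult_ac green_sym flip: integral_mult_right_zero)
  finally show ?thesis .
qed

section \<open>The half-Laplacian of a Green potential\<close>

lemma has_pv_integral_diff:
  assumes "has_pv_integral f x L" "has_pv_integral g x K"
  shows "has_pv_integral (\<lambda>y. f y - g y) x (L - K)"
  unfolding has_pv_integral_def
proof (intro conjI allI impI)
  note f = assms(1)[unfolded has_pv_integral_def] and g = assms(2)[unfolded has_pv_integral_def]
  fix \<epsilon> :: real assume "0 < \<epsilon>"
  then show "set_integrable lborel {y. \<epsilon> < \<bar>y - x\<bar>} (\<lambda>y. f y - g y)"
    using f g by (intro set_integral_diff) auto
next
  note f = assms(1)[unfolded has_pv_integral_def] and g = assms(2)[unfolded has_pv_integral_def]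
  have "\<forall>\<^sub>F \<epsilon> in at_right 0. (LINT y:{y. \<epsilon> < \<bar>y - x\<bar>}|lborel. f y) - (LINT y:{y. \<epsilon> < \<bar>y - x\<bar>}|lborel. g y)
      = (LINT y:{y. \<epsilon> < \<bar>y - x\<bar>}|lborel. f y - g y)"
    using eventually_at_right_less[of "0::real"]
  proof eventually_elim
    case (elim \<epsilon>)
    then show ?case using f g by (intro set_integral_diff(2)[symmetric]) auto
  qed
  then show "((\<lambda>\<epsilon>. LINT y:{y. \<epsilon> < \<bar>y - x\<bar>}|lborel. f y - g y) \<longlongrightarrow> L - K) (at_right 0)"
    by (rule Lim_transform_eventually[rotated]) (use f g in \<open>auto intro!: tendsto_diff\<close>)
qed

lemma has_half_laplacian_diff:
  assumes "has_half_laplacian u x l" "has_half_laplacian v x m"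
  shows "has_half_laplacian (\<lambda>y. u y - v y) x (l - m)"
proof -
  obtain L where L: "has_pv_integral (\<lambda>y. (u x - u y) / (x - y)\<^sup>2) x L" "l = 1 / pi * L"
    using assms(1) unfolding has_half_laplacian_def by blast
  obtain M where M: "has_pv_integral (\<lambda>y. (v x - v y) / (x - y)\<^sup>2) x M" "m = 1 / pi * M"
    using assms(2) unfolding has_half_laplacian_def by blast
  have "(\<lambda>y. (u x - u y) / (x - y)\<^sup>2 - (v x - v y) / (x - y)\<^sup>2)
      = (\<lambda>y. ((u x - v x) - (u y - v y)) / (x - y)\<^sup>2)"
    by (simp add: diff_divide_distrib[symmetric] algebra_simps)
  with has_pv_integral_diff[OF L(1) M(1)] show ?thesis
    unfolding has_half_laplacian_def by (intro exI[of _ "L - M"]) (simp add: L M diff_divide_distrib)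
qed

lemma has_half_laplacian_cmult:
  assumes "has_half_laplacian u x l"
  shows "has_half_laplacian (\<lambda>y. c * u y) x (c * l)"
proof -
  obtain L where L: "has_pv_integral (\<lambda>y. (u x - u y) / (x - y)\<^sup>2) x L" "l = 1 / pi * L"
    using assms unfolding has_half_laplacian_def by blast
  have "(\<lambda>y. c * ((u x - u y) / (x - y)\<^sup>2)) = (\<lambda>y. (c * u x - c * u y) / (x - y)\<^sup>2)"
    by (simp add: algebra_simps)
  moreover have "has_pv_integral (\<lambda>y. c * ((u x - u y) / (x - y)\<^sup>2)) x (c * L)"
    unfolding has_pv_integral_def set_integral_mult_right
    using L(1) unfolding has_pv_integral_def by (intro conjI allI impI set_integrable_mult_right tendsto_mult_left) auto
  ultimately show ?thesis
    unfolding has_half_laplacian_def using L(2) by (intro exI[of _ "c * L"]) auto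
qed

section \<open>The truncated inverse square kernel\<close>

lemma has_bochner_integral_inverse_square_tail:
  fixes x \<epsilon> :: real
  assumes e: "0 < \<epsilon>"
  shows "has_bochner_integral lborel (\<lambda>t. indicator {x + \<epsilon>..} t * (1 / (x - t)\<^sup>2)) (1 / \<epsilon>)"
proof (rule has_bochner_integral_nn_integral)
  have "(\<integral>\<^sup>+t. ennreal (1 / (x - t)\<^sup>2) * indicator {x + \<epsilon>..} t \<partial>lborel)
      = ennreal (0 - (- 1 / ((x + \<epsilon>) - x)))"
  proof (rule nn_integral_FTC_atLeast)
    fix t assume "x + \<epsilon> \<le> t"
    then have "t - x \<noteq> 0" using e by auto
    then show "((\<lambda>t. - 1 / (t - x)) has_real_derivative 1 / (x - t)\<^sup>2) (at t)"
      by (auto intro!: derivative_eq_intros simp: power2_eq_square field_simps)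
  next
    have "filterlim (\<lambda>t. - x + t) at_top at_top"
      by (rule filterlim_tendsto_add_at_top[OF tendsto_const filterlim_ident])
    then have "((\<lambda>t. - 1 / (- x + t)) \<longlongrightarrow> 0) at_top"
      by (rule tendsto_divide_0[OF tendsto_const filterlim_at_top_imp_at_infinity])
    then show "((\<lambda>t. - 1 / (t - x)) \<longlongrightarrow> 0) at_top" by simp
  qed auto
  then show "(\<integral>\<^sup>+t. ennreal (indicator {x + \<epsilon>..} t * (1 / (x - t)\<^sup>2)) \<partial>lborel) = ennreal (1 / \<epsilon>)"
    by (simp add: indicator_mult_ennreal mult.commute)
qed (use e in auto)

definition inverse_square_cut :: "real \<Rightarrow> real \<Rightarrow> real \<Rightarrow> real" where
  "inverse_square_cut x \<epsilon> t = indicator {t. \<epsilon> < \<bar>t - x\<bar>} t / (x - t)\<^sup>2"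

lemma borel_measurable_inverse_square_cut [measurable]: "inverse_square_cut x \<epsilon> \<in> borel_measurable borel"
  unfolding inverse_square_cut_def by measurable

lemma inverse_square_cut_le:
  assumes "0 < \<epsilon>" shows "\<bar>inverse_square_cut x \<epsilon> t\<bar> \<le> 1 / \<epsilon>\<^sup>2"
proof (cases "\<epsilon> < \<bar>t - x\<bar>")
  case True
  then have "\<epsilon>\<^sup>2 \<le> \<bar>t - x\<bar>\<^sup>2" using assms by (intro power_mono) auto
  then show ?thesis using assms True
    by (simp add: inverse_square_cut_def power2_commute frac_le)
qed (simp add: inverse_square_cut_def)

lemma has_bochner_integral_inverse_square_cut:
  assumes e: "0 < \<epsilon>"
  shows "has_bochner_integral lborel (inverse_square_cut x \<epsilon>) (2 / \<epsilon>)"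
proof -
  note R = has_bochner_integral_inverse_square_tail[OF e, of x]
  have "has_bochner_integral lborel (\<lambda>t. indicator {- x + \<epsilon>..} (0 + - 1 * t) * (1 / (- x - (0 + - 1 * t))\<^sup>2))
      ((1 / \<epsilon>) /\<^sub>R \<bar>-1\<bar>)"
    using has_bochner_integral_inverse_square_tail[OF e, of "- x"]
    by (subst (asm) lborel_has_bochner_integral_real_affine_iff[where c="-1" and t=0]) simp_all
  then have L: "has_bochner_integral lborel (\<lambda>t. indicator {- x + \<epsilon>..} (- t) * (1 / (t - x)\<^sup>2)) (1 / \<epsilon>)"
    by simp
  have "has_bochner_integral lborel (inverse_square_cut x \<epsilon>) (1 / \<epsilon> + 1 / \<epsilon>)"
  proof (rule has_bochner_integralI_AE[OF has_bochner_integral_add[OF R L]])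
    have "AE t in lborel. t \<noteq> x + \<epsilon> \<and> t \<noteq> x - \<epsilon>"
      using AE_lborel_singleton[of "x + \<epsilon>"] AE_lborel_singleton[of "x - \<epsilon>"] by eventually_elim auto
    then show "AE t in lborel. indicator {x + \<epsilon>..} t * (1 / (x - t)\<^sup>2) + indicator {- x + \<epsilon>..} (- t) * (1 / (t - x)\<^sup>2) =
         inverse_square_cut x \<epsilon> t"
    proof eventually_elim
      case (elim t)
      then show ?case using e
        by (auto simp: inverse_square_cut_def indicator_def power2_commute abs_if split: if_splits)
    qed
  qed simp
  then show ?thesis by simp
qed

lemma integrable_inverse_square_cut:
  assumes e: "0 < \<epsilon>" and [measurable]: "u \<in> borel_measurable borel" and B: "\<And>t. \<bar>u t\<bar> \<le> B"
  shows "integrable lborel (\<lambda>t. inverse_square_cut x \<epsilon> t * u t)"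
proof (rule Bochner_Integration.integrable_bound)
  show "integrable lborel (\<lambda>t. inverse_square_cut x \<epsilon> t * B)"
    using has_bochner_integral_inverse_square_cut[OF e, of x] by (auto intro: integrable.intros)
  show "AE t in lborel. norm (inverse_square_cut x \<epsilon> t * u t) \<le> norm (inverse_square_cut x \<epsilon> t * B)"
  proof (intro AE_I2)
    fix t have "\<bar>u t\<bar> \<le> \<bar>B\<bar>" using B[of t] by linarith
    then show "norm (inverse_square_cut x \<epsilon> t * u t) \<le> norm (inverse_square_cut x \<epsilon> t * B)"
      by (auto simp: abs_mult intro!: mult_left_mono)
  qed
qed simp

text \<open>The kernel has mass \<open>2 / \<epsilon>\<close> outside the \<epsilon>-ball, so for
  bounded u the truncated principal value splits into \<open>2 / \<epsilon> * u x\<close> and a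
  convergent integral; what has to be computed is the limit of their difference.\<close>

lemma has_half_laplacianI:
  assumes [measurable]: "u \<in> borel_measurable borel" and B: "\<And>t. \<bar>u t\<bar> \<le> B"
    and lim: "((\<lambda>\<epsilon>. 2 / \<epsilon> * u x - (\<integral>t. inverse_square_cut x \<epsilon> t * u t \<partial>lborel)) \<longlongrightarrow> pi * l) (at_right 0)"
  shows "has_half_laplacian u x l"
proof -
  have eq: "indicator {y. \<epsilon> < \<bar>y - x\<bar>} t *\<^sub>R ((u x - u t) / (x - t)\<^sup>2)
      = inverse_square_cut x \<epsilon> t * u x - inverse_square_cut x \<epsilon> t * u t" for \<epsilon> t
    by (simp add: inverse_square_cut_def diff_divide_distrib algebra_simps)
  have int: "integrable lborel (\<lambda>t. inverse_square_cut x \<epsilon> t * u t)"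
    "integrable lborel (\<lambda>t. inverse_square_cut x \<epsilon> t * u x)" if "0 < \<epsilon>" for \<epsilon>
    using integrable_inverse_square_cut[OF that assms(1) B] integrable.intros[OF has_bochner_integral_inverse_square_cut[OF that]]
    by simp_all
  have "has_pv_integral (\<lambda>y. (u x - u y) / (x - y)\<^sup>2) x (pi * l)"
    unfolding has_pv_integral_def set_integrable_def set_lebesgue_integral_def eq
  proof (intro conjI allI impI)
    fix \<epsilon> :: real assume "0 < \<epsilon>"
    from int[OF this]
    show "integrable lborel (\<lambda>t. inverse_square_cut x \<epsilon> t * u x - inverse_square_cut x \<epsilon> t * u t)"
      by (intro Bochner_Integration.integrable_diff)
  next
    have "\<forall>\<^sub>F \<epsilon> in at_right 0. 2 / \<epsilon> * u x - (\<integral>t. inverse_square_cut x \<epsilon> t * u t \<partial>lborel)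
      = (\<integral>t. inverse_square_cut x \<epsilon> t * u x - inverse_square_cut x \<epsilon> t * u t \<partial>lborel)"
      using eventually_at_right_less[of "0::real"]
    proof eventually_elim
      case (elim \<epsilon>)
      have "(\<integral>t. inverse_square_cut x \<epsilon> t \<partial>lborel) = 2 / \<epsilon>"
        using has_bochner_integral_inverse_square_cut[OF elim, of x] by (rule has_bochner_integral_integral_eq)
      with int[OF elim] show ?case by simp
    qed
    then show "((\<lambda>\<epsilon>. \<integral>t. inverse_square_cut x \<epsilon> t * u x - inverse_square_cut x \<epsilon> t * u t \<partial>lborel)
        \<longlongrightarrow> pi * l) (at_right 0)"
      by (rule Lim_transform_eventually[OF lim])
  qed
  then show ?thesis unfolding has_half_laplacian_def by (intro exI[of _ "pi * l"]) simp
qed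

text \<open>The interval is cut at x, where N may be singular, so continuity is asked on the two
  truncated pieces separately. The finite set S makes room for the diagonal point y when the
  integrand is \<open>green t y\<close>.\<close>

lemma has_bochner_integral_inverse_square_cut_FTC:
  assumes x: "\<bar>x\<bar> < 1" and e: "0 < \<epsilon>" "\<epsilon> < 1 - \<bar>x\<bar>"
    and [measurable]: "\<phi> \<in> borel_measurable borel" and nonneg: "\<And>t. 0 \<le> \<phi> t"
    and zero: "\<And>t. 1 \<le> \<bar>t\<bar> \<Longrightarrow> \<phi> t = 0" and fin: "finite S"
    and cont: "continuous_on {-1..x - \<epsilon>} N" "continuous_on {x + \<epsilon>..1} N"
    and deriv: "\<And>t. \<bar>t\<bar> < 1 \<Longrightarrow> t \<noteq> x \<Longrightarrow> t \<notin> S \<Longrightarrow> (N has_real_derivative \<phi> t / (x - t)\<^sup>2) (at t)"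
  shows "has_bochner_integral lborel (\<lambda>t. inverse_square_cut x \<epsilon> t * \<phi> t)
           ((N (x - \<epsilon>) - N (-1)) + (N 1 - N (x + \<epsilon>)))"
proof -
  have I: "((\<lambda>t. \<phi> t / (x - t)\<^sup>2) has_integral (N b - N a)) {a..b}"
    if "continuous_on {a..b} N" "a \<le> b" "-1 \<le> a" "b \<le> 1" "x \<notin> {a..b}" for a b
    using that
    by (intro fundamental_theorem_of_calculus_interior_strong[OF fin] that)
       (auto intro!: deriv simp: has_real_derivative_iff_has_vector_derivative[symmetric])
  have L: "has_bochner_integral lborel (\<lambda>t. indicator {-1..x - \<epsilon>} t * (\<phi> t / (x - t)\<^sup>2)) (N (x - \<epsilon>) - N (-1))"
    using x e by (intro has_bochner_integral_of_has_integral I cont) (auto simp: nonneg)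
  have R: "has_bochner_integral lborel (\<lambda>t. indicator {x + \<epsilon>..1} t * (\<phi> t / (x - t)\<^sup>2)) (N 1 - N (x + \<epsilon>))"
    using x e by (intro has_bochner_integral_of_has_integral I cont) (auto simp: nonneg)
  show ?thesis
  proof (rule has_bochner_integralI_AE[OF has_bochner_integral_add[OF L R]])
    have "AE t in lborel. t \<noteq> x + \<epsilon> \<and> t \<noteq> x - \<epsilon>"
      using AE_lborel_singleton[of "x + \<epsilon>"] AE_lborel_singleton[of "x - \<epsilon>"] by eventually_elim auto
    then show "AE t in lborel. indicator {-1..x - \<epsilon>} t * (\<phi> t / (x - t)\<^sup>2) + indicator {x + \<epsilon>..1} t * (\<phi> t / (x - t)\<^sup>2) =
         inverse_square_cut x \<epsilon> t * \<phi> t"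
    proof eventually_elim
      case (elim t)
      show ?case
      proof (cases "1 < \<bar>t\<bar>")
        case True
        then show ?thesis by (simp add: zero)
      next
        case False
        then show ?thesis using elim e
          by (auto simp: inverse_square_cut_def indicator_def abs_if split: if_splits)
      qed
    qed
  qed simp
qed

text \<open>The expression is the difference of the right and the left difference quotient at x,
  which share the limit D.\<close>

lemma second_difference_quotient_tendsto_0:
  assumes "(f has_real_derivative D) (at x)"
  shows "((\<lambda>\<epsilon>. (f (x + \<epsilon>) + f (x - \<epsilon>) - 2 * f x) / \<epsilon>) \<longlongrightarrow> 0) (at_right 0)"
proof -
  have f: "((\<lambda>h. (f (x + h) - f x) / h) \<longlongrightarrow> D) (at 0)" using assms unfolding DERIV_def .
  have R: "((\<lambda>h. (f (x + h) - f x) / h) \<longlongrightarrow> D) (at_right 0)"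
    using f by (rule tendsto_within_subset) simp
  have fl: "filterlim (\<lambda>h::real. - h) (at 0) (at_right 0)"
    unfolding filterlim_at by (auto intro!: tendsto_eq_intros simp: eventually_at_filter)
  have L: "((\<lambda>h. (f (x + - h) - f x) / - h) \<longlongrightarrow> D) (at_right 0)"
    by (rule filterlim_compose[OF f fl])
  have "((\<lambda>h. (f (x + h) - f x) / h - (f (x + - h) - f x) / - h) \<longlongrightarrow> D - D) (at_right 0)"
    by (intro tendsto_diff R L)
  moreover have "(\<lambda>h. (f (x + h) - f x) / h - (f (x + - h) - f x) / - h)
     = (\<lambda>\<epsilon>. (f (x + \<epsilon>) + f (x - \<epsilon>) - 2 * f x) / \<epsilon>)"
    by (auto simp: fun_eq_iff divide_inverse algebra_simps)
  ultimately show ?thesis by simp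
qed

text \<open>The singular terms \<open>ln \<epsilon>\<close> at \<open>x + \<epsilon>\<close> and
  \<open>x - \<epsilon>\<close> are equal and cancel; the logarithm of the numerator is continuous
  at x.\<close>

lemma green_symmetric_difference_tendsto_0:
  assumes x: "\<bar>x\<bar> < 1"
  shows "((\<lambda>\<epsilon>. green (x + \<epsilon>) x - green (x - \<epsilon>) x) \<longlongrightarrow> 0) (at_right 0)"
proof -
  let ?A = "\<lambda>t. ln (1 - t * x + semicircle t * semicircle x) / pi"
  have p: "0 < 1 - x * x + semicircle x * semicircle x"
  proof (rule add_pos_nonneg)
    have "x\<^sup>2 < 1" using x by (simp add: abs_square_less_1)
    then show "0 < 1 - x * x" by (simp add: power2_eq_square)
  qed simp
  have c: "isCont semicircle x"
    using continuous_on_semicircle[of UNIV] by (auto simp: continuous_on_eq_continuous_at)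
  have A: "isCont ?A x"
    unfolding continuous_at using p c
    by (auto intro!: tendsto_intros simp: isCont_def)
  have 1: "((\<lambda>\<epsilon>. ?A (x + \<epsilon>)) \<longlongrightarrow> ?A x) (at_right 0)"
    by (rule isCont_tendsto_compose[OF A]) (auto intro!: tendsto_eq_intros)
  have 2: "((\<lambda>\<epsilon>. ?A (x - \<epsilon>)) \<longlongrightarrow> ?A x) (at_right 0)"
    by (rule isCont_tendsto_compose[OF A]) (auto intro!: tendsto_eq_intros)
  have "((\<lambda>\<epsilon>. ?A (x + \<epsilon>) - ?A (x - \<epsilon>)) \<longlongrightarrow> ?A x - ?A x) (at_right 0)"
    by (intro tendsto_diff 1 2)
  moreover have "\<forall>\<^sub>F \<epsilon> in at_right 0. ?A (x + \<epsilon>) - ?A (x - \<epsilon>) = green (x + \<epsilon>) x - green (x - \<epsilon>) x"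
  proof -
    have "\<forall>\<^sub>F \<epsilon> in at_right 0. \<epsilon> \<in> {0<..<1 - \<bar>x\<bar>}"
      using x by (intro eventually_at_right_real) auto
    then show ?thesis
    proof eventually_elim
      case (elim \<epsilon>)
      then have "\<bar>x + \<epsilon>\<bar> \<le> 1" "\<bar>x - \<epsilon>\<bar> \<le> 1" "0 < \<epsilon>" by auto
      then show ?case using x
        by (simp add: green_eq[of "x + \<epsilon>"] green_eq[of "x - \<epsilon>"] diff_divide_distrib)
    qed
  qed
  ultimately show ?thesis by (auto intro: Lim_transform_eventually)
qed

section \<open>Half-Laplacians by explicit antiderivatives\<close>

lemma semicircle_has_derivative:
  assumes t: "\<bar>t\<bar> < 1"
  shows "(semicircle has_real_derivative - t / semicircle t) (at t)"
proof -
  have t2: "0 < 1 - t\<^sup>2" using t by (simp add: abs_square_less_1)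
  have d: "((\<lambda>t. sqrt (1 - t\<^sup>2)) has_real_derivative - t / sqrt (1 - t\<^sup>2)) (at t)"
    using t2 by (auto intro!: derivative_eq_intros simp: field_simps)
  show ?thesis
  proof (rule has_field_derivative_transform_within_open[of _ _ _ "{-1<..<1}"])
    show "((\<lambda>t. sqrt (1 - t\<^sup>2)) has_real_derivative - t / semicircle t) (at t)"
      using d t by (simp add: semicircle_eq)
  qed (use t in \<open>auto simp: semicircle_eq\<close>)
qed

lemma arcsin_has_derivative:
  assumes t: "\<bar>t\<bar> < 1"
  shows "(arcsin has_real_derivative 1 / semicircle t) (at t)"
  unfolding semicircle_eq[OF less_imp_le[OF t]]
  using DERIV_arcsin[of t] t by (simp add: divide_inverse)

text \<open>An explicit antiderivative evaluates the truncated integral. The second difference of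
  \<open>semicircle\<close> and the symmetric differences of \<open>arcsin\<close> and
  \<open>green\<close> vanish in the limit, and what is left is the increment \<pi> of
  \<open>arcsin\<close> over [-1,1]. For a general density this case handles the constant
  part.\<close>

lemma has_half_laplacian_semicircle:
  assumes x: "\<bar>x\<bar> < 1"
  shows "has_half_laplacian semicircle x 1"
proof (rule has_half_laplacianI[where B=1])
  let ?Q = semicircle
  \<comment> \<open>Found by parts: the derivative of \<open>semicircle\<close> brings in
    \<open>- t / (semicircle t * (t - x))\<close>, which equals
    \<open>- 1 / semicircle t - x / (semicircle t * (t - x))\<close>. The first part integrates to
    \<open>- arcsin t\<close>, the second to a multiple of \<open>green t x\<close> by
    \<open>green_has_derivative\<close>.\<close>
  define N where "N = (\<lambda>t. - (?Q t / (t - x)) - arcsin t + pi * x / ?Q x * green t x)"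
  have Qx: "0 < ?Q x" by (rule semicircle_pos[OF x])
  have val: "(\<integral>t. inverse_square_cut x \<epsilon> t * ?Q t \<partial>lborel) = N (x - \<epsilon>) - N (-1) + (N 1 - N (x + \<epsilon>))"
    if e: "0 < \<epsilon>" "\<epsilon> < 1 - \<bar>x\<bar>" for \<epsilon>
  proof (rule has_bochner_integral_integral_eq, rule has_bochner_integral_inverse_square_cut_FTC[where S="{}", OF x e])
    have cont: "continuous_on T N" if "x \<notin> T" "T \<subseteq> {-1..1}" for T
    proof -
      have "continuous_on T (\<lambda>t. green t x)"
        using that by (intro continuous_at_imp_continuous_on ballI isCont_green[OF x]) auto
      with that show ?thesis unfolding N_def
        by (intro continuous_intros continuous_on_semicircle) auto
    qed
    show "continuous_on {-1..x - \<epsilon>} N" "continuous_on {x + \<epsilon>..1} N"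
      using e x by (auto intro!: cont)
    fix t assume t: "\<bar>t\<bar> < 1" "t \<noteq> x"
    have Qt: "0 < ?Q t" by (rule semicircle_pos[OF t(1)])
    have "(N has_real_derivative
        (- ((- t / ?Q t * (t - x) - ?Q t * (1 - 0)) / ((t - x) * (t - x))) - 1 / ?Q t
          + pi * x / ?Q x * - (?Q x / (pi * ?Q t * (t - x))))) (at t)"
      unfolding N_def using t x
      by (intro DERIV_add DERIV_diff DERIV_minus DERIV_divide DERIV_cmult semicircle_has_derivative
          arcsin_has_derivative green_has_derivative DERIV_ident DERIV_const) auto
    moreover have "- ((- (x + d) / q * d - q * (1 - 0)) / (d * d)) - 1 / q + pi * x / p * - (p / (pi * q * d)) = q / (d * d)"
      if "d \<noteq> 0" "q \<noteq> 0" "p \<noteq> 0" for d q p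
    proof -
      have "pi * x / p * - (p / (pi * q * d)) = - (x / (q * d))" using that by simp
      then show ?thesis using that by (simp add: field_simps)
    qed
    from this[of "t - x" "?Q t" "?Q x"]
    have "- ((- t / ?Q t * (t - x) - ?Q t * (1 - 0)) / ((t - x) * (t - x))) - 1 / ?Q t
          + pi * x / ?Q x * - (?Q x / (pi * ?Q t * (t - x))) = ?Q t / (t - x)\<^sup>2"
      using t Qt Qx by (simp add: power2_eq_square)
    ultimately show "(N has_real_derivative ?Q t / (x - t)\<^sup>2) (at t)"
      by (simp only: power2_commute[of x t])
  qed (auto simp: semicircle_outside)
  have "\<forall>\<^sub>F \<epsilon> in at_right 0. pi - (?Q (x + \<epsilon>) + ?Q (x - \<epsilon>) - 2 * ?Q x) / \<epsilon> - (arcsin (x + \<epsilon>) - arcsin (x - \<epsilon>))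
          + pi * x / ?Q x * (green (x + \<epsilon>) x - green (x - \<epsilon>) x)
      = 2 / \<epsilon> * ?Q x - (\<integral>t. inverse_square_cut x \<epsilon> t * ?Q t \<partial>lborel)"
  proof -
    have "\<forall>\<^sub>F \<epsilon> in at_right 0. \<epsilon> \<in> {0<..<1 - \<bar>x\<bar>}"
      using x by (intro eventually_at_right_real) auto
    then show ?thesis
    proof eventually_elim
      case (elim \<epsilon>)
      then show ?case
        by (simp add: val N_def semicircle_outside green_outside arcsin_minus_1 add_divide_distrib diff_divide_distrib
            right_diff_distrib)
    qed
  qed
  moreover have "((\<lambda>\<epsilon>. pi - (?Q (x + \<epsilon>) + ?Q (x - \<epsilon>) - 2 * ?Q x) / \<epsilon> - (arcsin (x + \<epsilon>) - arcsin (x - \<epsilon>))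
          + pi * x / ?Q x * (green (x + \<epsilon>) x - green (x - \<epsilon>) x)) \<longlongrightarrow> pi - 0 - (arcsin x - arcsin x) + pi * x / ?Q x * 0) (at_right 0)"
  proof (intro tendsto_add tendsto_diff tendsto_mult tendsto_const green_symmetric_difference_tendsto_0 x
       second_difference_quotient_tendsto_0[OF semicircle_has_derivative[OF x]])
    have c: "isCont arcsin x" using arcsin_has_derivative[OF x] by (rule DERIV_isCont)
    show "((\<lambda>\<epsilon>. arcsin (x + \<epsilon>)) \<longlongrightarrow> arcsin x) (at_right 0)" "((\<lambda>\<epsilon>. arcsin (x - \<epsilon>)) \<longlongrightarrow> arcsin x) (at_right 0)"
      by (rule isCont_tendsto_compose[OF c]; auto intro!: tendsto_eq_intros)+
  qed
  ultimately show "((\<lambda>\<epsilon>. 2 / \<epsilon> * ?Q x - (\<integral>t. inverse_square_cut x \<epsilon> t * ?Q t \<partial>lborel)) \<longlongrightarrow> pi * 1) (at_right 0)"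
    by (auto intro: Lim_transform_eventually)
qed (auto simp: semicircle_le_1)

text \<open>By self-adjointness this is the function that a density is paired with when its
  potential is integrated against the truncated kernel. N is an antiderivative of
  \<open>green t y / (t - x)\<^sup>2\<close>: integrate by parts and split
  \<open>1 / ((t - y) * (t - x))\<close> into partial fractions, each of which is, up to factors, a
  derivative of \<open>green\<close> in its first argument.\<close>

lemma green_op_inverse_square_cut:
  assumes x: "\<bar>x\<bar> < 1" and y: "\<bar>y\<bar> < 1" "y \<noteq> x" and e: "0 < \<epsilon>" "\<epsilon> < 1 - \<bar>x\<bar>"
  defines "N \<equiv> \<lambda>t. (t - y) * green t y / ((t - x) * (y - x)) - semicircle y / semicircle x * green t x / (y - x)"
  shows "green_op (inverse_square_cut x \<epsilon>) y = N (x - \<epsilon>) - N (x + \<epsilon>)"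
proof -
  let ?Q = semicircle
  have Qx: "0 < ?Q x" by (rule semicircle_pos[OF x])
  have "has_bochner_integral lborel (\<lambda>t. inverse_square_cut x \<epsilon> t * green t y)
           ((N (x - \<epsilon>) - N (-1)) + (N 1 - N (x + \<epsilon>)))"
  proof (rule has_bochner_integral_inverse_square_cut_FTC[where S="{y}", OF x e])
    have cont: "continuous_on T N" if "x \<notin> T" "T \<subseteq> {-1..1}" for T
    proof -
      have "continuous_on T (\<lambda>t. green t x)"
        using that by (intro continuous_at_imp_continuous_on ballI isCont_green[OF x]) auto
      with that y show ?thesis unfolding N_def
        by (intro continuous_on_diff continuous_on_divide continuous_on_mult_green continuous_on_mult
            continuous_on_const continuous_on_id) auto
    qed
    show "continuous_on {-1..x - \<epsilon>} N" "continuous_on {x + \<epsilon>..1} N"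
      using e x by (auto intro!: cont)
    fix t assume t: "\<bar>t\<bar> < 1" "t \<noteq> x" "t \<notin> {y}"
    have Qt: "0 < ?Q t" by (rule semicircle_pos[OF t(1)])
    define c where "c = y - x"
    have c: "c \<noteq> 0" using y by (simp add: c_def)
    have d1: "((\<lambda>t. (t - y) * green t y) has_real_derivative
        ((1 - 0) * green t y + - (?Q y / (pi * ?Q t * (t - y))) * (t - y))) (at t)"
      using t y by (intro DERIV_mult DERIV_diff DERIV_ident DERIV_const green_has_derivative) auto
    have dN: "(N has_real_derivative
        (((1 - 0) * green t y + - (?Q y / (pi * ?Q t * (t - y))) * (t - y)) * ((t - x) * c)
           - ((t - y) * green t y) * ((1 - 0) * c)) / (((t - x) * c) * ((t - x) * c))
         - ?Q y / ?Q x * - (?Q x / (pi * ?Q t * (t - x))) / c) (at t)"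
      unfolding N_def c_def[symmetric] using t x c
      by (intro DERIV_diff DERIV_divide d1 DERIV_cdivide DERIV_cmult DERIV_cmult_right
          green_has_derivative DERIV_ident DERIV_const) auto
    have "(((1 - 0) * g + - (p / (pi * q * a)) * a) * (d * c) - (a * g) * ((1 - 0) * c)) / ((d * c) * (d * c))
         - p / r * - (r / (pi * q * d)) / c = g / d\<^sup>2"
      if "a \<noteq> 0" "d \<noteq> 0" "q \<noteq> 0" "r \<noteq> 0" "d = a + c" for a d g p q r
    proof -
      have 1: "- (p / (pi * q * a)) * a = - (p / (pi * q))" "p / r * - (r / (pi * q * d)) / c = - (p / (pi * q) / (d * c))"
        using that c by simp_all
      define z where "z = p / (pi * q)"
      have "((1 - 0) * g + - z) * (d * c) - (a * g) * ((1 - 0) * c) = g * c * c - z * (d * c)"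
        unfolding that(5) by (simp add: algebra_simps)
      then have "(((1 - 0) * g + - z) * (d * c) - (a * g) * ((1 - 0) * c)) / ((d * c) * (d * c)) = (g * c * c - z * (d * c)) / ((d * c) * (d * c))"
        by (simp only:)
      also have "\<dots> = g / d\<^sup>2 - z / (d * c)"
        using that(2) c by (simp add: diff_divide_distrib power2_eq_square)
      finally show ?thesis unfolding 1 z_def[symmetric] by simp
    qed
    note alg = this[of "t - y" "t - x" "?Q t" "?Q x" "green t y" "?Q y"]
    have "(((1 - 0) * green t y + - (?Q y / (pi * ?Q t * (t - y))) * (t - y)) * ((t - x) * c)
           - ((t - y) * green t y) * ((1 - 0) * c)) / (((t - x) * c) * ((t - x) * c))
         - ?Q y / ?Q x * - (?Q x / (pi * ?Q t * (t - x))) / c = green t y / (t - x)\<^sup>2"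
      by (rule alg) (use t Qt Qx in \<open>simp_all add: c_def\<close>)
    with dN show "(N has_real_derivative green t y / (x - t)\<^sup>2) (at t)"
      by (simp only: power2_commute[of x t])
  qed (use y in \<open>auto simp: green_outside\<close>)
  from has_bochner_integral_integral_eq[OF this] show ?thesis
    by (simp add: green_op_def N_def green_outside green_sym[of y] mult.commute)
qed

text \<open>The factor \<open>y - x\<close> clears the pole at y = x. It leaves the second
  difference of the continuous function \<open>(t - y) * green t y\<close> divided by \<epsilon>,
  and a term that is small by \<open>green_symmetric_difference_tendsto_0\<close>. The factor is
  paid for by the linear bound of the density at x.\<close>

lemma green_op_inverse_square_cut_weighted:
  assumes x: "\<bar>x\<bar> < 1" and y: "\<bar>y\<bar> < 1" "y \<noteq> x" and e: "0 < \<epsilon>" "\<epsilon> < 1 - \<bar>x\<bar>"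
  shows "(y - x) * (2 / \<epsilon> * green x y - green_op (inverse_square_cut x \<epsilon>) y) =
     ((x + \<epsilon> - y) * green (x + \<epsilon>) y + (x - \<epsilon> - y) * green (x - \<epsilon>) y - 2 * ((x - y) * green x y)) / \<epsilon>
      - semicircle y / semicircle x * (green (x + \<epsilon>) x - green (x - \<epsilon>) x)"
proof -
  have "c * (2 / \<epsilon> * g - (b * gb / (- \<epsilon> * c) - k * hb / c - (a * ga / (\<epsilon> * c) - k * ha / c)))
    = (a * ga + b * gb - 2 * (- c * g)) / \<epsilon> - k * (ha - hb)"
    if "c \<noteq> 0" for a b c g ga gb k ha hb
    using that e by (simp add: field_simps)
  from this[of "y - x" "green x y" "x - \<epsilon> - y" "green (x - \<epsilon>) y" "semicircle y / semicircle x"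
      "green (x - \<epsilon>) x" "x + \<epsilon> - y" "green (x + \<epsilon>) y" "green (x + \<epsilon>) x"] y
  show ?thesis unfolding green_op_inverse_square_cut[OF assms] by simp
qed

text \<open>\<open>(t - y) * green t y\<close> is \<open>green_primitive\<close> without its
  \<open>arcsin\<close> term, and the second difference of the primitive is the integral of an
  increment of \<open>green\<close> over an interval of length \<epsilon>.\<close>

lemma second_difference_mult_green:
  assumes x: "\<bar>x\<bar> < 1" and y: "\<bar>y\<bar> < 1" and e: "0 < \<epsilon>" "\<epsilon> < 1 - \<bar>x\<bar>"
  shows "(x + \<epsilon> - y) * green (x + \<epsilon>) y + (x - \<epsilon> - y) * green (x - \<epsilon>) y - 2 * ((x - y) * green x y)
    = (\<integral>t. indicator {x - \<epsilon>..x} t * (green (t + \<epsilon>) y - green t y) \<partial>lborel)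
      - semicircle y / pi * (arcsin (x + \<epsilon>) + arcsin (x - \<epsilon>) - 2 * arcsin x)"
proof -
  let ?P = "green_primitive y"
  have 1: "has_bochner_integral lborel (\<lambda>t. indicator {x..x + \<epsilon>} t * green t y) (?P (x + \<epsilon>) - ?P x)"
    using x e by (intro has_bochner_integral_green_Icc y) auto
  have 2: "has_bochner_integral lborel (\<lambda>t. indicator {x - \<epsilon>..x} t * green t y) (?P x - ?P (x - \<epsilon>))"
    using x e by (intro has_bochner_integral_green_Icc y) auto
  have "has_bochner_integral lborel (\<lambda>t. indicator {x..x + \<epsilon>} (\<epsilon> + 1 * t) * green (\<epsilon> + 1 * t) y) ((?P (x + \<epsilon>) - ?P x) /\<^sub>R \<bar>1\<bar>)"
    by (subst lborel_has_bochner_integral_real_affine_iff[where c=1 and t=\<epsilon>, symmetric]) (use 1 in auto)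
  moreover have "indicator {x..x + \<epsilon>} (\<epsilon> + 1 * t) = (indicator {x - \<epsilon>..x} t :: real)" for t
    by (auto simp: indicator_def)
  ultimately have 3: "has_bochner_integral lborel (\<lambda>t. indicator {x - \<epsilon>..x} t * green (t + \<epsilon>) y) (?P (x + \<epsilon>) - ?P x)"
    by (simp add: add.commute)
  have "(\<integral>t. indicator {x - \<epsilon>..x} t * (green (t + \<epsilon>) y - green t y) \<partial>lborel) = (?P (x + \<epsilon>) - ?P x) - (?P x - ?P (x - \<epsilon>))"
    using has_bochner_integral_integral_eq[OF has_bochner_integral_diff[OF 3 2]] by (simp add: right_diff_distrib)
  then show ?thesis by (simp add: green_primitive_def algebra_simps add_divide_distrib diff_divide_distrib)
qed

text \<open>Exchanging the integrals leaves the L1 modulus of \<open>green\<close>, of order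
  \<open>sqrt \<epsilon>\<close>, for each t in an interval of length \<epsilon>. The factor
  \<open>sqrt \<epsilon>\<close> survives the later division by \<epsilon>.\<close>

lemma integral_translate_green_diff:
  assumes x: "\<bar>x\<bar> < 1" and e: "0 < \<epsilon>" "\<epsilon> < 1 - \<bar>x\<bar>"
  defines "R \<equiv> \<lambda>y. \<integral>t. indicator {x - \<epsilon>..x} t * \<bar>green (t + \<epsilon>) y - green t y\<bar> \<partial>lborel"
  shows "integrable lborel R" "(\<integral>y. R y \<partial>lborel) \<le> 9 * \<epsilon> * sqrt \<epsilon>"
proof -
  let ?f = "\<lambda>t y. indicator {x - \<epsilon>..x} t * \<bar>green (t + \<epsilon>) y - green t y\<bar>"
  let ?I = "\<lambda>t. indicator {x - \<epsilon>..x} t * (\<integral>y. \<bar>green (t + \<epsilon>) y - green t y\<bar> \<partial>lborel)"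
  have I: "?I t \<le> indicator {x - \<epsilon>..x} t * (9 * sqrt \<epsilon>)" "0 \<le> ?I t" for t
    using integral_green_diff_le[of "t + \<epsilon>" t] e by (auto simp: indicator_def)
  have intI: "integrable lborel ?I"
  proof (rule Bochner_Integration.integrable_bound)
    show "integrable lborel (\<lambda>t. indicator {x - \<epsilon>..x} t * (9 * sqrt \<epsilon>))"
      by (intro integrable_mult_left integrable_real_indicator) (auto simp: emeasure_lborel_Icc_eq)
    show "AE t in lborel. norm (?I t) \<le> norm (indicator {x - \<epsilon>..x} t * (9 * sqrt \<epsilon>))"
      using I by (intro AE_I2) (metis abs_of_nonneg order_trans real_norm_def)
  qed measurable
  have int: "integrable (lborel \<Otimes>\<^sub>M lborel) (\<lambda>(t, y). ?f t y)"
  proof (rule lborel_pair.Fubini_integrable)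
    show "integrable lborel (\<lambda>t. \<integral>y. norm (case (t, y) of (t, y) \<Rightarrow> ?f t y) \<partial>lborel)"
      using intI by (simp add: abs_mult)
  qed auto
  show "integrable lborel R" unfolding R_def
    using lborel_pair.integrable_snd[OF int] .
  have "(\<integral>y. R y \<partial>lborel) = (\<integral>t. ?I t \<partial>lborel)"
    unfolding R_def using lborel_pair.Fubini_integral[OF int] by simp
  also have "\<dots> \<le> (\<integral>t. indicator {x - \<epsilon>..x} t * (9 * sqrt \<epsilon>) \<partial>lborel)"
    using I by (intro integral_mono intI integrable_mult_left integrable_real_indicator) (auto simp: emeasure_lborel_Icc_eq)
  also have "\<dots> = 9 * \<epsilon> * sqrt \<epsilon>" using e by simp
  finally show "(\<integral>y. R y \<partial>lborel) \<le> 9 * \<epsilon> * sqrt \<epsilon>" .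
qed

text \<open>Used with \<open>h y = f y - f x\<close>; the part of \<open>f\<close> equal to the constant \<open>f x\<close> is treated exactly, as
  \<open>green_op\<close> of a constant is a multiple of \<open>semicircle\<close>.\<close>

lemma truncated_half_laplacian_green_op_le:
  assumes x: "\<bar>x\<bar> < 1" and e: "0 < \<epsilon>" "\<epsilon> < 1 - \<bar>x\<bar>"
    and h[measurable]: "h \<in> borel_measurable borel" and M: "\<And>y. \<bar>h y\<bar> \<le> M"
    and C: "\<And>y. \<bar>y\<bar> < 1 \<Longrightarrow> \<bar>h y\<bar> \<le> C * \<bar>y - x\<bar>"
  shows "\<bar>2 / \<epsilon> * green_op h x - (\<integral>t. inverse_square_cut x \<epsilon> t * green_op h t \<partial>lborel)\<bar>
    \<le> C * (9 * sqrt \<epsilon> + (\<bar>(arcsin (x + \<epsilon>) + arcsin (x - \<epsilon>) - 2 * arcsin x) / \<epsilon>\<bar> / pi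
           + \<bar>green (x + \<epsilon>) x - green (x - \<epsilon>) x\<bar> / semicircle x) * (\<integral>y. semicircle y \<partial>lborel))"
proof -
  let ?w = "inverse_square_cut x \<epsilon>"
  let ?a = "arcsin (x + \<epsilon>) + arcsin (x - \<epsilon>) - 2 * arcsin x"
  let ?g = "green (x + \<epsilon>) x - green (x - \<epsilon>) x"
  define R where "R = (\<lambda>y. \<integral>t. indicator {x - \<epsilon>..x} t * \<bar>green (t + \<epsilon>) y - green t y\<bar> \<partial>lborel)"
  \<comment> \<open>Self-adjointness turns the truncated half-Laplacian of the potential into the
    integral of \<open>h\<close> against \<open>K\<close>; the zero of \<open>h\<close> at x
    compensates the pole of \<open>K\<close>.\<close>
  define K where "K = (\<lambda>y. 2 / \<epsilon> * green x y - green_op ?w y)"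
  define k where "k = \<bar>?a / \<epsilon>\<bar> / pi + \<bar>?g\<bar> / semicircle x"
  note R = integral_translate_green_diff[OF x e, folded R_def]
  note w = borel_measurable_inverse_square_cut[of x \<epsilon>] inverse_square_cut_le[OF e(1), of x]
  have Qx: "0 < semicircle x" by (rule semicircle_pos[OF x])
  have C0: "0 \<le> C"
  proof -
    have "\<bar>x + \<epsilon>\<bar> < 1" using e by linarith
    from order_trans[OF abs_ge_zero C[OF this]] show ?thesis using e by (simp add: zero_le_mult_iff)
  qed
  have abs3: "\<bar>a - b - c\<bar> \<le> \<bar>a\<bar> + \<bar>b\<bar> + \<bar>c\<bar>" for a b c :: real by linarith
  have K: "\<bar>h y * K y\<bar> \<le> C * (R y / \<epsilon> + k * semicircle y)" if "y \<noteq> x" for y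
  proof (cases "\<bar>y\<bar> < 1")
    case False
    then have "K y = 0" by (simp add: K_def green_outside' green_op_outside)
    moreover have "0 \<le> R y" unfolding R_def by (intro integral_nonneg_AE) auto
    ultimately show ?thesis using C0 e Qx by (auto simp: k_def intro!: mult_nonneg_nonneg add_nonneg_nonneg)
  next
    case True
    have "\<bar>h y * K y\<bar> \<le> C * \<bar>y - x\<bar> * \<bar>K y\<bar>"
      unfolding abs_mult using C[OF True] by (intro mult_right_mono) auto
    also have "\<dots> = C * \<bar>(y - x) * K y\<bar>" by (simp add: abs_mult)
    also have "\<dots> \<le> C * (R y / \<epsilon> + k * semicircle y)"
    proof (intro mult_left_mono C0)
      define J where "J = (\<integral>t. indicator {x - \<epsilon>..x} t * (green (t + \<epsilon>) y - green t y) \<partial>lborel)"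
      have "\<bar>J\<bar> \<le> (\<integral>t. \<bar>indicator {x - \<epsilon>..x} t * (green (t + \<epsilon>) y - green t y)\<bar> \<partial>lborel)"
        unfolding J_def by (rule integral_abs_bound)
      then have J: "\<bar>J\<bar> \<le> R y" by (simp add: R_def abs_mult)
      have "(y - x) * K y = J / \<epsilon> - semicircle y * (?a / \<epsilon>) / pi - semicircle y * (?g / semicircle x)"
        unfolding K_def green_op_inverse_square_cut_weighted[OF x True that e]
          second_difference_mult_green[OF x True e] J_def[symmetric]
        by (simp only: diff_divide_distrib[of "J"] times_divide_eq_right times_divide_eq_left divide_divide_eq_left mult_ac)
      also have "\<bar>\<dots>\<bar> \<le> \<bar>J / \<epsilon>\<bar> + \<bar>semicircle y * (?a / \<epsilon>) / pi\<bar> + \<bar>semicircle y * (?g / semicircle x)\<bar>"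
        using abs3 .
      also have "\<dots> = \<bar>J\<bar> / \<epsilon> + k * semicircle y"
      proof -
        have "\<bar>semicircle y * (?a / \<epsilon>) / pi\<bar> = \<bar>?a / \<epsilon>\<bar> / pi * semicircle y"
          "\<bar>semicircle y * (?g / semicircle x)\<bar> = \<bar>?g\<bar> / semicircle x * semicircle y"
          "\<bar>J / \<epsilon>\<bar> = \<bar>J\<bar> / \<epsilon>"
          using e Qx by (simp_all only: abs_mult abs_divide abs_of_pos abs_of_nonneg[OF semicircle_nonneg]
              pi_gt_zero mult.commute times_divide_eq_left times_divide_eq_right)
        then show ?thesis by (simp only: k_def distrib_right)
      qed
      finally show "\<bar>(y - x) * K y\<bar> \<le> R y / \<epsilon> + k * semicircle y"
        using divide_right_mono[OF J, of \<epsilon>] e by linarith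
    qed
    finally show ?thesis .
  qed
  have ih: "integrable lborel (\<lambda>y. green x y * h y)" by (rule integrable_green_mult[OF h M])
  have iw: "integrable lborel (\<lambda>y. h y * green_op ?w y)"
    by (rule integrable_mult_green_op[OF w h M])
  have iK: "integrable lborel (\<lambda>y. h y * K y)"
    using Bochner_Integration.integrable_diff[OF integrable_mult_right[OF ih, of "2 / \<epsilon>"] iw]
    by (simp add: K_def algebra_simps)
  have "(\<integral>t. ?w t * green_op h t \<partial>lborel) = (\<integral>y. h y * green_op ?w y \<partial>lborel)"
    by (rule green_op_selfadjoint[OF h M w])
  then have "2 / \<epsilon> * green_op h x - (\<integral>t. ?w t * green_op h t \<partial>lborel)
      = (\<integral>y. 2 / \<epsilon> * (green x y * h y) \<partial>lborel) - (\<integral>y. h y * green_op ?w y \<partial>lborel)"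
    by (simp add: green_op_def)
  also have "\<dots> = (\<integral>y. 2 / \<epsilon> * (green x y * h y) - h y * green_op ?w y \<partial>lborel)"
    by (intro Bochner_Integration.integral_diff[symmetric] integrable_mult_right ih iw)
  also have "\<dots> = (\<integral>y. h y * K y \<partial>lborel)"
    by (intro Bochner_Integration.integral_cong refl) (simp add: K_def algebra_simps)
  also have "\<bar>\<dots>\<bar> \<le> (\<integral>y. \<bar>h y * K y\<bar> \<partial>lborel)" by (rule integral_abs_bound)
  also have "\<dots> \<le> (\<integral>y. C * (R y / \<epsilon> + k * semicircle y) \<partial>lborel)"
  proof (rule integral_mono_AE)
    show "integrable lborel (\<lambda>y. \<bar>h y * K y\<bar>)" using iK by (rule integrable_abs)
    show "integrable lborel (\<lambda>y. C * (R y / \<epsilon> + k * semicircle y))"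
      by (intro integrable_mult_right Bochner_Integration.integrable_add integrable_divide R(1) integrable_semicircle)
    show "AE y in lborel. \<bar>h y * K y\<bar> \<le> C * (R y / \<epsilon> + k * semicircle y)"
      using AE_lborel_singleton[of x] by eventually_elim (rule K)
  qed
  also have "\<dots> = C * ((\<integral>y. R y \<partial>lborel) / \<epsilon> + k * (\<integral>y. semicircle y \<partial>lborel))"
    by (subst integral_mult_right_zero, subst Bochner_Integration.integral_add)
       (simp_all only: integrable_divide R(1) integrable_mult_right integrable_semicircle
          integral_divide_zero integral_mult_right_zero)
  also have "\<dots> \<le> C * (9 * sqrt \<epsilon> + k * (\<integral>y. semicircle y \<partial>lborel))"
  proof (intro mult_left_mono add_right_mono C0)
    have "(\<integral>y. R y \<partial>lborel) / \<epsilon> \<le> 9 * \<epsilon> * sqrt \<epsilon> / \<epsilon>"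
      using e(1) by (intro divide_right_mono R(2)) simp
    then show "(\<integral>y. R y \<partial>lborel) / \<epsilon> \<le> 9 * sqrt \<epsilon>" using e(1) by simp
  qed
  finally show ?thesis by (simp only: k_def)
qed

text \<open>The linear bound is asked at the single point x and against points of the interval,
  because the densities to be treated jump at the endpoints; C may depend on x. The density splits
  into the constant \<open>f x\<close>, treated by \<open>semicircle\<close>, and a part vanishing
  at x, whose truncated integrals tend to 0.\<close>

theorem has_half_laplacian_green_op:
  assumes x: "\<bar>x\<bar> < 1" and f[measurable]: "f \<in> borel_measurable borel" and M: "\<And>y. \<bar>f y\<bar> \<le> M"
    and C: "\<And>y. \<bar>y\<bar> < 1 \<Longrightarrow> \<bar>f y - f x\<bar> \<le> C * \<bar>y - x\<bar>"
  shows "has_half_laplacian (green_op f) x (f x)"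
proof -
  define h where "h = (\<lambda>y. f y - f x)"
  have [measurable]: "h \<in> borel_measurable borel" unfolding h_def by measurable
  have hM: "\<bar>h y\<bar> \<le> 2 * M" for y using M[of y] M[of x] unfolding h_def by linarith
  have Qx: "0 < semicircle x" by (rule semicircle_pos[OF x])
  let ?B = "\<lambda>\<epsilon>. C * (9 * sqrt \<epsilon> + (\<bar>(arcsin (x + \<epsilon>) + arcsin (x - \<epsilon>) - 2 * arcsin x) / \<epsilon>\<bar> / pi
           + \<bar>green (x + \<epsilon>) x - green (x - \<epsilon>) x\<bar> / semicircle x) * (\<integral>y. semicircle y \<partial>lborel))"
  have "has_half_laplacian (green_op h) x 0"
  proof (rule has_half_laplacianI)
    show "green_op h \<in> borel_measurable borel" by (rule borel_measurable_green_op[OF _ hM]) simp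
    show "\<bar>green_op h t\<bar> \<le> 2 * M" for t
    proof -
      have "\<bar>green_op h t\<bar> \<le> (2 * M) * semicircle t" by (rule green_op_bound[OF _ hM]) simp
      also have "\<dots> \<le> (2 * M) * 1" using M[of 0] by (intro mult_left_mono semicircle_le_1) auto
      finally show ?thesis by simp
    qed
    show "((\<lambda>\<epsilon>. 2 / \<epsilon> * green_op h x - (\<integral>t. inverse_square_cut x \<epsilon> t * green_op h t \<partial>lborel)) \<longlongrightarrow> pi * 0) (at_right 0)"
      unfolding mult_zero_right
    proof (rule Lim_null_comparison)
      have "\<forall>\<^sub>F \<epsilon> in at_right 0. \<epsilon> \<in> {0<..<1 - \<bar>x\<bar>}"
        using x by (intro eventually_at_right_real) auto
      then show "\<forall>\<^sub>F \<epsilon> in at_right 0. norm (2 / \<epsilon> * green_op h x - (\<integral>t. inverse_square_cut x \<epsilon> t * green_op h t \<partial>lborel)) \<le> ?B \<epsilon>"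
      proof eventually_elim
        case (elim \<epsilon>)
        then show ?case
          using truncated_half_laplacian_green_op_le[OF x, where \<epsilon>=\<epsilon> and h=h and M="2*M" and C=C] C hM by (simp add: h_def)
      qed
      have "(?B \<longlongrightarrow> C * (9 * sqrt 0 + (\<bar>0\<bar> / pi + \<bar>0\<bar> / semicircle x) * (\<integral>y. semicircle y \<partial>lborel))) (at_right 0)"
        using Qx
        by (intro tendsto_mult tendsto_add tendsto_const tendsto_divide tendsto_rabs tendsto_real_sqrt
            second_difference_quotient_tendsto_0[OF arcsin_has_derivative[OF x]]
            green_symmetric_difference_tendsto_0[OF x] tendsto_ident_at) auto
      then show "(?B \<longlongrightarrow> 0) (at_right 0)" by simp
    qed
  qed
  from has_half_laplacian_diff[OF this has_half_laplacian_cmult[OF has_half_laplacian_semicircle[OF x], of "- f x"]]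
  have "has_half_laplacian (\<lambda>y. green_op h y - - f x * semicircle y) x (f x)" by simp
  moreover have "green_op h y - - f x * semicircle y = green_op f y" for y
    using green_op_diff[OF f M, of "\<lambda>_. f x" "\<bar>f x\<bar>" y] by (simp add: h_def green_op_const)
  ultimately show ?thesis by (simp add: fun_eq_iff)
qed

section \<open>Maximum principle and uniqueness\<close>

lemma has_half_laplacian_zero_imp_nonpos:
  assumes cont: "continuous_on UNIV w" and out: "\<And>x. 1 \<le> \<bar>x\<bar> \<Longrightarrow> w x = 0"
    and harm: "\<And>x. \<bar>x\<bar> < 1 \<Longrightarrow> has_half_laplacian w x 0"
  shows "w x \<le> 0"
proof (rule ccontr)
  assume "\<not> w x \<le> 0"
  then have "0 < w x" by simp
  moreover from this have "\<not> 1 \<le> \<bar>x\<bar>" using out[of x] by auto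
  ultimately have x: "0 < w x" "\<bar>x\<bar> < 1" by auto
  obtain z where z: "z \<in> {-1..1}" "\<And>y. y \<in> {-1..1} \<Longrightarrow> w y \<le> w z"
    using continuous_attains_sup[of "{-1..1}" w] continuous_on_subset[OF cont] by auto
  have wz: "0 < w z" using z(2)[of x] x by (auto simp: abs_less_iff)
  have max: "w y \<le> w z" for y
  proof (cases "1 \<le> \<bar>y\<bar>")
    case False
    then have "y \<in> {-1..1}" by auto
    then show ?thesis by (rule z(2))
  qed (use out[of y] wz in simp)
  have z1: "\<bar>z\<bar> < 1" using out[of z] wz by (cases "1 \<le> \<bar>z\<bar>") auto
  obtain L where L: "has_pv_integral (\<lambda>y. (w z - w y) / (z - y)\<^sup>2) z L" "0 = 1 / pi * L"
    using harm[OF z1] unfolding has_half_laplacian_def by blast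
  let ?I = "\<lambda>\<epsilon>. LINT y:{y. \<epsilon> < \<bar>y - z\<bar>}|lborel. (w z - w y) / (z - y)\<^sup>2"
  have "L = 0" using L(2) by simp
  then have lim: "(?I \<longlongrightarrow> 0) (at_right 0)" using L(1) by (simp add: has_pv_integral_def)
  have int: "integrable lborel (\<lambda>y. indicator {y. \<epsilon> < \<bar>y - z\<bar>} y * ((w z - w y) / (z - y)\<^sup>2))" if "0 < \<epsilon>" for \<epsilon>
    using L(1) that by (auto simp: has_pv_integral_def set_integrable_def)
  \<comment> \<open>At a maximum z the integrand is nonnegative everywhere. On [2,3] the function w
    vanishes and the distance to z lies between 1 and 4, so this piece alone bounds the truncated
    integral from below independently of \<epsilon>.\<close>
  have lower: "w z / 16 \<le> ?I \<epsilon>" if e: "0 < \<epsilon>" "\<epsilon> < 1" for \<epsilon>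
  proof -
    have "(\<integral>y. indicator {2..3::real} y * (w z / 16) \<partial>lborel) \<le> (\<integral>y. indicator {y. \<epsilon> < \<bar>y - z\<bar>} y * ((w z - w y) / (z - y)\<^sup>2) \<partial>lborel)"
    proof (intro integral_mono int e)
      show "integrable lborel (\<lambda>y. indicator {2..3::real} y * (w z / 16))" by (intro integrable_mult_left) simp
      fix y
      show "indicator {2..3::real} y * (w z / 16) \<le> indicator {y. \<epsilon> < \<bar>y - z\<bar>} y * ((w z - w y) / (z - y)\<^sup>2)"
      proof (cases "y \<in> {2..3}")
        case True
        have "(y - z)\<^sup>2 \<le> 4\<^sup>2" using True z1 by (intro power_mono) auto
        moreover have "0 < (y - z)\<^sup>2" using True z1 by auto
        ultimately have "w z / 16 \<le> w z / (y - z)\<^sup>2" using wz by (intro divide_left_mono) auto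
        moreover have "\<epsilon> < \<bar>y - z\<bar>" using True z1 e by auto
        moreover have "w y = 0" using True by (intro out) auto
        ultimately show ?thesis using True by (simp add: power2_commute)
      next
        case False
        then show ?thesis using max[of y] by auto
      qed
    qed
    then show ?thesis by (simp add: set_lebesgue_integral_def)
  qed
  have "w z / 16 \<le> 0"
  proof (rule tendsto_lowerbound[OF lim])
    have "\<forall>\<^sub>F \<epsilon> in at_right 0. \<epsilon> \<in> {0<..<1::real}" by (intro eventually_at_right_real) auto
    then show "\<forall>\<^sub>F \<epsilon> in at_right 0. w z / 16 \<le> ?I \<epsilon>"
    proof eventually_elim
      case (elim \<epsilon>)
      then show ?case by (intro lower) simp_all
    qed
  qed simp
  with wz show False by simp
qed

lemma has_half_laplacian_unique:
  assumes u: "continuous_on UNIV u" "\<And>x. 1 \<le> \<bar>x\<bar> \<Longrightarrow> u x = 0" "\<And>x. \<bar>x\<bar> < 1 \<Longrightarrow> has_half_laplacian u x (f x)"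
    and v: "continuous_on UNIV v" "\<And>x. 1 \<le> \<bar>x\<bar> \<Longrightarrow> v x = 0" "\<And>x. \<bar>x\<bar> < 1 \<Longrightarrow> has_half_laplacian v x (f x)"
  shows "u = v"
proof
  fix x
  have *: "p x - q x \<le> 0"
    if p: "continuous_on UNIV p" "\<And>x. 1 \<le> \<bar>x\<bar> \<Longrightarrow> p x = 0" "\<And>x. \<bar>x\<bar> < 1 \<Longrightarrow> has_half_laplacian p x (f x)"
      and q: "continuous_on UNIV q" "\<And>x. 1 \<le> \<bar>x\<bar> \<Longrightarrow> q x = 0" "\<And>x. \<bar>x\<bar> < 1 \<Longrightarrow> has_half_laplacian q x (f x)"
    for p q
  proof (rule has_half_laplacian_zero_imp_nonpos[of "\<lambda>x. p x - q x"])
    show "continuous_on UNIV (\<lambda>x. p x - q x)" by (intro continuous_on_diff p(1) q(1))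
    show "p x - q x = 0" if "1 \<le> \<bar>x\<bar>" for x using p(2)[OF that] q(2)[OF that] by linarith
    show "has_half_laplacian (\<lambda>x. p x - q x) x 0" if "\<bar>x\<bar> < 1" for x
      using has_half_laplacian_diff[OF p(3)[OF that] q(3)[OF that]] by (simp only: diff_self)
  qed
  from *[OF u v] *[OF v u] show "u x = v x" by linarith
qed

section \<open>Dilations and the Pohozaev inequality\<close>

text \<open>The squares of the two sides differ by \<open>(1 - s\<^sup>2) * (x * semicircle y + y *
  semicircle x)\<^sup>2\<close>. For x and y of opposite signs this shows that dilation does not
  decrease the numerator of \<open>green\<close>, although the term \<open>- x * y\<close> alone
  decreases.\<close>

lemma semicircle_mult_ge_dilated:
  assumes x: "\<bar>x\<bar> \<le> 1" and y: "\<bar>y\<bar> \<le> 1" and xy: "x * y \<le> 0" and s: "0 < s" "s \<le> 1"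
  shows "semicircle x * semicircle y - (1 - s\<^sup>2) * (x * y) \<le> semicircle (s * x) * semicircle (s * y)"
proof -
  let ?Q = semicircle
  have sx: "\<bar>s * x\<bar> \<le> 1" "\<bar>s * y\<bar> \<le> 1"
    using x y s mult_mono[of s 1 "\<bar>x\<bar>" 1] mult_mono[of s 1 "\<bar>y\<bar>" 1] by (auto simp: abs_mult)
  define q where "q = s\<^sup>2"
  have q: "q \<le> 1" using s by (simp add: q_def power_le_one)
  have sq: "(?Q x)\<^sup>2 = 1 - x\<^sup>2" "(?Q y)\<^sup>2 = 1 - y\<^sup>2" "(?Q (s * x))\<^sup>2 = 1 - q * x\<^sup>2" "(?Q (s * y))\<^sup>2 = 1 - q * y\<^sup>2"
    using semicircle_sq[OF x] semicircle_sq[OF y] semicircle_sq[OF sx(1)] semicircle_sq[OF sx(2)]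
    by (simp_all add: q_def power_mult_distrib)
  have "(?Q x * ?Q y - (1 - q) * (x * y))\<^sup>2 = (?Q x)\<^sup>2 * (?Q y)\<^sup>2 - 2 * (1 - q) * (x * y) * (?Q x * ?Q y) + (1 - q)\<^sup>2 * (x\<^sup>2 * y\<^sup>2)"
    by (simp add: power2_eq_square algebra_simps)
  also have "\<dots> = (1 - q * x\<^sup>2) * (1 - q * y\<^sup>2) - (1 - q) * (x\<^sup>2 * (1 - y\<^sup>2) + y\<^sup>2 * (1 - x\<^sup>2) + 2 * (x * ?Q y) * (y * ?Q x))"
    unfolding sq by (simp add: power2_eq_square algebra_simps)
  also have "x\<^sup>2 * (1 - y\<^sup>2) + y\<^sup>2 * (1 - x\<^sup>2) + 2 * (x * ?Q y) * (y * ?Q x) = (x * ?Q y + y * ?Q x)\<^sup>2"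
    unfolding sq[symmetric] by (simp add: power2_eq_square algebra_simps)
  also have "(1 - q * x\<^sup>2) * (1 - q * y\<^sup>2) = (?Q (s * x) * ?Q (s * y))\<^sup>2"
    unfolding power_mult_distrib sq ..
  finally have "(?Q x * ?Q y - (1 - q) * (x * y))\<^sup>2 \<le> (?Q (s * x) * ?Q (s * y))\<^sup>2"
    using q mult_nonneg_nonneg[of "1 - q" "(x * ?Q y + y * ?Q x)\<^sup>2"] by simp
  then show ?thesis unfolding q_def by (rule power2_le_imp_le) simp
qed

lemma semicircle_dilated_ge:
  assumes x: "\<bar>x\<bar> \<le> 1" and s: "0 < s" "s \<le> 1"
  shows "semicircle x \<le> semicircle (s * x)"
proof -
  have "s\<^sup>2 * x\<^sup>2 \<le> 1 * x\<^sup>2" using s by (intro mult_right_mono power_le_one) auto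
  then show ?thesis unfolding semicircle_def by (intro real_sqrt_le_mono) (auto simp: power_mult_distrib)
qed

text \<open>Dilation shrinks \<open>\<bar>x - y\<bar>\<close> by the factor s, which contributes
  \<open>- ln s\<close>, and does not shrink the numerator. The indicator term records that the
  numerator even grows for pairs beyond \<eta> on the same side of 0; it is the source of the
  concentration estimate.\<close>

lemma green_dilated_ge:
  assumes x: "\<bar>x\<bar> < 1" and y: "\<bar>y\<bar> < 1" and ne: "x \<noteq> y" and s: "0 < s" "s < 1" and \<eta>: "0 \<le> \<eta>"
  shows "green x y + (- ln s + (indicator {\<eta><..} x * indicator {\<eta><..} y + indicator {..<-\<eta>} x * indicator {..<-\<eta>} y)
           * ln (1 + (1 - s\<^sup>2) * \<eta>\<^sup>2 / 2)) / pi \<le> green (s * x) (s * y)"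
proof -
  let ?A = "1 - x * y + semicircle x * semicircle y"
  let ?As = "1 - (s * x) * (s * y) + semicircle (s * x) * semicircle (s * y)"
  let ?i = "indicator {\<eta><..} x * indicator {\<eta><..} y + indicator {..<-\<eta>} x * indicator {..<-\<eta>} y :: real"
  have sx: "\<bar>s * x\<bar> \<le> 1" "\<bar>s * y\<bar> \<le> 1"
    using x y s mult_mono[of s 1 "\<bar>x\<bar>" 1] mult_mono[of s 1 "\<bar>y\<bar>" 1] by (auto simp: abs_mult)
  have s2: "0 \<le> 1 - s\<^sup>2" using s by (simp add: power_le_one)
  have "0 < \<bar>x - y\<bar>" using ne by simp
  then have A: "0 < ?A" "?A \<le> 2"
    using green_numerator_ge[of x y] green_numerator_le[of x y] x y by auto
  have z: "0 \<le> (1 - s\<^sup>2) * \<eta>\<^sup>2 / 2" using s2 by simp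
  have mono: "semicircle x * semicircle y \<le> semicircle (s * x) * semicircle (s * y)"
    using s x y by (intro mult_mono semicircle_dilated_ge) auto
  \<comment> \<open>The numerator gains at least \<open>(1 - s\<^sup>2) * (x * y)\<close>. As it is
    at most 2, this is a relative gain of at least half that amount, which explains the division by
    2 under the logarithm.\<close>
  have pos: "?A * (1 + ?i * ((1 - s\<^sup>2) * \<eta>\<^sup>2 / 2)) \<le> ?As" if "0 \<le> x * y"
  proof -
    have i: "?i * \<eta>\<^sup>2 \<le> x * y"
    proof -
      consider "\<eta> < x" "\<eta> < y" | "x < - \<eta>" "y < - \<eta>" | "\<not> (\<eta> < x \<and> \<eta> < y)" "\<not> (x < - \<eta> \<and> y < - \<eta>)"
        by blast
      then show ?thesis
      proof cases
        case 1
        then have "\<eta> * \<eta> \<le> x * y" using \<eta> by (intro mult_mono) auto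
        moreover have "?i = 1" using 1 \<eta> by (simp add: indicator_def)
        ultimately show ?thesis by (simp add: power2_eq_square)
      next
        case 2
        then have "\<eta> * \<eta> \<le> (- x) * (- y)" using \<eta> by (intro mult_mono) auto
        moreover have "?i = 1" using 2 \<eta> by (simp add: indicator_def)
        ultimately show ?thesis by (simp add: power2_eq_square)
      next
        case 3
        then have "?i = 0" by (auto simp: indicator_def)
        then show ?thesis using that by simp
      qed
    qed
    have i0: "0 \<le> ?i" by simp
    have "?A * (?i * ((1 - s\<^sup>2) * \<eta>\<^sup>2 / 2)) \<le> 2 * (?i * ((1 - s\<^sup>2) * \<eta>\<^sup>2 / 2))"
      using A z i0 by (intro mult_right_mono mult_nonneg_nonneg) auto
    also have "\<dots> = (1 - s\<^sup>2) * (?i * \<eta>\<^sup>2)" by simp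
    also have "\<dots> \<le> (1 - s\<^sup>2) * (x * y)" by (intro mult_left_mono i s2)
    finally have "?A * (1 + ?i * ((1 - s\<^sup>2) * \<eta>\<^sup>2 / 2)) \<le> ?A + (1 - s\<^sup>2) * (x * y)"
      unfolding distrib_left by simp
    also have "\<dots> \<le> ?As" using mono by (simp add: algebra_simps power2_eq_square)
    finally show ?thesis .
  qed
  have neg: "?A * (1 + ?i * ((1 - s\<^sup>2) * \<eta>\<^sup>2 / 2)) \<le> ?As" if "x * y < 0"
  proof -
    have "?i = 0" using that \<eta> by (auto simp: indicator_def mult_less_0_iff)
    moreover have "?A \<le> ?As"
      using semicircle_mult_ge_dilated[of x y s] x y s that by (simp add: algebra_simps power2_eq_square)
    ultimately show ?thesis by simp
  qed
  have le: "?A * (1 + ?i * ((1 - s\<^sup>2) * \<eta>\<^sup>2 / 2)) \<le> ?As" using pos neg by linarith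
  have i01: "?i = 0 \<or> ?i = 1" using \<eta> by (auto simp: indicator_def)
  have B: "0 < 1 + ?i * ((1 - s\<^sup>2) * \<eta>\<^sup>2 / 2)" using i01 z by auto
  have "ln ?A + ln (1 + ?i * ((1 - s\<^sup>2) * \<eta>\<^sup>2 / 2)) = ln (?A * (1 + ?i * ((1 - s\<^sup>2) * \<eta>\<^sup>2 / 2)))"
    using A B by (simp add: ln_mult)
  also have "\<dots> \<le> ln ?As" using A B le by (intro ln_mono) auto
  finally have 1: "ln ?A + ?i * ln (1 + (1 - s\<^sup>2) * \<eta>\<^sup>2 / 2) \<le> ln ?As" using i01 by auto
  have "\<bar>s * x - s * y\<bar> = s * \<bar>x - y\<bar>" using s by (simp add: abs_mult flip: right_diff_distrib)
  then have 2: "ln \<bar>s * x - s * y\<bar> = ln s + ln \<bar>x - y\<bar>"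
    using s ne by (simp add: ln_mult)
  have g: "green (s * x) (s * y) = (ln ?As - (ln s + ln \<bar>x - y\<bar>)) / pi"
    using green_eq[OF sx] ne s 2 by simp
  have "ln ?A - ln \<bar>x - y\<bar> + (- ln s + ?i * ln (1 + (1 - s\<^sup>2) * \<eta>\<^sup>2 / 2)) \<le> ln ?As - (ln s + ln \<bar>x - y\<bar>)"
    using 1 by linarith
  then show ?thesis
    unfolding g using green_eq[of x y] x y ne
    by (simp add: divide_right_mono flip: add_divide_distrib)
qed

section \<open>Energy of a dilated density\<close>

definition dilate :: "real \<Rightarrow> (real \<Rightarrow> real) \<Rightarrow> real \<Rightarrow> real" where
  "dilate s f x = f (x / s) / s"

lemma borel_measurable_dilate [measurable (raw)]:
  assumes [measurable]: "f \<in> borel_measurable borel"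
  shows "dilate s f \<in> borel_measurable borel"
  unfolding dilate_def by measurable

lemma dilate_bound:
  assumes "0 < s" "\<And>y. \<bar>f y\<bar> \<le> M" shows "\<bar>dilate s f y\<bar> \<le> M / s"
  using assms by (simp add: dilate_def divide_right_mono)

lemma integral_mult_dilate:
  assumes s: "0 < s"
  shows "(\<integral>x. \<phi> x * dilate s f x \<partial>lborel) = (\<integral>x. \<phi> (s * x) * f x \<partial>lborel)"
  using s by (subst lborel_integral_real_affine[where c=s and t=0]) (auto simp: dilate_def)

lemma integrable_mult_dilate:
  assumes s: "0 < s"
  shows "integrable lborel (\<lambda>x. \<phi> x * dilate s f x) \<longleftrightarrow> integrable lborel (\<lambda>x. \<phi> (s * x) * f x)"
proof -
  have "integrable lborel (\<lambda>x. \<phi> x * dilate s f x) \<longleftrightarrow> integrable lborel (\<lambda>x. \<phi> (0 + s * x) * dilate s f (0 + s * x))"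
    using s by (subst lborel_integrable_real_affine_iff) auto
  also have "(\<lambda>x. \<phi> (0 + s * x) * dilate s f (0 + s * x)) = (\<lambda>x. (\<phi> (s * x) * f x) / s)"
    using s by (simp add: dilate_def)
  finally show ?thesis using s by (simp add: divide_inverse integrable_mult_left_iff)
qed

lemma green_op_dilate: "0 < s \<Longrightarrow> green_op (dilate s f) x = (\<integral>y. green x (s * y) * f y \<partial>lborel)"
  unfolding green_op_def by (rule integral_mult_dilate)

lemma integrable_green_dilated_mult:
  assumes "f \<in> borel_measurable borel" "\<And>y. \<bar>f y\<bar> \<le> M" "0 < s"
  shows "integrable lborel (\<lambda>y. green x (s * y) * f y)"
  unfolding integrable_mult_dilate[OF assms(3), symmetric]
  by (rule integrable_green_mult[OF borel_measurable_dilate dilate_bound]) (use assms in auto)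

text \<open>\<open>green_dilated_ge\<close> integrated twice against f; the products of indicators
  integrate to the squares of the one-sided masses.\<close>

lemma dilated_energy_ge:
  assumes f[measurable]: "f \<in> borel_measurable borel" and M: "\<And>y. \<bar>f y\<bar> \<le> M" and nonneg: "\<And>y. 0 \<le> f y"
    and out: "\<And>y. 1 \<le> \<bar>y\<bar> \<Longrightarrow> f y = 0" and s: "0 < s" "s < 1" and \<eta>: "0 \<le> \<eta>"
  defines "F \<equiv> \<integral>y. f y \<partial>lborel" and "P \<equiv> \<integral>y. indicator {\<eta><..} y * f y \<partial>lborel"
    and "N \<equiv> \<integral>y. indicator {..<-\<eta>} y * f y \<partial>lborel"
  shows "(\<integral>x. f x * green_op f x \<partial>lborel) + (- ln s * F\<^sup>2 + ln (1 + (1 - s\<^sup>2) * \<eta>\<^sup>2 / 2) * (P\<^sup>2 + N\<^sup>2)) / pi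
     \<le> (\<integral>x. dilate s f x * green_op (dilate s f) x \<partial>lborel)"
proof -
  let ?k = "ln (1 + (1 - s\<^sup>2) * \<eta>\<^sup>2 / 2)"
  let ?p = "\<lambda>x. indicator {\<eta><..} x :: real" and ?n = "\<lambda>x. indicator {..<-\<eta>} x :: real"
  have intf: "integrable lborel f"
    by (rule integrable_bounded_on_unit[OF f M]) (auto intro: out)
  have intp: "integrable lborel (\<lambda>y. ?p y * f y)" "integrable lborel (\<lambda>y. ?n y * f y)"
    using M out by (auto intro!: integrable_bounded_on_unit[where M=M] simp: indicator_def abs_mult)
       (metis M abs_ge_zero order_trans)+
  have fM: "\<bar>dilate s f y\<bar> \<le> M / s" for y by (rule dilate_bound[OF s(1) M])
  have fm: "dilate s f \<in> borel_measurable borel" by measurable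
  have inner: "green_op f x + (- ln s * F + ?k * (?p x * P + ?n x * N)) / pi \<le> green_op (dilate s f) (s * x)"
    if x: "\<bar>x\<bar> < 1" for x
  proof -
    have "(\<integral>y. green x y * f y + (- ln s * f y + ?k * (?p x * (?p y * f y) + ?n x * (?n y * f y))) / pi \<partial>lborel)
       \<le> (\<integral>y. green (s * x) (s * y) * f y \<partial>lborel)"
    proof (rule integral_mono_AE)
      show "integrable lborel (\<lambda>y. green x y * f y + (- ln s * f y + ?k * (?p x * (?p y * f y) + ?n x * (?n y * f y))) / pi)"
        by (intro Bochner_Integration.integrable_add integrable_divide integrable_mult_right integrable_green_mult[OF f M] intf intp)
      show "integrable lborel (\<lambda>y. green (s * x) (s * y) * f y)"
        by (rule integrable_green_dilated_mult[OF f M s(1)])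
      show "AE y in lborel. green x y * f y + (- ln s * f y + ?k * (?p x * (?p y * f y) + ?n x * (?n y * f y))) / pi
          \<le> green (s * x) (s * y) * f y"
        using AE_lborel_singleton[of x]
      proof eventually_elim
        case (elim y)
        show ?case
        proof (cases "\<bar>y\<bar> < 1")
          case True
          have "(green x y + (- ln s + (?p x * ?p y + ?n x * ?n y) * ?k) / pi) * f y \<le> green (s * x) (s * y) * f y"
            using elim by (intro mult_right_mono nonneg green_dilated_ge x True s \<eta>) auto
          then show ?thesis by (simp add: algebra_simps add_divide_distrib)
        next
          case False
          then show ?thesis using out[of y] by simp
        qed
      qed
    qed
    moreover have "(\<integral>y. green x y * f y + (- ln s * f y + ?k * (?p x * (?p y * f y) + ?n x * (?n y * f y))) / pi \<partial>lborel)
        = green_op f x + (- ln s * F + ?k * (?p x * P + ?n x * N)) / pi"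
      unfolding green_op_def F_def P_def N_def
      by (subst Bochner_Integration.integral_add)
         (simp_all add: integrable_green_mult[OF f M] intf intp del: integral_mult_right_zero integral_mult_left_zero
            add: integral_mult_right_zero)
    ultimately show ?thesis by (simp add: green_op_dilate s)
  qed
  have "(\<integral>x. f x * green_op f x + (- ln s * F * f x + ?k * (P * (?p x * f x) + N * (?n x * f x))) / pi \<partial>lborel)
     \<le> (\<integral>x. green_op (dilate s f) (s * x) * f x \<partial>lborel)"
  proof (rule integral_mono)
    show "integrable lborel (\<lambda>x. f x * green_op f x + (- ln s * F * f x + ?k * (P * (?p x * f x) + N * (?n x * f x))) / pi)"
      by (intro Bochner_Integration.integrable_add integrable_divide integrable_mult_right integrable_mult_green_op[OF f M f M] intf intp)
    show "integrable lborel (\<lambda>x. green_op (dilate s f) (s * x) * f x)"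
      unfolding integrable_mult_dilate[OF s(1), symmetric]
      using integrable_mult_green_op[OF fm fM fm fM] by (simp add: mult.commute)
    show "f x * green_op f x + (- ln s * F * f x + ?k * (P * (?p x * f x) + N * (?n x * f x))) / pi
        \<le> green_op (dilate s f) (s * x) * f x" for x
    proof (cases "\<bar>x\<bar> < 1")
      case True
      from mult_right_mono[OF inner[OF True] nonneg[of x]] show ?thesis
        by (simp add: algebra_simps add_divide_distrib)
    next
      case False
      then show ?thesis using out[of x] by simp
    qed
  qed
  also have "\<dots> = (\<integral>x. dilate s f x * green_op (dilate s f) x \<partial>lborel)"
    by (subst integral_mult_dilate[OF s(1), symmetric]) (simp add: mult.commute)
  also have "(\<integral>x. f x * green_op f x + (- ln s * F * f x + ?k * (P * (?p x * f x) + N * (?n x * f x))) / pi \<partial>lborel)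
    = (\<integral>x. f x * green_op f x \<partial>lborel) + (- ln s * F * F + ?k * (P * P + N * N)) / pi"
    by (subst Bochner_Integration.integral_add)
       (simp_all add: integrable_mult_green_op[OF f M f M] intf intp del: integral_mult_left_zero add: F_def P_def N_def)
  finally show ?thesis by (simp add: power2_eq_square mult.assoc)
qed

text \<open>Expansion of the quadratic form around f. In the linear term the dilation is moved from
  the density to the argument of the potential, which keeps derivatives out of the
  expansion.\<close>

lemma dilated_energy_eq:
  assumes f[measurable]: "f \<in> borel_measurable borel" and M: "\<And>y. \<bar>f y\<bar> \<le> M" and s: "0 < s"
  defines "h \<equiv> \<lambda>x. dilate s f x - f x"
  shows "(\<integral>x. dilate s f x * green_op (dilate s f) x \<partial>lborel) = (\<integral>x. f x * green_op f x \<partial>lborel)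
    + 2 * (\<integral>x. f x * (green_op f (s * x) - green_op f x) \<partial>lborel) + (\<integral>x. h x * green_op h x \<partial>lborel)"
proof -
  have gm: "dilate s f \<in> borel_measurable borel" by measurable
  have gM: "\<bar>dilate s f y\<bar> \<le> M / s" for y by (rule dilate_bound[OF s M])
  have Gh: "green_op h x = green_op (dilate s f) x - green_op f x" for x
    unfolding h_def by (rule green_op_diff[OF gm gM f M])
  note i = integrable_mult_green_op[OF gm gM gm gM] integrable_mult_green_op[OF gm gM f M]
    integrable_mult_green_op[OF f M gm gM] integrable_mult_green_op[OF f M f M]
  have "(\<integral>x. h x * green_op h x \<partial>lborel) = (\<integral>x. dilate s f x * green_op (dilate s f) x - f x * green_op (dilate s f) x
      - (dilate s f x * green_op f x - f x * green_op f x) \<partial>lborel)"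
    unfolding Gh by (simp add: h_def algebra_simps)
  also have "\<dots> = (\<integral>x. dilate s f x * green_op (dilate s f) x \<partial>lborel) - (\<integral>x. f x * green_op (dilate s f) x \<partial>lborel)
      - ((\<integral>x. dilate s f x * green_op f x \<partial>lborel) - (\<integral>x. f x * green_op f x \<partial>lborel))"
    using i by simp
  also have "(\<integral>x. f x * green_op (dilate s f) x \<partial>lborel) = (\<integral>x. dilate s f x * green_op f x \<partial>lborel)"
    by (rule green_op_selfadjoint[OF gm gM f M])
  finally have 1: "(\<integral>x. h x * green_op h x \<partial>lborel) = (\<integral>x. dilate s f x * green_op (dilate s f) x \<partial>lborel)
      - 2 * (\<integral>x. dilate s f x * green_op f x \<partial>lborel) + (\<integral>x. f x * green_op f x \<partial>lborel)"
    by simp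
  have 2: "(\<integral>x. dilate s f x * green_op f x \<partial>lborel) = (\<integral>x. f x * green_op f (s * x) \<partial>lborel)"
    using integral_mult_dilate[OF s, of "green_op f" f] by (simp add: mult.commute)
  have "integrable lborel (\<lambda>x. f x * green_op f (s * x))"
    using integrable_mult_dilate[OF s, of "green_op f" f] i(3) by (simp add: mult.commute)
  then have "(\<integral>x. f x * (green_op f (s * x) - green_op f x) \<partial>lborel)
      = (\<integral>x. f x * green_op f (s * x) \<partial>lborel) - (\<integral>x. f x * green_op f x \<partial>lborel)"
    using i(4) by (simp add: right_diff_distrib)
  with 1 2 show ?thesis by simp
qed

lemma abs_green_op_le:
  assumes f[measurable]: "f \<in> borel_measurable borel" and M: "\<And>y. \<bar>f y\<bar> \<le> M"
  shows "\<bar>green_op f x\<bar> \<le> green_op (\<lambda>y. \<bar>f y\<bar>) x"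
proof -
  have m: "(\<lambda>y. \<bar>f y\<bar>) \<in> borel_measurable borel" "\<And>y. \<bar>\<bar>f y\<bar>\<bar> \<le> M" using M by auto
  have m': "(\<lambda>y. (-1) * \<bar>f y\<bar>) \<in> borel_measurable borel" "\<And>y. \<bar>(-1) * \<bar>f y\<bar>\<bar> \<le> M" using M by auto
  have "green_op f x \<le> green_op (\<lambda>y. \<bar>f y\<bar>) x"
    by (rule green_op_mono[OF f M m]) auto
  moreover have "green_op (\<lambda>y. (-1) * \<bar>f y\<bar>) x \<le> green_op f x"
    by (rule green_op_mono[OF m' f M]) auto
  then have "- green_op (\<lambda>y. \<bar>f y\<bar>) x \<le> green_op f x" unfolding green_op_cmult by simp
  ultimately show ?thesis by linarith
qed

lemma semicircle_near_boundary:
  assumes "1 - \<delta> \<le> \<bar>x\<bar>" "0 \<le> \<delta>"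
  shows "semicircle x \<le> 2 * sqrt \<delta>"
proof (cases "\<bar>x\<bar> < 1")
  case True
  have "semicircle x = sqrt ((1 - \<bar>x\<bar>) * (1 + \<bar>x\<bar>))"
    using True by (simp add: semicircle_eq algebra_simps power2_eq_square)
  also have "\<dots> \<le> sqrt (\<delta> * 2)" using assms True by (intro real_sqrt_le_mono mult_mono) auto
  also have "\<dots> \<le> sqrt (\<delta> * 4)" using assms by (intro real_sqrt_le_mono mult_left_mono) auto
  finally show ?thesis by (simp add: real_sqrt_mult)
qed (use assms in \<open>simp add: semicircle_outside\<close>)

text \<open>The quadratic remainder must become o(\<delta>). In the bulk h is O(sqrt \<delta>) by
  the Hoelder bound. On the end strips, of total length \<open>2 * \<delta>\<close>, it has order 1,
  but there potentials are O(sqrt \<delta>). Bounding the bulk crudely would give O(\<delta>) only,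
  so the L1 norm of h / sqrt \<delta> is kept in the estimate and shown to vanish
  separately.\<close>

lemma energy_dilation_defect_le:
  assumes f[measurable]: "f \<in> borel_measurable borel" and M: "\<And>y. \<bar>f y\<bar> \<le> M"
    and out: "\<And>y. 1 \<le> \<bar>y\<bar> \<Longrightarrow> f y = 0" and \<delta>: "0 < \<delta>" "\<delta> \<le> 1 / 2"
    and H: "\<And>x y. \<bar>x\<bar> < 1 \<Longrightarrow> \<bar>y\<bar> < 1 \<Longrightarrow> \<bar>f x - f y\<bar> \<le> H * sqrt \<bar>x - y\<bar>"
  defines "h \<equiv> \<lambda>x. dilate (1 - \<delta>) f x - f x"
  shows "\<And>x. \<bar>x\<bar> < 1 - \<delta> \<Longrightarrow> \<bar>h x\<bar> \<le> (2 * M + 2 * H) * sqrt \<delta>"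
    and "(\<integral>x. h x * green_op h x \<partial>lborel) \<le> \<delta> * ((2 * M + 2 * H) * ((\<integral>x. indicator {x. \<bar>x\<bar> < 1 - \<delta>} x * (\<bar>h x\<bar> / sqrt \<delta>) \<partial>lborel) + 2 * M * sqrt \<delta>)
        + 4 * M * (3 * M + 2 * H) * sqrt \<delta>)"
proof -
  define s where "s = 1 - \<delta>"
  define C where "C = 2 * M + 2 * H"
  define g where "g = (\<lambda>x. \<bar>h x\<bar>)"
  \<comment> \<open>\<open>b\<close> is 1 on the two end strips, where \<open>f (x / s)\<close> has
    already dropped to 0 and \<open>h\<close> equals \<open>- f\<close>.\<close>
  define b where "b = (\<lambda>x. indicator {s..1} x + indicator {-1..-s} x :: real)"
  define J where "J = (\<integral>x. indicator {x. \<bar>x\<bar> < s} x * (g x / sqrt \<delta>) \<partial>lborel)"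
  have s: "1 / 2 \<le> s" "s < 1" "0 < s" using \<delta> by (auto simp: s_def)
  have \<delta>_s: "\<delta> = 1 - s" by (simp add: s_def)
  have M0: "0 \<le> M" using M[of 0] by linarith
  have H0: "0 \<le> H" using order_trans[OF abs_ge_zero H[of 0 "1/4"]] by (simp add: zero_le_mult_iff)
  have sd: "\<delta> \<le> sqrt \<delta>" "sqrt \<delta> \<le> 1" "0 \<le> sqrt \<delta>"
  proof -
    show 1: "sqrt \<delta> \<le> 1" using \<delta> by (intro real_le_lsqrt) auto
    have "sqrt \<delta> * sqrt \<delta> \<le> sqrt \<delta> * 1" using 1 \<delta> by (intro mult_left_mono) auto
    then show "\<delta> \<le> sqrt \<delta>" using \<delta> by simp
  qed (use \<delta> in simp)
  have C0: "0 \<le> C" using M0 H0 by (simp add: C_def)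
  have inner: "\<bar>h x\<bar> \<le> C * sqrt \<delta>" if x: "\<bar>x\<bar> < s" for x
  proof -
    have xs: "\<bar>x / s\<bar> < 1" using x s by (simp add: abs_mult)
    have q: "x / s - x = x * (\<delta> / s)" "1 / s - 1 = \<delta> / s" using s by (simp_all add: \<delta>_s field_simps)
    have ds: "\<delta> / s \<le> 2 * \<delta>" "0 \<le> \<delta> / s" using s \<delta> by (simp_all add: field_simps)
    have "h x = (1 / s - 1) * f (x / s) + (f (x / s) - f x)"
      by (simp add: h_def s_def[symmetric] dilate_def algebra_simps)
    also have "\<bar>\<dots>\<bar> \<le> \<bar>(1 / s - 1) * f (x / s)\<bar> + \<bar>f (x / s) - f x\<bar>" by (rule abs_triangle_ineq)
    also have "\<dots> \<le> 2 * sqrt \<delta> * M + H * (2 * sqrt \<delta>)"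
    proof (intro add_mono)
      show "\<bar>(1 / s - 1) * f (x / s)\<bar> \<le> 2 * sqrt \<delta> * M"
        unfolding abs_mult q using ds sd M by (intro mult_mono) auto
      have "\<bar>f (x / s) - f x\<bar> \<le> H * sqrt \<bar>x / s - x\<bar>" using x s by (intro H xs) auto
      also have "\<dots> \<le> H * sqrt (4 * \<delta>)"
      proof (intro mult_left_mono H0 real_sqrt_le_mono)
        have "\<bar>x\<bar> * \<bar>\<delta> / s\<bar> \<le> 1 * (2 * \<delta>)" using x s ds \<delta> by (intro mult_mono) auto
        then show "\<bar>x / s - x\<bar> \<le> 4 * \<delta>" unfolding q abs_mult using \<delta> by linarith
      qed
      finally show "\<bar>f (x / s) - f x\<bar> \<le> H * (2 * sqrt \<delta>)" by (simp add: real_sqrt_mult)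
    qed
    finally show ?thesis by (simp add: C_def algebra_simps)
  qed
  then show "\<And>x. \<bar>x\<bar> < 1 - \<delta> \<Longrightarrow> \<bar>h x\<bar> \<le> (2 * M + 2 * H) * sqrt \<delta>"
    by (simp add: s_def C_def)
  have outer: "h x = - f x" if "s \<le> \<bar>x\<bar>" for x
    using that s out[of "x / s"] by (simp add: h_def s_def[symmetric] dilate_def)
  have h_le: "g x \<le> C * sqrt \<delta> + M * b x" if "\<bar>x\<bar> < 1" for x
  proof (cases "\<bar>x\<bar> < s")
    case True
    have "0 \<le> M * b x" using M0 by (simp add: b_def)
    then show ?thesis using inner[OF True] by (simp add: g_def)
  next
    case False
    have "b x = 1" using False that s by (auto simp: b_def indicator_def abs_if split: if_splits)
    moreover have "0 \<le> C * sqrt \<delta>" using C0 \<delta> by simp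
    ultimately show ?thesis using outer[of x] M[of x] False by (simp add: g_def)
  qed
  have hm[measurable]: "h \<in> borel_measurable borel" unfolding h_def by measurable
  have gm[measurable]: "g \<in> borel_measurable borel" unfolding g_def by measurable
  have bm[measurable]: "b \<in> borel_measurable borel" unfolding b_def by measurable
  have h_out: "h x = 0" if "1 \<le> \<bar>x\<bar>" for x using outer[of x] that s out[of x] by simp
  have gK: "\<bar>g x\<bar> \<le> C + M" for x
  proof (cases "\<bar>x\<bar> < s")
    case True
    have "C * sqrt \<delta> \<le> C * 1" using C0 sd by (intro mult_left_mono) auto
    then show ?thesis using inner[OF True] M0 by (simp add: g_def)
  next
    case False
    then show ?thesis using outer[of x] M[of x] C0 by (simp add: g_def)
  qed
  have hK: "\<bar>h x\<bar> \<le> C + M" for x using gK[of x] by (simp add: g_def)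
  have bK: "\<bar>b x\<bar> \<le> 2" for x by (auto simp: b_def indicator_def)
  have int_g: "integrable lborel g"
    by (rule integrable_bounded_on_unit[OF gm gK]) (simp add: g_def h_out)
  have int_b: "has_bochner_integral lborel b (\<delta> + \<delta>)"
  proof -
    have "has_bochner_integral lborel (indicator {s..1} :: real \<Rightarrow> real) \<delta>" "has_bochner_integral lborel (indicator {-1..-s} :: real \<Rightarrow> real) \<delta>"
      using s by (auto simp: has_bochner_integral_iff \<delta>_s emeasure_lborel_Icc_eq intro!: integrable_real_indicator)
    then show ?thesis unfolding b_def by (rule has_bochner_integral_add)
  qed
  have b_int: "integrable lborel b" "(\<integral>x. b x \<partial>lborel) = 2 * \<delta>"
    using int_b by (auto simp: has_bochner_integral_iff)
  have iGg: "integrable lborel (\<lambda>x. green_op g x)"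
    using integrable_mult_green_op[OF gm gK, of "\<lambda>_. 1" 1] by simp
  have ibGg: "integrable lborel (\<lambda>x. b x * green_op g x)"
    by (rule integrable_mult_green_op[OF gm gK bm bK])
  have Gg0: "0 \<le> green_op g x" for x by (rule green_op_nonneg) (simp add: g_def)
  have "(\<integral>x. h x * green_op h x \<partial>lborel) \<le> (\<integral>x. C * sqrt \<delta> * green_op g x + M * (b x * green_op g x) \<partial>lborel)"
  proof (rule integral_mono)
    show "integrable lborel (\<lambda>x. h x * green_op h x)"
      by (rule integrable_mult_green_op[OF hm hK hm hK])
    show "integrable lborel (\<lambda>x. C * sqrt \<delta> * green_op g x + M * (b x * green_op g x))"
      by (intro Bochner_Integration.integrable_add integrable_mult_right iGg ibGg)
    fix x
    show "h x * green_op h x \<le> C * sqrt \<delta> * green_op g x + M * (b x * green_op g x)"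
    proof (cases "\<bar>x\<bar> < 1")
      case True
      have "h x * green_op h x \<le> \<bar>h x\<bar> * \<bar>green_op h x\<bar>" by (metis abs_ge_self abs_mult)
      also have "\<dots> \<le> g x * green_op g x"
        using abs_green_op_le[OF hm hK] by (intro mult_mono) (auto simp: g_def)
      also have "\<dots> \<le> (C * sqrt \<delta> + M * b x) * green_op g x"
        by (intro mult_right_mono h_le True Gg0)
      finally show ?thesis by (simp add: algebra_simps)
    qed (simp add: green_op_outside)
  qed
  also have "\<dots> = C * sqrt \<delta> * (\<integral>x. green_op g x \<partial>lborel) + M * (\<integral>x. b x * green_op g x \<partial>lborel)"
    using iGg ibGg by simp
  also have "\<dots> \<le> C * sqrt \<delta> * (sqrt \<delta> * J + 2 * M * \<delta>) + M * ((C + M) * (2 * sqrt \<delta>) * (2 * \<delta>))"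
  proof (intro add_mono mult_left_mono M0)
    have "(\<integral>x. green_op g x \<partial>lborel) = (\<integral>x. g x * semicircle x \<partial>lborel)"
      using green_op_selfadjoint[OF gm gK, of "\<lambda>_. 1" 1] by (simp add: green_op_const)
    also have "\<dots> \<le> (\<integral>x. sqrt \<delta> * (indicator {x. \<bar>x\<bar> < s} x * (g x / sqrt \<delta>)) + M * b x \<partial>lborel)"
    proof (rule integral_mono)
      have iJ: "integrable lborel (\<lambda>x. indicator {x. \<bar>x\<bar> < s} x * (g x / sqrt \<delta>))"
        by (rule Bochner_Integration.integrable_bound[OF integrable_divide[OF int_g, of "sqrt \<delta>"]])
           (auto simp: indicator_def)
      then show "integrable lborel (\<lambda>x. sqrt \<delta> * (indicator {x. \<bar>x\<bar> < s} x * (g x / sqrt \<delta>)) + M * b x)"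
        by (intro Bochner_Integration.integrable_add integrable_mult_right b_int)
      show "integrable lborel (\<lambda>x. g x * semicircle x)"
      proof (rule integrable_bounded_on_unit)
        show "\<bar>g y * semicircle y\<bar> \<le> (C + M) * 1" for y
          unfolding abs_mult using gK[of y] C0 M0 by (intro mult_mono) (auto simp: semicircle_le_1)
      qed (simp_all add: semicircle_outside)
      fix x
      have "g x * semicircle x \<le> g x" using mult_left_mono[OF semicircle_le_1, of "g x" x] by (simp add: g_def)
      also have "\<dots> \<le> sqrt \<delta> * (indicator {x. \<bar>x\<bar> < s} x * (g x / sqrt \<delta>)) + M * b x"
      proof (cases "\<bar>x\<bar> < s")
        case True
        then show ?thesis using \<delta> M0 by (simp add: b_def)
      next
        case F: False
        show ?thesis
        proof (cases "\<bar>x\<bar> < 1")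
          case True
          have "b x = 1" using F True s by (auto simp: b_def indicator_def abs_if split: if_splits)
          then show ?thesis using outer[of x] M[of x] F by (simp add: g_def)
        next
          case False
          then show ?thesis using h_out[of x] M0 F by (simp add: g_def b_def)
        qed
      qed
      finally show "g x * semicircle x \<le> sqrt \<delta> * (indicator {x. \<bar>x\<bar> < s} x * (g x / sqrt \<delta>)) + M * b x" .
    qed
    also have "\<dots> = sqrt \<delta> * J + M * (2 * \<delta>)"
    proof -
      have iJ: "integrable lborel (\<lambda>x. indicator {x. \<bar>x\<bar> < s} x * (g x / sqrt \<delta>))"
        by (rule Bochner_Integration.integrable_bound[OF integrable_divide[OF int_g, of "sqrt \<delta>"]])
           (auto simp: indicator_def)
      then show ?thesis
        using Bochner_Integration.integral_add[OF integrable_mult_right[OF iJ, of "sqrt \<delta>"] integrable_mult_right[OF b_int(1), of M]]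
        unfolding J_def b_int(2)[symmetric] integral_mult_right_zero by simp
    qed
    finally show "(\<integral>x. green_op g x \<partial>lborel) \<le> sqrt \<delta> * J + 2 * M * \<delta>" by simp
    have "(\<integral>x. b x * green_op g x \<partial>lborel) \<le> (\<integral>x. (C + M) * (2 * sqrt \<delta>) * b x \<partial>lborel)"
    proof (intro integral_mono ibGg integrable_mult_right b_int)
      fix x
      show "b x * green_op g x \<le> (C + M) * (2 * sqrt \<delta>) * b x"
      proof (cases "s \<le> \<bar>x\<bar>")
        case True
        have "green_op g x \<le> (C + M) * semicircle x"
          using green_op_bound[OF gm gK, of x] by linarith
        also have "\<dots> \<le> (C + M) * (2 * sqrt \<delta>)"
          using True C0 M0 \<delta> by (intro mult_left_mono semicircle_near_boundary) (auto simp: s_def)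
        finally have "green_op g x * b x \<le> (C + M) * (2 * sqrt \<delta>) * b x"
          by (rule mult_right_mono) (simp add: b_def)
        then show ?thesis by (simp add: mult.commute)
      next
        case False
        then have "b x = 0" by (auto simp: b_def indicator_def abs_if split: if_splits)
        then show ?thesis by simp
      qed
    qed
    then show "(\<integral>x. b x * green_op g x \<partial>lborel) \<le> (C + M) * (2 * sqrt \<delta>) * (2 * \<delta>)"
      by (simp add: b_int(2) mult_ac)
  qed (use C0 \<delta> in simp)
  also have "\<dots> = \<delta> * (C * (J + 2 * M * sqrt \<delta>) + 4 * M * (C + M) * sqrt \<delta>)"
  proof -
    have "C * q * (q * J + 2 * M * (q * q)) + M * ((C + M) * (2 * q) * (2 * (q * q))) = q * q * (C * (J + 2 * M * q) + 4 * M * (C + M) * q)" for q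
      by (simp add: algebra_simps)
    from this[of "sqrt \<delta>"] show ?thesis using \<delta> by simp
  qed
  finally show "(\<integral>x. h x * green_op h x \<partial>lborel) \<le> \<delta> * ((2 * M + 2 * H) * ((\<integral>x. indicator {x. \<bar>x\<bar> < 1 - \<delta>} x * (\<bar>h x\<bar> / sqrt \<delta>) \<partial>lborel) + 2 * M * sqrt \<delta>)
        + 4 * M * (3 * M + 2 * H) * sqrt \<delta>)"
    by (simp add: J_def C_def g_def s_def algebra_simps)
qed

text \<open>At a point of differentiability the numerator is O(d n), so the integrand is O(sqrt (d
  n)) there; the hypothesis \<open>bound\<close> supplies the constant majorant.\<close>

lemma dilation_defect_integral_tendsto_0:
  assumes f[measurable]: "f \<in> borel_measurable borel"
    and diff: "\<And>x. \<bar>x\<bar> < 1 \<Longrightarrow> \<exists>D. (f has_real_derivative D) (at x)"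
    and d: "d \<longlonglongrightarrow> 0" "\<And>n. 0 < d n"
    and bound: "\<And>n x. \<bar>x\<bar> < 1 - d n \<Longrightarrow> \<bar>dilate (1 - d n) f x - f x\<bar> \<le> C * sqrt (d n)"
  shows "(\<lambda>n. \<integral>x. indicator {x. \<bar>x\<bar> < 1 - d n} x * (\<bar>dilate (1 - d n) f x - f x\<bar> / sqrt (d n)) \<partial>lborel) \<longlonglongrightarrow> 0"
proof -
  let ?\<phi> = "\<lambda>n x. indicator {x. \<bar>x\<bar> < 1 - d n} x * (\<bar>dilate (1 - d n) f x - f x\<bar> / sqrt (d n)) :: real"
  have "(\<lambda>n. \<integral>x. ?\<phi> n x \<partial>lborel) \<longlonglongrightarrow> (\<integral>x. 0 \<partial>(lborel :: real measure))"
  proof (rule integral_dominated_convergence)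
    show "integrable lborel (\<lambda>x. indicator {-1..1::real} x * \<bar>C\<bar>)" by (intro integrable_mult_left) simp
    show "AE x in lborel. norm (?\<phi> n x) \<le> indicator {-1..1} x * \<bar>C\<bar>" for n
    proof (intro AE_I2)
      fix x
      show "norm (?\<phi> n x) \<le> indicator {-1..1} x * \<bar>C\<bar>"
      proof (cases "\<bar>x\<bar> < 1 - d n")
        case True
        have "\<bar>dilate (1 - d n) f x - f x\<bar> / sqrt (d n) \<le> C * sqrt (d n) / sqrt (d n)"
          using d(2)[of n] by (intro divide_right_mono bound True) simp
        also have "\<dots> \<le> \<bar>C\<bar>" using d(2)[of n] by simp
        finally have "\<bar>dilate (1 - d n) f x - f x\<bar> / sqrt (d n) \<le> \<bar>C\<bar>" .
        moreover have "x \<in> {-1..1}" using True d(2)[of n] by auto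
        ultimately show ?thesis using True d(2)[of n] by simp
      qed auto
    qed
    show "AE x in lborel. (\<lambda>n. ?\<phi> n x) \<longlonglongrightarrow> 0"
    proof (intro AE_I2)
      fix x
      show "(\<lambda>n. ?\<phi> n x) \<longlonglongrightarrow> 0"
      proof (cases "\<bar>x\<bar> < 1")
        case False
        then have "indicator {x. \<bar>x\<bar> < 1 - d n} x = (0::real)" for n using d(2)[of n] by simp
        then show ?thesis by (simp only: mult_zero_left tendsto_const)
      next
        case True
        then obtain D where D: "(f has_real_derivative D) (at x)" using diff by blast
        have "((\<lambda>s. f (x / s) / s) has_real_derivative ((D * (- x)) * 1 - f (x / 1) * 1) / (1 * 1)) (at 1)"
        proof (rule DERIV_divide)
          show "((\<lambda>s. f (x / s)) has_real_derivative D * - x) (at 1)"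
            by (rule DERIV_chain2[of f D]) (use D in \<open>auto intro!: derivative_eq_intros\<close>)
        qed auto
        then have q: "((\<lambda>h. (f (x / (1 + h)) / (1 + h) - f (x / 1) / 1) / h) \<longlongrightarrow> D * - x * 1 - f x) (at 0)"
          unfolding DERIV_def by simp
        have fl: "filterlim (\<lambda>n. - d n) (at 0) sequentially"
          unfolding filterlim_at using d(2) tendsto_minus[OF d(1)]
          by (auto intro!: always_eventually simp: less_imp_neq[symmetric])
        have "(\<lambda>n. \<bar>(f (x / (1 + - d n)) / (1 + - d n) - f (x / 1) / 1) / - d n\<bar> * sqrt (d n))
            \<longlonglongrightarrow> \<bar>D * - x * 1 - f x\<bar> * sqrt 0"
          by (intro tendsto_intros filterlim_compose[OF q fl] d)
        then have z: "(\<lambda>n. \<bar>(f (x / (1 + - d n)) / (1 + - d n) - f (x / 1) / 1) / - d n\<bar> * sqrt (d n)) \<longlonglongrightarrow> 0"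
          by simp
        show ?thesis
        proof (rule Lim_null_comparison[OF always_eventually z], rule allI)
          fix n
          have "sqrt (d n) * sqrt (d n) = d n" using d(2)[of n] by simp
          then have "\<bar>(f (x / (1 + - d n)) / (1 + - d n) - f (x / 1) / 1) / - d n\<bar> * sqrt (d n)
              = \<bar>dilate (1 - d n) f x - f x\<bar> / sqrt (d n)"
            using d(2)[of n] by (simp add: dilate_def abs_mult field_simps)
          then show "norm (?\<phi> n x) \<le> \<bar>(f (x / (1 + - d n)) / (1 + - d n) - f (x / 1) / 1) / - d n\<bar> * sqrt (d n)"
            using d(2)[of n] by (simp add: indicator_def)
        qed
      qed
    qed
  qed measurable
  then show ?thesis by simp
qed

section \<open>The mean field equation and its mass\<close>

lemma abs_exp_diff_le:
  fixes a b B :: real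
  assumes "a \<le> B" "b \<le> B"
  shows "\<bar>exp a - exp b\<bar> \<le> exp B * \<bar>a - b\<bar>"
proof -
  have *: "exp a - exp b \<le> exp B * \<bar>a - b\<bar>" if "a \<le> B" for a b :: real
  proof -
    have "exp a * (1 + (b - a)) \<le> exp a * exp (b - a)" by (intro mult_left_mono exp_ge_add_one_self) simp
    then have "exp a - exp b \<le> exp a * (a - b)" by (simp add: exp_diff algebra_simps)
    also have "\<dots> \<le> exp a * \<bar>a - b\<bar>" by (intro mult_left_mono) auto
    also have "\<dots> \<le> exp B * \<bar>a - b\<bar>" using that by (intro mult_right_mono) auto
    finally show ?thesis .
  qed
  show ?thesis using *[OF assms(1), of b] *[OF assms(2), of a] by (simp add: abs_le_iff abs_minus_commute)
qed

text \<open>Differentiability covers the neighbourhood of x, boundedness the rest. The result is the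
  constant that \<open>has_half_laplacian_green_op\<close> asks for.\<close>

lemma differentiable_imp_global_linear_bound:
  fixes f :: "real \<Rightarrow> real"
  assumes D: "(f has_real_derivative D) (at x)" and M: "\<And>y. \<bar>f y\<bar> \<le> M"
  shows "\<exists>C. \<forall>y. \<bar>f y - f x\<bar> \<le> C * \<bar>y - x\<bar>"
proof -
  have "((\<lambda>y. (f y - f x) / (y - x)) \<longlongrightarrow> D) (at x)"
    using D by (simp add: has_field_derivative_iff)
  then have "\<forall>\<^sub>F y in at x. dist ((f y - f x) / (y - x)) D < 1" by (rule tendstoD) simp
  then obtain d where d: "0 < d" "\<And>y. y \<noteq> x \<Longrightarrow> dist y x < d \<Longrightarrow> dist ((f y - f x) / (y - x)) D < 1"
    unfolding eventually_at by auto
  have "\<bar>f y - f x\<bar> \<le> (\<bar>D\<bar> + 1 + 2 * M / d) * \<bar>y - x\<bar>" for y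
  proof -
    have M0: "0 \<le> M" using M[of x] by linarith
    consider "y = x" | "y \<noteq> x" "\<bar>y - x\<bar> < d" | "d \<le> \<bar>y - x\<bar>" by linarith
    then show ?thesis
    proof cases
      case 2
      then have "\<bar>(f y - f x) / (y - x) - D\<bar> < 1" using d(2)[of y] by (simp add: dist_real_def)
      then have "\<bar>(f y - f x) / (y - x)\<bar> \<le> \<bar>D\<bar> + 1" by linarith
      then have "\<bar>(f y - f x) / (y - x)\<bar> * \<bar>y - x\<bar> \<le> (\<bar>D\<bar> + 1) * \<bar>y - x\<bar>"
        by (rule mult_right_mono) simp
      moreover have "\<bar>(f y - f x) / (y - x)\<bar> * \<bar>y - x\<bar> = \<bar>f y - f x\<bar>"
        using 2(1) by simp
      ultimately have "\<bar>f y - f x\<bar> \<le> (\<bar>D\<bar> + 1) * \<bar>y - x\<bar>" by simp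
      also have "\<dots> \<le> (\<bar>D\<bar> + 1 + 2 * M / d) * \<bar>y - x\<bar>" using M0 d(1) by (intro mult_right_mono) auto
      finally show ?thesis .
    next
      case 3
      have "\<bar>f y - f x\<bar> \<le> 2 * M" using M[of x] M[of y] by linarith
      also have "\<dots> = 2 * M / d * d" using d(1) by simp
      also have "\<dots> \<le> (\<bar>D\<bar> + 1 + 2 * M / d) * \<bar>y - x\<bar>"
        using 3 M0 d(1) by (intro mult_mono) auto
      finally show ?thesis .
    qed simp
  qed
  then show ?thesis by blast
qed

text \<open>For a solution, \<open>lam\<close> is \<rho> divided by the integral of exp u over the
  interval: the nonlocal denominator becomes a constant, and \<rho> reappears as the mass of
  \<open>f\<close>.\<close>

locale mean_field =
  fixes lam B :: real and u f :: "real \<Rightarrow> real"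
  assumes lam_pos: "0 < lam"
    and f_def: "f = (\<lambda>x. if \<bar>x\<bar> < 1 then lam * exp (u x) else 0)"
    and u_eq: "u = green_op f"
    and u_bound: "\<And>x. \<bar>u x\<bar> \<le> B"
    and u_cont: "continuous_on UNIV u"
    and u_diff: "\<And>x. \<bar>x\<bar> < 1 \<Longrightarrow> \<exists>D. (u has_real_derivative D) (at x)"
begin

lemma u_measurable [measurable]: "u \<in> borel_measurable borel"
  by (rule borel_measurable_continuous_onI[OF u_cont])

lemma f_measurable [measurable]: "f \<in> borel_measurable borel"
  unfolding f_def by measurable

lemma f_nonneg: "0 \<le> f x"
  using lam_pos by (simp add: f_def)

lemma f_bound: "\<bar>f x\<bar> \<le> lam * exp B"
proof -
  have "u x \<le> B" using u_bound[of x] by linarith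
  then show ?thesis using lam_pos by (simp add: f_def)
qed

lemma f_outside: "1 \<le> \<bar>x\<bar> \<Longrightarrow> f x = 0"
  by (simp add: f_def)

lemma u_nonneg: "0 \<le> u x"
  unfolding u_eq by (rule green_op_nonneg) (rule f_nonneg)

lemma f_ge: "\<bar>x\<bar> < 1 \<Longrightarrow> lam \<le> f x"
  using lam_pos u_nonneg[of x] by (simp add: f_def)

lemma f_integrable: "integrable lborel f"
  by (rule integrable_bounded_on_unit[OF f_measurable f_bound]) (simp add: f_def)

lemma f_holder:
  assumes "\<bar>x\<bar> < 1" "\<bar>y\<bar> < 1"
  shows "\<bar>f x - f y\<bar> \<le> 9 * (lam * exp B)\<^sup>2 * sqrt \<bar>x - y\<bar>"
proof -
  have "\<bar>f x - f y\<bar> = lam * \<bar>exp (u x) - exp (u y)\<bar>"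
    using assms lam_pos by (simp add: f_def abs_mult flip: right_diff_distrib)
  also have "\<dots> \<le> lam * (exp B * \<bar>u x - u y\<bar>)"
    using lam_pos u_bound[of x] u_bound[of y] by (intro mult_left_mono abs_exp_diff_le) auto
  also have "\<dots> \<le> lam * (exp B * (9 * (lam * exp B) * sqrt \<bar>x - y\<bar>))"
    using lam_pos green_op_holder[OF f_measurable f_bound, of x y]
    by (intro mult_left_mono) (auto simp: u_eq)
  finally show ?thesis by (simp add: power2_eq_square mult_ac)
qed

lemma f_diff:
  assumes "\<bar>x\<bar> < 1"
  shows "\<exists>D. (f has_real_derivative D) (at x)"
proof -
  obtain D where D: "(u has_real_derivative D) (at x)" using u_diff assms by blast
  have "((\<lambda>x. lam * exp (u x)) has_real_derivative lam * (exp (u x) * D)) (at x)"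
    by (intro DERIV_cmult DERIV_fun_exp D)
  then have "(f has_real_derivative lam * (exp (u x) * D)) (at x)"
    by (rule has_field_derivative_transform_within_open[of _ _ _ "{-1<..<1}"])
       (use assms in \<open>auto simp: f_def\<close>)
  then show ?thesis by blast
qed

text \<open>Convexity of exp takes the place of an integration by parts: inside the interval,
  \<open>f x * (u (s * x) - u x)\<close> is at most \<open>f (s * x) - f x\<close>. After rescaling,
  the mass in (-s,s) divided by s is compared with the whole mass. The two strips left out carry at
  least \<open>2 * (1 - s) * lam\<close>, as u is nonnegative; this is the origin of
  \<open>- 2 * lam\<close>.\<close>

lemma integral_dilated_increment_le:
  assumes s: "0 < s" "s < 1"
  shows "(\<integral>x. f x * (u (s * x) - u x) \<partial>lborel) \<le> (1 - s) / s * ((\<integral>x. f x \<partial>lborel) - 2 * lam)"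
proof -
  let ?I = "\<lambda>x. indicator {-s<..<s} x :: real" and ?U = "\<lambda>x. indicator {-1<..<1} x :: real"
  let ?b = "\<lambda>x. indicator {s..<1} x + indicator {-1<..-s} x :: real"
  have iI: "integrable lborel (\<lambda>x. ?I x * f x)"
    by (rule Bochner_Integration.integrable_bound[OF f_integrable]) (auto simp: indicator_def)
  have sc: "?U x * f (s * x) = ?I (0 + s * x) * f (0 + s * x)" for x
  proof -
    have "s * x < s \<longleftrightarrow> x < 1" "- s < s * x \<longleftrightarrow> - 1 < x"
      using s mult_less_cancel_left_pos[of s x 1] mult_less_cancel_left_pos[of s "-1" x] by simp_all
    then show ?thesis by (simp add: indicator_def)
  qed
  have iU: "integrable lborel (\<lambda>x. ?U x * f (s * x))"
    unfolding sc using s by (intro lborel_integrable_real_affine iI) auto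
  have "(\<integral>x. f x * (u (s * x) - u x) \<partial>lborel) \<le> (\<integral>x. ?U x * f (s * x) - f x \<partial>lborel)"
  proof (rule integral_mono)
    have "continuous_on UNIV (\<lambda>x. u (s * x))"
      by (rule continuous_on_compose2[OF u_cont]) (auto intro!: continuous_intros)
    then have [measurable]: "(\<lambda>x. u (s * x)) \<in> borel_measurable borel" by (rule borel_measurable_continuous_onI)
    show "integrable lborel (\<lambda>x. f x * (u (s * x) - u x))"
    proof (rule integrable_bounded_on_unit)
      show "\<bar>f y * (u (s * y) - u y)\<bar> \<le> lam * exp B * (2 * B)" for y
        unfolding abs_mult using f_bound[of y] u_bound[of y] u_bound[of "s * y"] by (intro mult_mono) auto
    qed (auto simp: f_outside)
    show "integrable lborel (\<lambda>x. ?U x * f (s * x) - f x)" by (intro Bochner_Integration.integrable_diff iU f_integrable)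
    fix x
    show "f x * (u (s * x) - u x) \<le> ?U x * f (s * x) - f x"
    proof (cases "\<bar>x\<bar> < 1")
      case True
      have sx: "\<bar>s * x\<bar> < 1" using True s mult_strict_mono'[of s 1 "\<bar>x\<bar>" 1] by (simp add: abs_mult)
      have "exp (u x) * (1 + (u (s * x) - u x)) \<le> exp (u x) * exp (u (s * x) - u x)"
        by (intro mult_left_mono exp_ge_add_one_self) simp
      then have "exp (u x) * (u (s * x) - u x) \<le> exp (u (s * x)) - exp (u x)"
        by (simp add: exp_diff algebra_simps)
      from mult_left_mono[OF this, of lam] show ?thesis
        using True sx lam_pos by (simp add: f_def indicator_def right_diff_distrib mult.assoc) (auto simp: abs_less_iff)
    next
      case False
      then show ?thesis by (auto simp: f_def indicator_def)
    qed
  qed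
  also have "\<dots> = (\<integral>x. ?U x * f (s * x) \<partial>lborel) - (\<integral>x. f x \<partial>lborel)"
    using iU f_integrable by simp
  also have "(\<integral>x. ?U x * f (s * x) \<partial>lborel) = (\<integral>x. ?I x * f x \<partial>lborel) / s"
    unfolding sc using s by (subst lborel_integral_real_affine[where c=s and t=0, of "\<lambda>x. ?I x * f x"]) auto
  also have "(\<integral>x. ?I x * f x \<partial>lborel) \<le> (\<integral>x. f x - lam * ?b x \<partial>lborel)"
  proof (rule integral_mono[OF iI])
    show "integrable lborel (\<lambda>x. f x - lam * ?b x)"
      using s by (intro Bochner_Integration.integrable_diff f_integrable integrable_mult_right Bochner_Integration.integrable_add integrable_real_indicator)
        simp_all
    fix x
    consider "\<bar>x\<bar> < s" | "s \<le> \<bar>x\<bar>" "\<bar>x\<bar> < 1" | "1 \<le> \<bar>x\<bar>" by linarith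
    then show "?I x * f x \<le> f x - lam * ?b x"
    proof cases
      case 1
      then have "?b x = 0" "?I x = 1" by (auto simp: indicator_def)
      then show ?thesis by simp
    next
      case 2
      then have "?b x = 1" "?I x = 0" using s by (auto simp: indicator_def abs_if split: if_splits)
      then show ?thesis using f_ge[of x] 2 by simp
    next
      case 3
      then have "?b x = 0" "?I x = 0" using s by (auto simp: indicator_def abs_if split: if_splits)
      then show ?thesis using f_nonneg[of x] by simp
    qed
  qed
  also have "(\<integral>x. f x - lam * ?b x \<partial>lborel) = (\<integral>x. f x \<partial>lborel) - lam * (2 * (1 - s))"
  proof -
    have "has_bochner_integral lborel (indicator {s..<1} :: real \<Rightarrow> real) (1 - s)" "has_bochner_integral lborel (indicator {-1<..-s} :: real \<Rightarrow> real) (1 - s)"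
      using s by (auto simp: has_bochner_integral_iff intro!: integrable_real_indicator)
    from has_bochner_integral_add[OF this] have b: "has_bochner_integral lborel ?b (2 * (1 - s))" by simp
    have "has_bochner_integral lborel (\<lambda>x. f x - lam * ?b x) ((\<integral>x. f x \<partial>lborel) - lam * (2 * (1 - s)))"
      by (intro has_bochner_integral_diff has_bochner_integral_integrable f_integrable has_bochner_integral_mult_right b)
    then show ?thesis by (rule has_bochner_integral_integral_eq)
  qed
  finally have "(\<integral>x. f x * (u (s * x) - u x) \<partial>lborel)
      \<le> ((\<integral>x. f x \<partial>lborel) - lam * (2 * (1 - s))) / s - (\<integral>x. f x \<partial>lborel)"
    using s by (simp add: divide_right_mono)
  also have "\<dots> = (1 - s) / s * ((\<integral>x. f x \<partial>lborel) - 2 * lam)"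
    using s by (simp add: field_simps)
  finally show ?thesis .
qed

text \<open>The lower bound for the dilated energy and its expansion are compared to first order in
  1 - s; dividing by 1 - s and letting s tend to 1 leaves the inequality.\<close>

theorem pohozaev_inequality:
  assumes \<eta>: "0 \<le> \<eta>"
  defines "F \<equiv> \<integral>y. f y \<partial>lborel" and "P \<equiv> \<integral>y. indicator {\<eta><..} y * f y \<partial>lborel"
    and "N \<equiv> \<integral>y. indicator {..<-\<eta>} y * f y \<partial>lborel"
  shows "F\<^sup>2 + \<eta>\<^sup>2 * (P\<^sup>2 + N\<^sup>2) \<le> 2 * pi * (F - 2 * lam)"
proof -
  let ?M = "lam * exp B" and ?H = "9 * (lam * exp B)\<^sup>2"
  define d where "d = (\<lambda>n. inverse (real (Suc (Suc n))))"
  have d: "0 < d n" "d n \<le> 1 / 2" for n by (auto simp: d_def divide_simps)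
  have d_lim: "d \<longlonglongrightarrow> 0" unfolding d_def by (rule LIMSEQ_Suc[OF LIMSEQ_inverse_real_of_nat])
  define J where "J = (\<lambda>n. \<integral>x. indicator {x. \<bar>x\<bar> < 1 - d n} x * (\<bar>dilate (1 - d n) f x - f x\<bar> / sqrt (d n)) \<partial>lborel)"
  define r where "r = (\<lambda>n. (2 * ?M + 2 * ?H) * (J n + 2 * ?M * sqrt (d n)) + 4 * ?M * (3 * ?M + 2 * ?H) * sqrt (d n))"
  \<comment> \<open>With s = 1 - d n, the product \<open>d n * c n\<close> is the quantity
    \<open>(1 - s\<^sup>2) * \<eta>\<^sup>2 / 2\<close> of the energy bound, and \<open>c n\<close>
    tends to \<open>\<eta>\<^sup>2\<close>.\<close>
  define c where "c = (\<lambda>n. (2 - d n) * \<eta>\<^sup>2 / 2)"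
  note defect = energy_dilation_defect_le[OF f_measurable f_bound f_outside d f_holder]
  have "J \<longlonglongrightarrow> 0" unfolding J_def
    by (rule dilation_defect_integral_tendsto_0[OF f_measurable f_diff d_lim d(1) defect(1)])
  then have "r \<longlonglongrightarrow> (2 * ?M + 2 * ?H) * (0 + 2 * ?M * sqrt 0) + 4 * ?M * (3 * ?M + 2 * ?H) * sqrt 0"
    unfolding r_def by (intro tendsto_intros d_lim)
  then have r: "r \<longlonglongrightarrow> 0" by simp
  have W: "0 \<le> P\<^sup>2 + N\<^sup>2" by simp
  have step: "(F\<^sup>2 + c n / (1 + d n * c n) * (P\<^sup>2 + N\<^sup>2)) / pi \<le> 2 * (1 / (1 - d n) * (F - 2 * lam)) + r n" for n
  proof -
    let ?s = "1 - d n"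
    have s: "0 < ?s" "?s < 1" using d[of n] by auto
    have z: "(1 - ?s\<^sup>2) * \<eta>\<^sup>2 / 2 = d n * c n" by (simp add: c_def power2_eq_square algebra_simps)
    have c0: "0 \<le> d n * c n" using d[of n] by (simp add: c_def)
    \<comment> \<open>Both logarithms are replaced by lower bounds with the factor
      \<open>d n\<close>: - ln (1 - d) \<ge> d and ln (1 + z) \<ge> z / (1 + z).\<close>
    have "d n * F\<^sup>2 + d n * (c n / (1 + d n * c n)) * (P\<^sup>2 + N\<^sup>2) \<le> - ln ?s * F\<^sup>2 + ln (1 + d n * c n) * (P\<^sup>2 + N\<^sup>2)"
    proof (intro add_mono mult_right_mono W)
      show "d n \<le> - ln ?s" using ln_le_minus_one[OF s(1)] by simp
      have "ln (1 / (1 + d n * c n)) \<le> 1 / (1 + d n * c n) - 1" using c0 by (intro ln_le_minus_one) auto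
      moreover have "1 / (1 + d n * c n) - 1 = - (d n * (c n / (1 + d n * c n)))" using c0 by (simp add: field_simps)
      ultimately show "d n * (c n / (1 + d n * c n)) \<le> ln (1 + d n * c n)" using c0 by (simp add: ln_div)
    qed simp
    then have "d n * ((F\<^sup>2 + c n / (1 + d n * c n) * (P\<^sup>2 + N\<^sup>2)) / pi)
        \<le> (- ln ?s * F\<^sup>2 + ln (1 + (1 - ?s\<^sup>2) * \<eta>\<^sup>2 / 2) * (P\<^sup>2 + N\<^sup>2)) / pi"
      unfolding z by (subst times_divide_eq_right, intro divide_right_mono) (simp_all only: distrib_left mult.assoc pi_ge_zero)
    also have "\<dots> \<le> 2 * (\<integral>x. f x * (green_op f (?s * x) - green_op f x) \<partial>lborel)
        + (\<integral>x. (dilate ?s f x - f x) * green_op (\<lambda>x. dilate ?s f x - f x) x \<partial>lborel)"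
      using dilated_energy_ge[OF f_measurable f_bound f_nonneg f_outside s \<eta>]
        dilated_energy_eq[OF f_measurable f_bound s(1)]
      unfolding F_def[symmetric] P_def[symmetric] N_def[symmetric] by linarith
    also have "\<dots> \<le> 2 * (d n / ?s * (F - 2 * lam)) + d n * r n"
      using integral_dilated_increment_le[OF s] defect(2)[of n]
      unfolding u_eq[symmetric] F_def[symmetric] r_def J_def by (intro add_mono mult_left_mono) auto
    also have "\<dots> = d n * (2 * (1 / ?s * (F - 2 * lam)) + r n)"
      by (simp add: distrib_left)
    finally have "d n * ((F\<^sup>2 + c n / (1 + d n * c n) * (P\<^sup>2 + N\<^sup>2)) / pi)
        \<le> d n * (2 * (1 / ?s * (F - 2 * lam)) + r n)" .
    then show ?thesis using d(1)[of n] by (simp only: mult_le_cancel_left_pos)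
  qed
  have c: "c \<longlonglongrightarrow> (2 - 0) * \<eta>\<^sup>2 / 2" unfolding c_def by (intro tendsto_intros d_lim) simp
  have "(\<lambda>n. (F\<^sup>2 + c n / (1 + d n * c n) * (P\<^sup>2 + N\<^sup>2)) / pi)
      \<longlonglongrightarrow> (F\<^sup>2 + ((2 - 0) * \<eta>\<^sup>2 / 2) / (1 + 0 * ((2 - 0) * \<eta>\<^sup>2 / 2)) * (P\<^sup>2 + N\<^sup>2)) / pi"
    by (intro tendsto_intros d_lim c) auto
  moreover have "(\<lambda>n. 2 * (1 / (1 - d n) * (F - 2 * lam)) + r n) \<longlonglongrightarrow> 2 * (1 / (1 - 0) * (F - 2 * lam)) + 0"
    by (intro tendsto_intros d_lim r) auto
  ultimately have "(F\<^sup>2 + ((2 - 0) * \<eta>\<^sup>2 / 2) / (1 + 0 * ((2 - 0) * \<eta>\<^sup>2 / 2)) * (P\<^sup>2 + N\<^sup>2)) / pi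
      \<le> 2 * (1 / (1 - 0) * (F - 2 * lam)) + 0"
    by (rule LIMSEQ_le) (use step in blast)
  then show ?thesis by (simp add: field_simps)
qed

lemma mass_pos: "0 < (\<integral>x. f x \<partial>lborel)"
proof -
  have "(\<integral>x. indicator {-1<..<1::real} x * lam \<partial>lborel) \<le> (\<integral>x. f x \<partial>lborel)"
  proof (intro integral_mono f_integrable integrable_mult_left integrable_real_indicator)
    show "indicator {-1<..<1} x * lam \<le> f x" for x
      using f_ge[of x] f_nonneg[of x] by (cases "\<bar>x\<bar> < 1") (auto simp: indicator_def)
  qed auto
  with lam_pos show ?thesis by simp
qed

text \<open>At \<eta> = 0 the inequality reads F^2 \<le> 2\<pi> (F - 2 lam), and lam > 0 makes the
  bound strict.\<close>

lemma mass_less: "(\<integral>x. f x \<partial>lborel) < 2 * pi"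
proof -
  let ?F = "\<integral>x. f x \<partial>lborel"
  have "?F * ?F \<le> 2 * pi * (?F - 2 * lam)"
    using pohozaev_inequality[of 0] by (simp add: power2_eq_square)
  also have "\<dots> < 2 * pi * ?F" using lam_pos by simp
  finally show ?thesis using mass_pos by simp
qed

text \<open>The Pohozaev inequality bounds the mass outside [-\<eta>,\<eta>] by the deficit 2\<pi> -
  F. The rest of the mass sees the kernel with pole 0 at height at least
  \<open>ln (1 / \<eta>) / pi\<close>.\<close>

lemma center_value_ge:
  assumes \<eta>: "0 < \<eta>" "\<eta> < 1"
  defines "F \<equiv> \<integral>y. f y \<partial>lborel"
  shows "ln (1 / \<eta>) / pi * (F - 2 * sqrt (2 * pi * (2 * pi - F)) / \<eta>) \<le> u 0"
proof -
  let ?L = "ln (1 / \<eta>) / pi"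
  define P where "P = (\<integral>y. indicator {\<eta><..} y * f y \<partial>lborel)"
  define N where "N = (\<integral>y. indicator {..<-\<eta>} y * f y \<partial>lborel)"
  have L: "0 \<le> ?L" using \<eta> by simp
  have F: "0 < F" "F < 2 * pi" using mass_pos mass_less by (auto simp: F_def)
  have "F\<^sup>2 + \<eta>\<^sup>2 * (P\<^sup>2 + N\<^sup>2) \<le> 2 * pi * (F - 2 * lam)"
    using pohozaev_inequality[of \<eta>] \<eta> by (simp add: F_def P_def N_def)
  also have "\<dots> \<le> 2 * pi * F" using lam_pos by simp
  finally have "\<eta>\<^sup>2 * (P\<^sup>2 + N\<^sup>2) \<le> F * (2 * pi - F)" by (simp add: power2_eq_square algebra_simps)
  also have "\<dots> \<le> 2 * pi * (2 * pi - F)" using F by (intro mult_right_mono) auto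
  finally have W: "(\<eta> * P)\<^sup>2 + (\<eta> * N)\<^sup>2 \<le> 2 * pi * (2 * pi - F)"
    by (simp add: power_mult_distrib distrib_left)
  have "\<eta> * P \<le> sqrt (2 * pi * (2 * pi - F))"
    using W zero_le_power2[of "\<eta> * N"] by (intro real_le_rsqrt) linarith
  moreover have "\<eta> * N \<le> sqrt (2 * pi * (2 * pi - F))"
    using W zero_le_power2[of "\<eta> * P"] by (intro real_le_rsqrt) linarith
  ultimately have "\<eta> * (P + N) \<le> 2 * sqrt (2 * pi * (2 * pi - F))" by (simp add: distrib_left)
  then have PN: "P + N \<le> 2 * sqrt (2 * pi * (2 * pi - F)) / \<eta>" using \<eta> by (simp add: field_simps)
  have intp: "integrable lborel (\<lambda>y. indicator {\<eta><..} y * f y)" "integrable lborel (\<lambda>y. indicator {..<-\<eta>} y * f y)"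
    by (rule Bochner_Integration.integrable_bound[OF f_integrable]; auto simp: indicator_def)+
  have "?L * (F - (P + N)) = (\<integral>y. ?L * (f y - (indicator {\<eta><..} y * f y + indicator {..<-\<eta>} y * f y)) \<partial>lborel)"
    using intp f_integrable by (simp add: F_def P_def N_def)
  also have "\<dots> \<le> (\<integral>y. green 0 y * f y \<partial>lborel)"
  proof (rule integral_mono_AE)
    show "integrable lborel (\<lambda>y. ?L * (f y - (indicator {\<eta><..} y * f y + indicator {..<-\<eta>} y * f y)))"
      by (intro integrable_mult_right Bochner_Integration.integrable_diff Bochner_Integration.integrable_add intp f_integrable)
    show "integrable lborel (\<lambda>y. green 0 y * f y)" by (rule integrable_green_mult[OF f_measurable f_bound])
    show "AE y in lborel. ?L * (f y - (indicator {\<eta><..} y * f y + indicator {..<-\<eta>} y * f y)) \<le> green 0 y * f y"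
      using AE_lborel_singleton[of 0]
    proof eventually_elim
      case (elim y)
      show ?case
      proof (cases "\<bar>y\<bar> \<le> \<eta>")
        case True
        have "ln \<bar>y\<bar> \<le> ln \<eta>" using True elim \<eta> by (intro ln_mono) auto
        moreover have "0 \<le> ln (1 + semicircle y)" by (intro ln_ge_zero) simp
        moreover have "ln (1 / \<eta>) = - ln \<eta>" using \<eta> by (simp add: ln_div)
        ultimately have "ln (1 / \<eta>) \<le> ln (1 + semicircle y) - ln \<bar>y\<bar>" by linarith
        moreover have "semicircle 0 = 1" by (simp add: semicircle_def)
        then have "green 0 y = (ln (1 + semicircle y) - ln \<bar>y\<bar>) / pi"
          using green_eq[of 0 y] True elim \<eta> by simp
        ultimately have "?L \<le> green 0 y" by (simp only: divide_right_mono pi_ge_zero)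
        from mult_right_mono[OF this f_nonneg[of y]] True show ?thesis by (auto simp: indicator_def)
      next
        case False
        then have "indicator {\<eta><..} y + indicator {..<-\<eta>} y = (1::real)"
          using \<eta> by (auto simp: indicator_def abs_if split: if_splits)
        then have "indicator {\<eta><..} y * f y + indicator {..<-\<eta>} y * f y = f y"
          by (simp flip: distrib_right)
        then show ?thesis using f_nonneg[of y] by simp
      qed
    qed
  qed
  also have "\<dots> = u 0" by (simp add: u_eq green_op_def)
  finally show ?thesis using mult_left_mono[OF PN L] by (simp add: right_diff_distrib)
qed

end

text \<open>Uniqueness for the half-Laplacian identifies u with the potential of its own right-hand
  side, which converts the pointwise equation into the integral equation that the estimates
  use.\<close>

lemma liouville_solution_imp_mean_field:
  assumes sol: "liouville_solution \<rho> u" and \<rho>: "0 < \<rho>"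
  obtains lam B f where "mean_field lam B u f" "(\<integral>x. f x \<partial>lborel) = \<rho>"
proof -
  have hold: "bounded (range u)" "\<exists>C. \<forall>x y. \<bar>u x - u y\<bar> \<le> C * \<bar>x - y\<bar> powr (1/2)"
    and smooth: "smooth_on_open {-1<..<1} u"
    and eq: "\<And>x. x \<in> {-1<..<1} \<Longrightarrow> has_half_laplacian u x (\<rho> * (exp (u x) / (LINT y:{-1<..<1}|lborel. exp (u y))))"
    and out: "\<And>x. x \<notin> {-1<..<1} \<Longrightarrow> u x = 0"
    using sol by (auto simp: liouville_solution_def hoelder_space_def)
  obtain B where B: "\<And>x. \<bar>u x\<bar> \<le> B" using hold(1) by (auto simp: bounded_iff)
  obtain C where C: "\<And>x y. \<bar>u x - u y\<bar> \<le> C * \<bar>x - y\<bar> powr (1/2)" using hold(2) by blast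
  have cont: "continuous_on UNIV u"
    by (rule continuous_on_of_holder[of _ C]) (use C in \<open>simp add: powr_half_sqrt\<close>)
  have [measurable]: "u \<in> borel_measurable borel" by (rule borel_measurable_continuous_onI[OF cont])
  define Z where "Z = (LINT y:{-1<..<1}|lborel. exp (u y))"
  have Z_eq: "Z = (\<integral>y. indicator {-1<..<1} y * exp (u y) \<partial>lborel)"
    by (simp add: Z_def set_lebesgue_integral_def)
  have Zint: "integrable lborel (\<lambda>y. indicator {-1<..<1} y * exp (u y))"
  proof (rule integrable_bounded_on_unit)
    show "\<bar>indicator {-1<..<1} y * exp (u y)\<bar> \<le> exp B" for y
      using abs_le_D1[OF B[of y]] by (auto simp: indicator_def)
    show "indicator {-1<..<1} y * exp (u y) = 0" if "1 < \<bar>y\<bar>" for y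
      using that by (auto simp: indicator_def)
  qed measurable
  have "(\<integral>y. indicator {-1<..<1::real} y * exp (- B) \<partial>lborel) \<le> Z"
    unfolding Z_eq
  proof (intro integral_mono Zint integrable_mult_left integrable_real_indicator)
    show "indicator {-1<..<1} y * exp (- B) \<le> indicator {-1<..<1} y * exp (u y)" for y
      using abs_le_D2[OF B[of y]] by (auto simp: indicator_def)
  qed auto
  then have "2 * exp (- B) \<le> Z" by simp
  then have Z: "0 < Z" using exp_gt_zero[of "- B"] by linarith
  define lam where "lam = \<rho> / Z"
  define f where "f = (\<lambda>x. if \<bar>x\<bar> < 1 then lam * exp (u x) else 0)"
  have lam: "0 < lam" using Z \<rho> by (simp add: lam_def)
  have udiff: "\<exists>D. (u has_real_derivative D) (at x)" if "\<bar>x\<bar> < 1" for x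
  proof -
    have "x \<in> {-1<..<1}" using that by auto
    with smooth[unfolded smooth_on_open_def, rule_format, of x 0] show ?thesis
      by (simp add: field_differentiable_def)
  qed
  have fm: "f \<in> borel_measurable borel" unfolding f_def by measurable
  have fB: "\<bar>f x\<bar> \<le> lam * exp B" for x
    using abs_le_D1[OF B[of x]] lam by (simp add: f_def)
  have half: "has_half_laplacian (green_op f) x (f x)" if x: "\<bar>x\<bar> < 1" for x
  proof -
    obtain D where D: "(u has_real_derivative D) (at x)" using udiff[OF x] by blast
    have "((\<lambda>x. lam * exp (u x)) has_real_derivative lam * (exp (u x) * D)) (at x)"
      by (intro DERIV_cmult DERIV_fun_exp D)
    then have "(f has_real_derivative lam * (exp (u x) * D)) (at x)"
      by (rule has_field_derivative_transform_within_open[of _ _ _ "{-1<..<1}"])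
         (use x in \<open>auto simp: f_def\<close>)
    from differentiable_imp_global_linear_bound[OF this, of "lam * exp B"] fB
    obtain C' where "\<And>y. \<bar>f y - f x\<bar> \<le> C' * \<bar>y - x\<bar>" by blast
    then show ?thesis by (rule has_half_laplacian_green_op[OF x fm fB])
  qed
  have "u = green_op f"
  proof (rule has_half_laplacian_unique[where f=f])
    show "has_half_laplacian u x (f x)" if "\<bar>x\<bar> < 1" for x
      using eq[of x] that by (simp add: f_def lam_def Z_def abs_less_iff)
    show "u x = 0" if "1 \<le> \<bar>x\<bar>" for x by (rule out) (use that in auto)
  qed (use cont half in \<open>auto simp: green_op_outside intro: continuous_on_green_op[OF fm fB]\<close>)
  then have "mean_field lam B u f"
    using lam B cont udiff by unfold_locales (auto simp: f_def)
  moreover have "(\<integral>x. f x \<partial>lborel) = \<rho>"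
  proof -
    have "f = (\<lambda>x. lam * (indicator {-1<..<1} x * exp (u x)))"
      by (auto simp: f_def indicator_def fun_eq_iff)
    then show ?thesis using Z by (simp add: Z_eq[symmetric] lam_def)
  qed
  ultimately show ?thesis by (rule that)
qed

lemma nontrivial_nonneg_solution_mass_less:
  assumes "nontrivial_nonneg_solution \<rho> u" "0 < \<rho>"
  shows "\<rho> < 2 * pi"
proof -
  obtain lam B f where "mean_field lam B u f" and F: "(\<integral>x. f x \<partial>lborel) = \<rho>"
    using liouville_solution_imp_mean_field[of \<rho> u] assms by (auto simp: nontrivial_nonneg_solution_def)
  then interpret mean_field lam B u f by simp
  show ?thesis using mass_less F by simp
qed

lemma center_values_at_top:
  assumes "\<And>\<rho>. \<rho> \<in> {0<..<2 * pi} \<Longrightarrow> nontrivial_nonneg_solution \<rho> (u \<rho>)"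
  shows "filterlim (\<lambda>\<rho>. u \<rho> 0) at_top (at_left (2 * pi))"
  unfolding filterlim_at_top
proof
  fix K :: real
  \<comment> \<open>\<eta> is fixed before \<rho> moves: with this value the lower bound of
    \<open>center_value_ge\<close> tends to \<open>2 * (\<bar>K\<bar> + 1)\<close>, which exceeds K.
    The bound involves only \<rho>, so it is indifferent to which solution \<open>u \<rho>\<close>
    selects.\<close>
  define \<eta> where "\<eta> = exp (- (\<bar>K\<bar> + 1))"
  have \<eta>: "0 < \<eta>" "\<eta> < 1" by (auto simp: \<eta>_def)
  have ln\<eta>: "ln (1 / \<eta>) = \<bar>K\<bar> + 1" by (simp add: \<eta>_def exp_minus ln_div)
  let ?g = "\<lambda>\<rho>. ln (1 / \<eta>) / pi * (\<rho> - 2 * sqrt (2 * pi * (2 * pi - \<rho>)) / \<eta>)"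
  have "(?g \<longlongrightarrow> ln (1 / \<eta>) / pi * (2 * pi - 2 * sqrt (2 * pi * (2 * pi - 2 * pi)) / \<eta>)) (at_left (2 * pi))"
    using \<eta> by (intro tendsto_intros) auto
  moreover have "ln (1 / \<eta>) / pi * (2 * pi - 2 * sqrt (2 * pi * (2 * pi - 2 * pi)) / \<eta>) = 2 * (\<bar>K\<bar> + 1)"
    by (simp add: ln\<eta>)
  ultimately have lim: "(?g \<longlongrightarrow> 2 * (\<bar>K\<bar> + 1)) (at_left (2 * pi))" by (simp only:)
  have "\<forall>\<^sub>F \<rho> in at_left (2 * pi). K < ?g \<rho>"
  proof (rule order_tendstoD(1)[OF lim])
    show "K < 2 * (\<bar>K\<bar> + 1)" using abs_ge_self[of K] abs_ge_zero[of K] by argo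
  qed
  moreover have "\<forall>\<^sub>F \<rho> in at_left (2 * pi). \<rho> \<in> {0<..<2 * pi}"
    by (rule eventually_at_left_real) simp
  ultimately show "\<forall>\<^sub>F \<rho> in at_left (2 * pi). K \<le> u \<rho> 0"
  proof eventually_elim
    case (elim \<rho>)
    obtain lam B f where "mean_field lam B (u \<rho>) f" and F: "(\<integral>x. f x \<partial>lborel) = \<rho>"
      using liouville_solution_imp_mean_field[of \<rho> "u \<rho>"] assms[OF elim(2)] elim(2)
      by (auto simp: nontrivial_nonneg_solution_def)
    then interpret mean_field lam B "u \<rho>" f by simp
    show ?case using center_value_ge[OF \<eta>] elim(1) F by simp
  qed
qed

section \<open>Positive definiteness of the Green function\<close>

text \<open>With \<open>x = cos \<theta>\<close>, the \<open>sine_mode n\<close> are the functions \<open>sin (n \<theta>)\<close>, which diagonalise the Green function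
  with respect to \<open>d\<theta>\<close>; \<open>green_abel\<close> is the Abel mean of this expansion (the term \<open>n = 0\<close> vanishes).\<close>

definition sine_mode :: "nat \<Rightarrow> real \<Rightarrow> real" where
  "sine_mode n x = sin (real n * arccos (unit_clamp x))"

lemma borel_measurable_sine_mode [measurable]: "sine_mode n \<in> borel_measurable borel"
proof (rule borel_measurable_continuous_onI)
  show "continuous_on UNIV (sine_mode n)"
    unfolding sine_mode_def
    by (intro continuous_intros continuous_on_unit_clamp ballI)
       (use abs_unit_clamp_le in \<open>auto simp: abs_le_iff\<close>)
qed

lemma abs_sine_mode_le: "\<bar>sine_mode n x\<bar> \<le> 1"
  by (simp add: sine_mode_def)

definition green_abel :: "real \<Rightarrow> real \<Rightarrow> real \<Rightarrow> real" where
  "green_abel r x y = (\<Sum>n. 2 / pi * (r ^ n / real n) * (sine_mode n x * sine_mode n y))"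

text \<open>The real part of the series of - Ln (1 - w) for w = r e^(i\<alpha>), where \<bar>1 -
  w\<bar>^2 is 1 - 2 r cos \<alpha> + r^2. The term n = 0 is 0, since division by 0 gives 0.\<close>

lemma cosine_log_series:
  assumes r: "0 < r" "r < 1"
  shows "(\<lambda>n. r ^ n / real n * cos (real n * \<alpha>)) sums (- ln (1 - 2 * r * cos \<alpha> + r\<^sup>2) / 2)"
proof -
  define w where "w = of_real r * cis \<alpha>"
  have w: "cmod w < 1" using r by (simp add: w_def norm_mult)
  have "(\<lambda>n. (-1) ^ Suc n / of_nat n * (- w) ^ n) sums ln (1 + - w)"
    by (rule Ln_series) (use w in simp)
  moreover have "(-1) ^ Suc n / of_nat n * (- w) ^ n = - (w ^ n / of_nat n)" for n
  proof -
    have "(-1) ^ n * (-1) ^ n = (1 :: complex)" by (simp flip: power_mult_distrib)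
    then show ?thesis unfolding power_minus[of w] by (simp add: mult.assoc[symmetric])
  qed
  ultimately have "(\<lambda>n. - (w ^ n / of_nat n)) sums ln (1 + - w)" by (simp only:)
  then have "(\<lambda>n. - (w ^ n / of_nat n)) sums ln (1 - w)" by simp
  from sums_minus[OF this] have "(\<lambda>n. w ^ n / of_nat n) sums - ln (1 - w)" by simp
  from sums_Re[OF this] have "(\<lambda>n. Re (w ^ n / of_nat n)) sums - Re (ln (1 - w))" by simp
  moreover have "Re (w ^ n / of_nat n) = r ^ n / real n * cos (real n * \<alpha>)" for n
  proof -
    have "w ^ n = of_real (r ^ n) * cis (real n * \<alpha>)"
      by (simp only: w_def power_mult_distrib Complex.DeMoivre of_real_power)
    then show ?thesis by (simp add: Re_divide_of_nat del: of_real_power)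
  qed
  moreover have "Re (ln (1 - w)) = ln (1 - 2 * r * cos \<alpha> + r\<^sup>2) / 2"
  proof -
    have ne: "1 - w \<noteq> 0" using w by auto
    have "(cmod (1 - w))\<^sup>2 = (1 - r * cos \<alpha>)\<^sup>2 + (r * sin \<alpha>)\<^sup>2"
      by (simp add: cmod_power2 w_def)
    also have "\<dots> = 1 - 2 * r * cos \<alpha> + r\<^sup>2 * ((cos \<alpha>)\<^sup>2 + (sin \<alpha>)\<^sup>2)"
    proof -
      have "(1 - r * c)\<^sup>2 + (r * s)\<^sup>2 = 1 - 2 * r * c + r\<^sup>2 * (c\<^sup>2 + s\<^sup>2)" for c s
        by (simp add: power2_eq_square algebra_simps)
      then show ?thesis .
    qed
    finally have "(cmod (1 - w))\<^sup>2 = 1 - 2 * r * cos \<alpha> + r\<^sup>2" by simp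
    moreover have "Re (ln (1 - w)) = ln ((cmod (1 - w))\<^sup>2) / 2"
      using ne by (simp add: Re_Ln ln_realpow)
    ultimately show ?thesis by simp
  qed
  ultimately show ?thesis by (simp only: minus_divide_left)
qed

text \<open>With x = cos \<theta> and y = cos \<phi>, twice the product of the sines is the
  difference of the cosines of n (\<theta> - \<phi>) and n (\<theta> + \<phi>), so the sum is a
  difference of two logarithmic series.\<close>

lemma green_abel_sums:
  assumes r: "0 < r" "r < 1" and x: "\<bar>x\<bar> < 1" and y: "\<bar>y\<bar> < 1"
  defines "q \<equiv> semicircle x * semicircle y"
  shows "(\<lambda>n. 2 / pi * (r ^ n / real n) * (sine_mode n x * sine_mode n y)) sums
    ((ln (1 + r\<^sup>2 - 2 * r * (x * y - q)) - ln (1 + r\<^sup>2 - 2 * r * (x * y + q))) / (2 * pi))"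
proof -
  define \<theta> where "\<theta> = arccos x"
  define \<phi> where "\<phi> = arccos y"
  have cs: "cos \<theta> = x" "cos \<phi> = y" "sin \<theta> = semicircle x" "sin \<phi> = semicircle y"
    using x y by (auto simp: \<theta>_def \<phi>_def sin_arccos semicircle_eq abs_less_iff)
  have c1: "cos (\<theta> - \<phi>) = x * y + q" "cos (\<theta> + \<phi>) = x * y - q"
    by (simp_all add: cos_diff cos_add cs q_def)
  have "(\<lambda>n. 1 / pi * (r ^ n / real n * cos (real n * (\<theta> - \<phi>)) - r ^ n / real n * cos (real n * (\<theta> + \<phi>)))) sums
      (1 / pi * (- ln (1 - 2 * r * cos (\<theta> - \<phi>) + r\<^sup>2) / 2 - - ln (1 - 2 * r * cos (\<theta> + \<phi>) + r\<^sup>2) / 2))"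
    by (intro sums_mult sums_diff cosine_log_series r)
  moreover have "1 / pi * (r ^ n / real n * cos (real n * (\<theta> - \<phi>)) - r ^ n / real n * cos (real n * (\<theta> + \<phi>)))
      = 2 / pi * (r ^ n / real n) * (sine_mode n x * sine_mode n y)" for n
  proof -
    have "cos (real n * (\<theta> - \<phi>)) - cos (real n * (\<theta> + \<phi>)) = 2 * (sine_mode n x * sine_mode n y)"
      using x y by (simp add: sine_mode_def \<theta>_def[symmetric] \<phi>_def[symmetric] right_diff_distrib distrib_left cos_diff cos_add)
    then have "1 / pi * (r ^ n / real n * (cos (real n * (\<theta> - \<phi>)) - cos (real n * (\<theta> + \<phi>))))
        = 2 / pi * (r ^ n / real n) * (sine_mode n x * sine_mode n y)"
      by simp
    then show ?thesis by (simp only: right_diff_distrib)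
  qed
  moreover have "1 / pi * (- ln (1 - 2 * r * cos (\<theta> - \<phi>) + r\<^sup>2) / 2 - - ln (1 - 2 * r * cos (\<theta> + \<phi>) + r\<^sup>2) / 2)
     = (ln (1 + r\<^sup>2 - 2 * r * (x * y - q)) - ln (1 + r\<^sup>2 - 2 * r * (x * y + q))) / (2 * pi)"
    unfolding c1 by (simp add: algebra_simps diff_divide_distrib)
  ultimately show ?thesis by simp
qed

lemma green_abel_eq:
  assumes "0 < r" "r < 1" "\<bar>x\<bar> < 1" "\<bar>y\<bar> < 1"
  shows "green_abel r x y = (ln (1 + r\<^sup>2 - 2 * r * (x * y - semicircle x * semicircle y))
     - ln (1 + r\<^sup>2 - 2 * r * (x * y + semicircle x * semicircle y))) / (2 * pi)"
  unfolding green_abel_def using sums_unique[OF green_abel_sums[OF assms]] by simp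

text \<open>This trades the denominator \<open>\<bar>x - y\<bar>\<close> of \<open>green\<close> for
  the conjugate factor: \<open>green\<close> becomes a difference of two logarithms over 2\<pi>, the
  form that \<open>green_abel\<close> takes at r = 1.\<close>

lemma green_conjugate_product:
  assumes "\<bar>x\<bar> \<le> 1" "\<bar>y\<bar> \<le> 1"
  shows "(1 - x * y + semicircle x * semicircle y) * (1 - x * y - semicircle x * semicircle y) = (x - y)\<^sup>2"
proof -
  have "(1 - x * y + semicircle x * semicircle y) * (1 - x * y - semicircle x * semicircle y)
      = (1 - x * y)\<^sup>2 - (semicircle x)\<^sup>2 * (semicircle y)\<^sup>2"
    by (simp add: power2_eq_square algebra_simps)
  also have "\<dots> = (x - y)\<^sup>2"
    unfolding semicircle_sq[OF assms(1)] semicircle_sq[OF assms(2)] by (simp add: power2_eq_square algebra_simps)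
  finally show ?thesis .
qed

text \<open>Lying between 0 and \<open>green\<close>, the Abel means have an integrable majorant as
  r tends to 1. The upper bound compares the quotients a / b and (1 - c + q) / (1 - c - q); cross
  multiplication leaves \<open>2 * q * (1 - r)\<^sup>2\<close>.\<close>

lemma green_abel_bounds:
  assumes r: "0 < r" "r < 1" and x: "\<bar>x\<bar> < 1" and y: "\<bar>y\<bar> < 1" and ne: "x \<noteq> y"
  shows "0 \<le> green_abel r x y" "green_abel r x y \<le> green x y"
    "green x y = (ln (1 - x * y + semicircle x * semicircle y) - ln (1 - x * y - semicircle x * semicircle y)) / (2 * pi)"
    "0 < 1 - x * y - semicircle x * semicircle y"
proof -
  define c where "c = x * y"
  define q where "q = semicircle x * semicircle y"
  have q: "0 \<le> q" by (simp add: q_def)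
  have A: "0 < 1 - c + q" using green_numerator_ge[of x y] x y ne by (simp add: c_def q_def)
  have AB: "(1 - c + q) * (1 - c - q) = \<bar>x - y\<bar>\<^sup>2"
    using green_conjugate_product[of x y] x y by (simp add: c_def q_def)
  have "0 < (1 - c + q) * (1 - c - q)" unfolding AB using ne by simp
  then have B: "0 < 1 - c - q" using A by (simp add: zero_less_mult_iff)
  then show "0 < 1 - x * y - semicircle x * semicircle y" by (simp add: c_def q_def)
  have "ln (1 - c + q) + ln (1 - c - q) = 2 * ln \<bar>x - y\<bar>"
  proof -
    have "ln (1 - c + q) + ln (1 - c - q) = ln (\<bar>x - y\<bar>\<^sup>2)"
      unfolding AB[symmetric] using A B by (simp add: ln_mult)
    also have "\<dots> = 2 * ln \<bar>x - y\<bar>" using ne by (subst ln_realpow) auto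
    finally show ?thesis .
  qed
  then have g: "green x y = (ln (1 - c + q) - ln (1 - c - q)) / (2 * pi)"
    using green_eq[of x y] x y ne by (simp add: c_def q_def field_simps)
  then show "green x y = (ln (1 - x * y + semicircle x * semicircle y) - ln (1 - x * y - semicircle x * semicircle y)) / (2 * pi)"
    by (simp add: c_def q_def)
  define a where "a = 1 + r\<^sup>2 - 2 * r * (c - q)"
  define b where "b = 1 + r\<^sup>2 - 2 * r * (c + q)"
  have "b = (1 - r)\<^sup>2 + 2 * r * (1 - c - q)" by (simp add: b_def power2_eq_square algebra_simps)
  then have b: "0 < b" using B r by (simp add: add_nonneg_pos)
  have ab: "b \<le> a" using q r by (simp add: a_def b_def)
  then have a: "0 < a" using b by simp
  have ga: "green_abel r x y = (ln a - ln b) / (2 * pi)"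
    using green_abel_eq[OF r x y] by (simp add: a_def b_def c_def q_def)
  show "0 \<le> green_abel r x y" unfolding ga using a b ab by simp
  have "(1 - c + q) * b - a * (1 - c - q) = 2 * q * (1 - r)\<^sup>2"
    by (simp add: a_def b_def power2_eq_square algebra_simps)
  then have "a * (1 - c - q) \<le> (1 - c + q) * b" using mult_nonneg_nonneg[OF q zero_le_power2, of "1 - r"] by linarith
  then have "ln (a * (1 - c - q)) \<le> ln ((1 - c + q) * b)" using a B by (intro ln_mono) auto
  then have "ln a + ln (1 - c - q) \<le> ln (1 - c + q) + ln b" using a b A B by (simp add: ln_mult)
  then show "green_abel r x y \<le> green x y" unfolding ga g by (simp add: divide_right_mono)
qed

lemma borel_measurable_green_abel [measurable]:
  "(\<lambda>(x, y). green_abel r x y) \<in> borel_measurable (borel \<Otimes>\<^sub>M borel)"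
  unfolding green_abel_def by measurable

lemma integrable_bounded_on_square:
  fixes f :: "real \<times> real \<Rightarrow> real"
  assumes [measurable]: "f \<in> borel_measurable (borel \<Otimes>\<^sub>M borel)" and M: "\<And>p. \<bar>f p\<bar> \<le> M"
    and out: "\<And>x y. 1 < \<bar>x\<bar> \<or> 1 < \<bar>y\<bar> \<Longrightarrow> f (x, y) = 0"
  shows "integrable (lborel \<Otimes>\<^sub>M lborel) f"
proof (rule Bochner_Integration.integrable_bound)
  let ?S = "{-1..1::real} \<times> {-1..1::real}"
  have "emeasure (lborel \<Otimes>\<^sub>M lborel) ?S = emeasure lborel {-1..1::real} * emeasure lborel {-1..1::real}"
    by (rule lborel.emeasure_pair_measure_Times) auto
  also have "\<dots> < \<infinity>" by (simp add: ennreal_mult_less_top)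
  finally show "integrable (lborel \<Otimes>\<^sub>M lborel) (\<lambda>p. indicator ?S p * M)"
    by (intro integrable_mult_left integrable_real_indicator) auto
  show "AE p in lborel \<Otimes>\<^sub>M lborel. norm (f p) \<le> norm (indicator ?S p * M)"
  proof (intro AE_I2)
    fix p :: "real \<times> real"
    obtain x y where p: "p = (x, y)" by fastforce
    show "norm (f p) \<le> norm (indicator ?S p * M)"
    proof (cases "p \<in> ?S")
      case True
      then show ?thesis using M[of p] by simp
    next
      case False
      then have "f p = 0" unfolding p by (intro out) auto
      then show ?thesis by simp
    qed
  qed
qed simp

text \<open>In the Abel mean each term contributes a nonnegative weight times the square of a sine
  coefficient. Nonnegativity passes through two dominated limits: in the number of terms at fixed r,
  with a constant majorant on the square from the geometric series, then as r tends to 1, with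
  \<open>green\<close> providing the majorant.\<close>

theorem green_op_energy_nonneg:
  assumes h[measurable]: "h \<in> borel_measurable borel" and M: "\<And>y. \<bar>h y\<bar> \<le> M"
  shows "0 \<le> (\<integral>x. h x * green_op h x \<partial>lborel)"
proof -
  let ?L = "lborel \<Otimes>\<^sub>M lborel :: (real \<times> real) measure"
  \<comment> \<open>Cutting h off outside the open interval does not change the energy, because
    \<open>green\<close> vanishes there, and it gives the products \<open>T n\<close> bounded
    support and hence integrability.\<close>
  define k where "k = (\<lambda>x. if \<bar>x\<bar> < 1 then h x else 0)"
  have [measurable]: "k \<in> borel_measurable borel" unfolding k_def by measurable
  have M0: "0 \<le> M" using M[of 0] by linarith
  have kM: "\<bar>k x\<bar> \<le> M" for x using M[of x] M0 by (simp add: k_def)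
  have k_out: "k x = 0" if "1 \<le> \<bar>x\<bar>" for x using that by (simp add: k_def)
  define T where "T = (\<lambda>n p. (k (fst p) * sine_mode n (fst p)) * (k (snd p) * sine_mode n (snd p)))"
  have [measurable]: "T n \<in> borel_measurable (borel \<Otimes>\<^sub>M borel)" for n unfolding T_def by measurable
  have kS: "\<bar>k x * sine_mode n x\<bar> \<le> M" for n x
    using mult_mono[OF kM[of x] abs_sine_mode_le[of n x]] M0 by (simp add: abs_mult)
  have TM: "\<bar>T n p\<bar> \<le> M * M" for n p
    unfolding T_def abs_mult[of "k (fst p) * sine_mode n (fst p)"] using M0 by (intro mult_mono kS) auto
  have iT: "integrable ?L (T n)" for n
    by (rule integrable_bounded_on_square[OF _ TM]) (auto simp: T_def k_out)
  have T_nonneg: "0 \<le> (\<integral>p. T n p \<partial>?L)" for n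
  proof -
    have "(\<integral>p. T n p \<partial>?L) = (\<integral>x. (\<integral>y. T n (x, y) \<partial>lborel) \<partial>lborel)"
      by (rule lborel_pair.integral_fst'[OF iT, symmetric])
    also have "\<dots> = (\<integral>x. k x * sine_mode n x \<partial>lborel) * (\<integral>x. k x * sine_mode n x \<partial>lborel)"
      by (simp add: T_def)
    finally show ?thesis by simp
  qed
  have abel: "0 \<le> (\<integral>p. k (fst p) * k (snd p) * green_abel r (fst p) (snd p) \<partial>?L)" if r: "0 < r" "r < 1" for r
  proof -
    define S where "S = (\<lambda>N p. \<Sum>n<N. 2 / pi * (r ^ n / real n) * T n p)"
    have [measurable]: "S N \<in> borel_measurable (borel \<Otimes>\<^sub>M borel)" for N unfolding S_def by measurable
    have S_nonneg: "0 \<le> (\<integral>p. S N p \<partial>?L)" for N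
      unfolding S_def using iT T_nonneg r by (simp add: Bochner_Integration.integral_sum sum_nonneg)
    have SM: "\<bar>S N p\<bar> \<le> 2 / pi * (M * M) * (1 / (1 - r))" for N p
    proof -
      have "\<bar>S N p\<bar> \<le> (\<Sum>n<N. \<bar>2 / pi * (r ^ n / real n) * T n p\<bar>)" unfolding S_def by (rule sum_abs)
      also have "\<dots> \<le> (\<Sum>n<N. 2 / pi * (M * M) * r ^ n)"
      proof (intro sum_mono)
        fix n
        have "r ^ n / real n \<le> r ^ n" using r by (cases "n = 0") (auto simp: field_simps mult_left_le)
        then have "2 / pi * (r ^ n / real n) * \<bar>T n p\<bar> \<le> 2 / pi * r ^ n * (M * M)"
          using r TM[of n p] by (intro mult_mono mult_left_mono) auto
        then show "\<bar>2 / pi * (r ^ n / real n) * T n p\<bar> \<le> 2 / pi * (M * M) * r ^ n"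
          using r by (simp add: abs_mult mult_ac)
      qed
      also have "\<dots> = 2 / pi * (M * M) * (\<Sum>n<N. r ^ n)" by (simp add: sum_distrib_left)
      also have "\<dots> \<le> 2 / pi * (M * M) * (1 / (1 - r))"
        using sum_le_suminf[OF summable_geometric, of r "{..<N}"] suminf_geometric[of r] r M0
        by (intro mult_left_mono) auto
      finally show ?thesis .
    qed
    define C where "C = 2 / pi * (M * M) * (1 / (1 - r))"
    have C0: "0 \<le> C" using order_trans[OF abs_ge_zero SM] by (simp add: C_def)
    have S_out: "S N (x, y) = 0" if "1 \<le> \<bar>x\<bar> \<or> 1 \<le> \<bar>y\<bar>" for N x y
      using that by (auto simp: S_def T_def k_out)
    define D where "D = (\<lambda>p :: real \<times> real. indicator ({-1..1} \<times> {-1..1}) p * C)"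
    have iD: "integrable ?L D" unfolding D_def
      by (rule integrable_bounded_on_square[where M=C]) (use C0 in \<open>auto simp: indicator_def\<close>)
    have "(\<lambda>N. \<integral>p. S N p \<partial>?L) \<longlonglongrightarrow> (\<integral>p. k (fst p) * k (snd p) * green_abel r (fst p) (snd p) \<partial>?L)"
    proof (rule integral_dominated_convergence[OF _ _ iD])
      show "AE p in ?L. (\<lambda>N. S N p) \<longlonglongrightarrow> k (fst p) * k (snd p) * green_abel r (fst p) (snd p)"
      proof (intro AE_I2)
        fix p :: "real \<times> real"
        obtain x y where p: "p = (x, y)" by fastforce
        show "(\<lambda>N. S N p) \<longlonglongrightarrow> k (fst p) * k (snd p) * green_abel r (fst p) (snd p)"
        proof (cases "\<bar>x\<bar> < 1 \<and> \<bar>y\<bar> < 1")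
          case True
          then have "(\<lambda>n. 2 / pi * (r ^ n / real n) * (sine_mode n x * sine_mode n y)) sums green_abel r x y"
            using green_abel_sums[OF r, of x y] green_abel_eq[OF r, of x y] by simp
          from sums_mult[OF this, of "k x * k y"]
          have "(\<lambda>N. \<Sum>n<N. k x * k y * (2 / pi * (r ^ n / real n) * (sine_mode n x * sine_mode n y))) \<longlonglongrightarrow> k x * k y * green_abel r x y"
            by (simp add: sums_def)
          then show ?thesis by (simp add: p S_def T_def mult_ac)
        next
          case False
          then have "S N p = 0" for N unfolding p by (intro S_out) auto
          moreover have "k x * k y = 0" using False k_out[of x] k_out[of y] by auto
          ultimately show ?thesis by (simp only: p fst_conv snd_conv mult_zero_left tendsto_const)
        qed
      qed
      show "AE p in ?L. norm (S N p) \<le> D p" for N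
      proof (intro AE_I2)
        fix p :: "real \<times> real"
        obtain x y where p: "p = (x, y)" by fastforce
        show "norm (S N p) \<le> D p"
        proof (cases "p \<in> {-1..1} \<times> {-1..1}")
          case True
          then show ?thesis using SM[of N p] by (simp add: D_def C_def)
        next
          case False
          then have "S N p = 0" unfolding p by (intro S_out) auto
          then show ?thesis using C0 by (simp add: D_def)
        qed
      qed
    qed (auto simp: case_prod_unfold[symmetric])
    then show ?thesis by (rule LIMSEQ_le_const) (use S_nonneg in blast)
  qed
  define r where "r = (\<lambda>n. 1 - inverse (real (Suc (Suc n))))"
  have r: "0 < r n" "r n < 1" for n by (auto simp: r_def field_simps)
  have r_lim: "r \<longlonglongrightarrow> 1 - 0" unfolding r_def by (intro tendsto_intros LIMSEQ_Suc[OF LIMSEQ_inverse_real_of_nat])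
  have iG: "integrable ?L (\<lambda>(x, y). \<bar>k x\<bar> * (green x y * \<bar>k y\<bar>))"
    by (rule integrable_green_prod) (use kM in auto)
  have "(\<lambda>n. \<integral>p. k (fst p) * k (snd p) * green_abel (r n) (fst p) (snd p) \<partial>?L)
      \<longlonglongrightarrow> (\<integral>p. k (fst p) * k (snd p) * green (fst p) (snd p) \<partial>?L)"
  proof (rule integral_dominated_convergence[OF _ _ iG])
    have ne: "AE p in ?L. fst p \<noteq> snd p"
    proof (rule lborel_pair.AE_pair_measure)
      show "AE x in lborel. AE y in lborel. fst (x :: real, y) \<noteq> snd (x, y)"
      proof (rule AE_I2)
        fix x :: real
        show "AE y in lborel. fst (x, y) \<noteq> snd (x, y)"
          using AE_lborel_singleton[of x] by eventually_elim auto
      qed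
    qed measurable
    show "AE p in ?L. (\<lambda>n. k (fst p) * k (snd p) * green_abel (r n) (fst p) (snd p))
        \<longlonglongrightarrow> k (fst p) * k (snd p) * green (fst p) (snd p)"
      using ne
    proof eventually_elim
      case (elim p)
      obtain x y where p: "p = (x, y)" by fastforce
      show ?case
      proof (cases "\<bar>x\<bar> < 1 \<and> \<bar>y\<bar> < 1")
        case True
        then have xy: "\<bar>x\<bar> < 1" "\<bar>y\<bar> < 1" "x \<noteq> y" using elim by (auto simp: p)
        let ?q = "semicircle x * semicircle y"
        note b = green_abel_bounds(3,4)[OF r[of 0] xy]
        have A: "0 < 1 - x * y + ?q" using b(2) semicircle_nonneg[of x] semicircle_nonneg[of y]
            mult_nonneg_nonneg[of "semicircle x" "semicircle y"] by linarith
        have "(\<lambda>n. (ln (1 + (r n)\<^sup>2 - 2 * r n * (x * y - ?q)) - ln (1 + (r n)\<^sup>2 - 2 * r n * (x * y + ?q))) / (2 * pi))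
          \<longlonglongrightarrow> (ln (1 + (1 - 0)\<^sup>2 - 2 * (1 - 0) * (x * y - ?q)) - ln (1 + (1 - 0)\<^sup>2 - 2 * (1 - 0) * (x * y + ?q))) / (2 * pi)"
          using A b(2) by (intro tendsto_intros r_lim) auto
        also have "(ln (1 + (1 - 0)\<^sup>2 - 2 * (1 - 0) * (x * y - ?q)) - ln (1 + (1 - 0)\<^sup>2 - 2 * (1 - 0) * (x * y + ?q))) / (2 * pi)
          = green x y"
        proof -
          have "1 + (1 - 0)\<^sup>2 - 2 * (1 - 0) * (x * y - ?q) = 2 * (1 - x * y + ?q)"
            "1 + (1 - 0)\<^sup>2 - 2 * (1 - 0) * (x * y + ?q) = 2 * (1 - x * y - ?q)" by (simp_all add: algebra_simps)
          moreover have "ln (2 * (1 - x * y + ?q)) - ln (2 * (1 - x * y - ?q)) = ln (1 - x * y + ?q) - ln (1 - x * y - ?q)"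
            using A b(2) by (simp only: ln_mult_pos zero_less_numeral)
          ultimately show ?thesis unfolding b(1) by (simp only:)
        qed
        finally have "(\<lambda>n. green_abel (r n) x y) \<longlonglongrightarrow> green x y"
          using green_abel_eq[OF r xy(1,2)] by simp
        then show ?thesis by (auto simp: p intro!: tendsto_intros)
      next
        case False
        then have "k x * k y = 0" using k_out[of x] k_out[of y] by auto
        then show ?thesis by (auto simp: p)
      qed
    qed
    show "AE p in ?L. norm (k (fst p) * k (snd p) * green_abel (r n) (fst p) (snd p)) \<le> (case p of (x, y) \<Rightarrow> \<bar>k x\<bar> * (green x y * \<bar>k y\<bar>))" for n
      using ne
    proof eventually_elim
      case (elim p)
      obtain x y where p: "p = (x, y)" by fastforce
      show ?case
      proof (cases "\<bar>x\<bar> < 1 \<and> \<bar>y\<bar> < 1")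
        case True
        then have b: "0 \<le> green_abel (r n) x y" "green_abel (r n) x y \<le> green x y"
          using green_abel_bounds(1,2)[OF r] elim by (auto simp: p)
        have "\<bar>k x * k y\<bar> * green_abel (r n) x y \<le> \<bar>k x * k y\<bar> * green x y" by (intro mult_left_mono b) simp
        then show ?thesis using b by (simp add: p abs_mult mult_ac)
      next
        case False
        then have "k x = 0 \<or> k y = 0" using k_out[of x] k_out[of y] by auto
        then show ?thesis by (auto simp: p)
      qed
    qed
  qed (auto simp: case_prod_unfold[symmetric])
  then have "0 \<le> (\<integral>p. k (fst p) * k (snd p) * green (fst p) (snd p) \<partial>?L)"
    by (rule LIMSEQ_le_const) (use abel[OF r] in blast)
  also have "\<dots> = (\<integral>p. (case p of (x, y) \<Rightarrow> h x * (green x y * h y)) \<partial>?L)"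
  proof (rule Bochner_Integration.integral_cong[OF refl])
    fix p :: "real \<times> real"
    obtain x y where p: "p = (x, y)" by fastforce
    show "k (fst p) * k (snd p) * green (fst p) (snd p) = (case p of (x, y) \<Rightarrow> h x * (green x y * h y))"
      by (simp add: p k_def green_outside green_outside')
  qed
  also have "\<dots> = (\<integral>x. (\<integral>y. h x * (green x y * h y) \<partial>lborel) \<partial>lborel)"
    using lborel_pair.integral_fst'[OF integrable_green_prod[OF h M h M]] by simp
  also have "\<dots> = (\<integral>x. h x * green_op h x \<partial>lborel)" by (simp add: green_op_def)
  finally show ?thesis .
qed

section \<open>Existence of a fixed point by Gibbs iteration\<close>

definition partition_sum :: "(real \<Rightarrow> real) \<Rightarrow> real" where
  "partition_sum v = (\<integral>y. indicator {-1<..<1} y * exp (v y) \<partial>lborel)"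

definition gibbs :: "(real \<Rightarrow> real) \<Rightarrow> real \<Rightarrow> real" where
  "gibbs v y = (if \<bar>y\<bar> < 1 then exp (v y) / partition_sum v else 0)"

definition entropy :: "(real \<Rightarrow> real) \<Rightarrow> real" where
  "entropy \<mu> = (\<integral>y. \<mu> y * ln (\<mu> y) \<partial>lborel)"

definition bounded_potential :: "real \<Rightarrow> (real \<Rightarrow> real) \<Rightarrow> bool" where
  "bounded_potential K v \<longleftrightarrow> v \<in> borel_measurable borel \<and> (\<forall>x. 0 \<le> v x \<and> v x \<le> K)"

lemma bounded_potentialD:
  assumes "bounded_potential K v"
  shows "v \<in> borel_measurable borel" "0 \<le> v x" "v x \<le> K"
  using assms by (auto simp: bounded_potential_def)

lemma
  assumes v: "bounded_potential K v"
  shows integrable_partition: "integrable lborel (\<lambda>y. indicator {-1<..<1} y * exp (v y))"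
    and partition_sum_ge: "2 \<le> partition_sum v"
proof -
  note [measurable] = bounded_potentialD(1)[OF v]
  show i: "integrable lborel (\<lambda>y. indicator {-1<..<1} y * exp (v y))"
  proof (rule integrable_bounded_on_unit)
    show "\<bar>indicator {-1<..<1} y * exp (v y)\<bar> \<le> exp K" for y
      using bounded_potentialD(3)[OF v, of y] by (simp add: indicator_def)
    show "indicator {-1<..<1} y * exp (v y) = 0" if "1 < \<bar>y\<bar>" for y
      using that by (auto simp: indicator_def)
  qed measurable
  have "(\<integral>y. indicator {-1<..<1::real} y * 1 \<partial>lborel) \<le> partition_sum v"
    unfolding partition_sum_def
  proof (intro integral_mono i integrable_mult_left integrable_real_indicator)
    show "indicator {-1<..<1} y * 1 \<le> indicator {-1<..<1} y * exp (v y)" for y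
      using bounded_potentialD(2)[OF v, of y] by (simp add: indicator_def)
  qed auto
  then show "2 \<le> partition_sum v" by simp
qed

lemma borel_measurable_gibbs:
  assumes "bounded_potential K v" shows "gibbs v \<in> borel_measurable borel"
proof -
  note [measurable] = bounded_potentialD(1)[OF assms]
  show ?thesis unfolding gibbs_def by measurable
qed

lemma gibbs_outside: "1 \<le> \<bar>y\<bar> \<Longrightarrow> gibbs v y = 0"
  by (simp add: gibbs_def)

lemma
  assumes v: "bounded_potential K v"
  shows gibbs_nonneg: "0 \<le> gibbs v y"
    and gibbs_pos: "\<bar>y\<bar> < 1 \<Longrightarrow> 0 < gibbs v y"
    and abs_gibbs_le: "\<bar>gibbs v y\<bar> \<le> exp K"
    and ln_gibbs: "\<bar>y\<bar> < 1 \<Longrightarrow> ln (gibbs v y) = v y - ln (partition_sum v)"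
proof -
  have Z: "2 \<le> partition_sum v" by (rule partition_sum_ge[OF v])
  then show "0 \<le> gibbs v y" "\<bar>y\<bar> < 1 \<Longrightarrow> 0 < gibbs v y"
    "\<bar>y\<bar> < 1 \<Longrightarrow> ln (gibbs v y) = v y - ln (partition_sum v)"
    by (auto simp: gibbs_def ln_div)
  have "exp (v y) / partition_sum v \<le> exp K / 1"
    using Z bounded_potentialD(3)[OF v, of y] by (intro frac_le) auto
  then show "\<bar>gibbs v y\<bar> \<le> exp K" using Z by (simp add: gibbs_def)
qed

lemma
  assumes v: "bounded_potential K v"
  shows integrable_gibbs: "integrable lborel (gibbs v)"
    and integral_gibbs: "(\<integral>y. gibbs v y \<partial>lborel) = 1"
proof -
  have eq: "gibbs v = (\<lambda>y. indicator {-1<..<1} y * exp (v y) / partition_sum v)"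
    by (auto simp: gibbs_def indicator_def fun_eq_iff)
  show "integrable lborel (gibbs v)"
    unfolding eq by (intro integrable_divide integrable_partition[OF v])
  show "(\<integral>y. gibbs v y \<partial>lborel) = 1"
    unfolding eq using partition_sum_ge[OF v] by (simp flip: partition_sum_def)
qed

lemma integrable_gibbs_mult:
  assumes v: "bounded_potential K v" and [measurable]: "g \<in> borel_measurable borel" and B: "\<And>y. \<bar>g y\<bar> \<le> B"
  shows "integrable lborel (\<lambda>y. gibbs v y * g y)"
proof (rule Bochner_Integration.integrable_bound)
  show "integrable lborel (\<lambda>y. gibbs v y * B)" by (intro integrable_mult_left integrable_gibbs[OF v])
  show "AE y in lborel. norm (gibbs v y * g y) \<le> norm (gibbs v y * B)"
    using gibbs_nonneg[OF v] B by (intro AE_I2) (simp add: abs_mult mult_left_mono order_trans[OF _ abs_ge_self])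
qed (use borel_measurable_gibbs[OF v] in measurable)

lemma
  assumes v: "bounded_potential K v" and w: "bounded_potential L w"
  shows integrable_gibbs_ln: "integrable lborel (\<lambda>y. gibbs v y * ln (gibbs w y))"
    and integral_gibbs_ln: "(\<integral>y. gibbs v y * ln (gibbs w y) \<partial>lborel)
      = (\<integral>y. gibbs v y * w y \<partial>lborel) - ln (partition_sum w)"
proof -
  have eq: "gibbs v y * ln (gibbs w y) = gibbs v y * w y - gibbs v y * ln (partition_sum w)" for y
    by (cases "\<bar>y\<bar> < 1") (simp_all add: ln_gibbs[OF w] gibbs_outside right_diff_distrib)
  have i: "integrable lborel (\<lambda>y. gibbs v y * w y)"
    by (rule integrable_gibbs_mult[OF v bounded_potentialD(1)[OF w]])
       (use bounded_potentialD(2,3)[OF w] in \<open>auto simp: abs_le_iff intro: order_trans[of _ 0]\<close>)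
  show "integrable lborel (\<lambda>y. gibbs v y * ln (gibbs w y))"
    unfolding eq by (intro Bochner_Integration.integrable_diff i integrable_mult_left integrable_gibbs[OF v])
  show "(\<integral>y. gibbs v y * ln (gibbs w y) \<partial>lborel) = (\<integral>y. gibbs v y * w y \<partial>lborel) - ln (partition_sum w)"
    unfolding eq using i integrable_gibbs[OF v] integral_gibbs[OF v] by simp
qed

text \<open>Legendre duality between \<open>a * ln a - a\<close> and exp; at a = 0 the product
  \<open>a * ln a\<close> is 0 by convention.\<close>

lemma young_exp_ineq:
  fixes a \<phi> :: real
  assumes "0 \<le> a" shows "a * \<phi> \<le> a * ln a - a + exp \<phi>"
proof (cases "a = 0")
  case False
  then have a: "0 < a" using assms by simp
  have "a * (1 + (\<phi> - ln a)) \<le> a * exp (\<phi> - ln a)" using a by (intro mult_left_mono exp_ge_add_one_self) simp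
  also have "\<dots> = exp \<phi>" using a by (simp add: exp_diff)
  finally show ?thesis by (simp add: algebra_simps)
qed simp

text \<open>This is ln z \<le> z - 1 at z = sqrt (b / a). The left side is continuous in the
  densities and bounded when they are, so it passes to the limit along the iteration.\<close>

lemma kullback_ge_hellinger_pointwise:
  fixes a b :: real
  assumes a: "0 < a" and b: "0 < b"
  shows "(sqrt a - sqrt b)\<^sup>2 \<le> a * ln a - a * ln b - a + b"
proof -
  have "ln (sqrt b / sqrt a) \<le> sqrt b / sqrt a - 1" using a b by (intro ln_le_minus_one) simp
  then have "(ln b - ln a) / 2 \<le> sqrt b / sqrt a - 1" using a b by (simp add: ln_div ln_sqrt diff_divide_distrib)
  then have "a * ((ln b - ln a) / 2) \<le> a * (sqrt b / sqrt a - 1)" using a by (intro mult_left_mono) auto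
  also have "\<dots> = sqrt a * sqrt b - a"
    using a by (simp add: right_diff_distrib real_div_sqrt flip: times_divide_eq_left)
  finally have "a * ln b - a * ln a \<le> 2 * (sqrt a * sqrt b - a)" by (simp add: right_diff_distrib)
  moreover have "(sqrt a - sqrt b)\<^sup>2 = a + b - 2 * (sqrt a * sqrt b)" using a b by (simp add: power2_diff)
  ultimately show ?thesis by argo
qed

text \<open>\<open>exp (c * green x y)\<close> is at most
  \<open>(2 / \<bar>x - y\<bar>) powr (c / pi)\<close>, whose exponent is below 1 for c < \<pi>. One
  majorant translated to x serves every x in the interval, so C is uniform.\<close>

lemma exp_green_bound:
  assumes c: "0 < c" "c < pi"
  obtains C where "\<And>x. integrable lborel (\<lambda>y. indicator {-1<..<1} y * exp (c * green x y))"
    "\<And>x. (\<integral>y. indicator {-1<..<1} y * exp (c * green x y) \<partial>lborel) \<le> C"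
proof -
  define p where "p = c / pi"
  have p: "0 < p" "p < 1" using c by (auto simp: p_def)
  \<comment> \<open>The summand 1 covers the diagonal, where \<open>green\<close> has the value 0
    and the power term vanishes as well.\<close>
  define W where "W = (\<lambda>z::real. indicator {-2..2} z * (1 + (2 / \<bar>z\<bar>) powr p))"
  have [measurable]: "W \<in> borel_measurable borel" unfolding W_def by measurable
  have R: "integrable lborel (\<lambda>z::real. indicator {0..2} z * z powr - p)"
    using has_bochner_integral_of_has_integral[OF _ _ has_integral_powr_from_0[of "- p" 2]] p
    by (auto simp: has_bochner_integral_iff)
  have L: "integrable lborel (\<lambda>z::real. indicator {0..2} (0 + -1 * z) * (0 + -1 * z) powr - p)"
    by (rule lborel_integrable_real_affine[OF R]) simp
  have iW: "integrable lborel W"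
  proof (rule Bochner_Integration.integrable_bound)
    show "integrable lborel (\<lambda>z::real. indicator {-2..2} z * 1 + 2 powr p * (indicator {0..2} z * z powr - p
        + indicator {0..2} (0 + -1 * z) * (0 + -1 * z) powr - p))"
      by (intro Bochner_Integration.integrable_add integrable_mult_left integrable_mult_right R L) simp
    show "AE z in lborel. norm (W z) \<le> norm (indicator {-2..2} z * 1 + 2 powr p * (indicator {0..2} z * z powr - p
        + indicator {0..2} (0 + -1 * z) * (0 + -1 * z) powr - p))"
    proof (intro AE_I2)
      fix z :: real
      consider "2 < \<bar>z\<bar>" | "z = 0" | "0 < z" "z \<le> 2" | "z < 0" "-2 \<le> z" by linarith
      then show "norm (W z) \<le> norm (indicator {-2..2} z * 1 + 2 powr p * (indicator {0..2} z * z powr - p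
        + indicator {0..2} (0 + -1 * z) * (0 + -1 * z) powr - p))"
      proof cases
        case 1
        then have "z \<notin> {-2..2}" by auto
        then show ?thesis by (simp add: W_def)
      next
        case 3
        then have "W z = 1 + 2 powr p * z powr - p"
          by (simp add: W_def powr_divide powr_minus_divide)
        then show ?thesis using 3 by simp
      next
        case 4
        then have "W z = 1 + 2 powr p * (- z) powr - p"
          by (simp add: W_def powr_divide powr_minus_divide)
        then show ?thesis using 4 by simp
      qed (simp add: W_def)
    qed
  qed measurable
  have iWx: "integrable lborel (\<lambda>y. W (- x + 1 * y))" for x
    by (rule lborel_integrable_real_affine[OF iW]) simp
  have le: "indicator {-1<..<1} y * exp (c * green x y) \<le> W (- x + 1 * y)" if x: "\<bar>x\<bar> < 1" for x y
  proof (cases "\<bar>y\<bar> < 1")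
    case False
    then have "y \<notin> {-1<..<1}" by auto
    then show ?thesis by (simp add: W_def)
  next
    case True
    have z: "y - x \<in> {-2..2}" using x True by auto
    show ?thesis
    proof (cases "x = y")
      case False
      then have pos: "0 < 2 / \<bar>x - y\<bar>" by simp
      have "c * green x y \<le> c * (ln (2 / \<bar>x - y\<bar>) / pi)"
        using x True False c by (intro mult_left_mono green_le) auto
      also have "\<dots> = p * ln (2 / \<bar>x - y\<bar>)" by (simp add: p_def)
      finally have "exp (c * green x y) \<le> exp (p * ln (2 / \<bar>x - y\<bar>))" by simp
      also have "\<dots> = (2 / \<bar>x - y\<bar>) powr p" using pos False by (simp add: powr_def)
      finally have "exp (c * green x y) \<le> 1 + (2 / \<bar>y - x\<bar>) powr p" by (simp add: abs_minus_commute)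
      then show ?thesis using z True by (simp add: W_def indicator_def)
    qed (use True in \<open>simp add: W_def indicator_def\<close>)
  qed
  \<comment> \<open>For x outside the interval \<open>green x\<close> vanishes and the integral is
    the length 2 of the interval, hence the maximum.\<close>
  have int: "integrable lborel (\<lambda>y. indicator {-1<..<1} y * exp (c * green x y))"
    and bd: "(\<integral>y. indicator {-1<..<1} y * exp (c * green x y) \<partial>lborel) \<le> max (\<integral>z. W z \<partial>lborel) 2" for x
  proof -
    have *: "integrable lborel (\<lambda>y. indicator {-1<..<1} y * exp (c * green x y)) \<and>
      (\<integral>y. indicator {-1<..<1} y * exp (c * green x y) \<partial>lborel) \<le> max (\<integral>z. W z \<partial>lborel) 2"
    proof (cases "\<bar>x\<bar> < 1")
      case True
      have i: "integrable lborel (\<lambda>y. indicator {-1<..<1} y * exp (c * green x y))"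
        by (rule Bochner_Integration.integrable_bound[OF iWx[of x]])
           (use le[OF True] in \<open>auto intro!: AE_I2 intro: order_trans[OF _ abs_ge_self]\<close>)
      have "(\<integral>y. indicator {-1<..<1} y * exp (c * green x y) \<partial>lborel) \<le> (\<integral>y. W (- x + 1 * y) \<partial>lborel)"
        by (intro integral_mono i iWx le True)
      also have "\<dots> = (\<integral>z. W z \<partial>lborel)"
        using lborel_integral_real_affine[of 1 W "- x"] by simp
      finally show ?thesis using i by simp
    next
      case False
      then show ?thesis by (simp add: green_outside)
    qed
    then show "integrable lborel (\<lambda>y. indicator {-1<..<1} y * exp (c * green x y))"
      "(\<integral>y. indicator {-1<..<1} y * exp (c * green x y) \<partial>lborel) \<le> max (\<integral>z. W z \<partial>lborel) 2"
      by auto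
  qed
  show ?thesis by (rule that[OF int bd])
qed

text \<open>Young's inequality under the integral, with the density as a and
  \<open>c * green x y\<close> as \<phi>: the entropy bounds the potential at every point without
  any sup bound on the density entering the estimate.\<close>

lemma green_op_gibbs_le_entropy:
  assumes c: "0 < c"
    and C: "integrable lborel (\<lambda>y. indicator {-1<..<1} y * exp (c * green x y))"
      "(\<integral>y. indicator {-1<..<1} y * exp (c * green x y) \<partial>lborel) \<le> C"
    and v: "bounded_potential K v"
  shows "c * green_op (gibbs v) x \<le> entropy (gibbs v) + C"
proof -
  have "c * green_op (gibbs v) x = (\<integral>y. c * (green x y * gibbs v y) \<partial>lborel)"
    by (simp add: green_op_def)
  also have "\<dots> \<le> (\<integral>y. gibbs v y * ln (gibbs v y) + indicator {-1<..<1} y * exp (c * green x y) \<partial>lborel)"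
  proof (rule integral_mono)
    show "integrable lborel (\<lambda>y. c * (green x y * gibbs v y))"
      by (intro integrable_mult_right integrable_green_mult[OF borel_measurable_gibbs[OF v] abs_gibbs_le[OF v]])
    show "integrable lborel (\<lambda>y. gibbs v y * ln (gibbs v y) + indicator {-1<..<1} y * exp (c * green x y))"
      by (intro Bochner_Integration.integrable_add integrable_gibbs_ln[OF v v] C)
    fix y
    show "c * (green x y * gibbs v y) \<le> gibbs v y * ln (gibbs v y) + indicator {-1<..<1} y * exp (c * green x y)"
    proof (cases "\<bar>y\<bar> < 1")
      case True
      then show ?thesis
        using young_exp_ineq[OF gibbs_nonneg[OF v], of y "c * green x y"] gibbs_nonneg[OF v, of y]
        by (simp add: indicator_def abs_less_iff mult_ac)
    next
      case False
      then have "y \<notin> {-1<..<1}" by auto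
      then show ?thesis using False by (simp add: gibbs_outside)
    qed
  qed
  also have "\<dots> \<le> entropy (gibbs v) + C"
    unfolding entropy_def using C integrable_gibbs_ln[OF v v] by simp
  finally show ?thesis .
qed

definition free_energy :: "real \<Rightarrow> (real \<Rightarrow> real) \<Rightarrow> real" where
  "free_energy \<rho> \<mu> = entropy \<mu> - \<rho> / 2 * (\<integral>x. \<mu> x * green_op \<mu> x \<partial>lborel)"

text \<open>From a ln a \<ge> a - 1: the density has mass 1 and the interval has length 2.\<close>

lemma entropy_gibbs_ge:
  assumes v: "bounded_potential K v"
  shows "- 1 \<le> entropy (gibbs v)"
proof -
  have "(\<integral>y. gibbs v y - indicator {-1<..<1::real} y \<partial>lborel) \<le> entropy (gibbs v)"
    unfolding entropy_def
  proof (intro integral_mono Bochner_Integration.integrable_diff integrable_gibbs[OF v] integrable_gibbs_ln[OF v v])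
    fix y
    show "gibbs v y - indicator {-1<..<1} y \<le> gibbs v y * ln (gibbs v y)"
    proof (cases "\<bar>y\<bar> < 1")
      case True
      from order_trans[OF zero_le_power2 kullback_ge_hellinger_pointwise[OF gibbs_pos[OF v True], of 1]]
      have "gibbs v y - 1 \<le> gibbs v y * ln (gibbs v y)" by simp
      then show ?thesis using True by (simp add: indicator_def abs_less_iff)
    qed (simp add: gibbs_outside)
  qed simp
  also have "(\<integral>y. gibbs v y - indicator {-1<..<1::real} y \<partial>lborel) = - 1"
    using integrable_gibbs[OF v] integral_gibbs[OF v] by simp
  finally show ?thesis .
qed

text \<open>Averaging the entropy bound for the potential against the density bounds the energy by
  the entropy. The remaining coefficient of the entropy is positive for c > \<rho>/2, while
  \<open>exp_green_bound\<close> asks for c < \<pi>; both can be met exactly when \<rho> <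
  2\<pi>.\<close>

lemma free_energy_ge:
  assumes c: "0 < c" and \<rho>: "0 < \<rho>"
    and C: "\<And>x. integrable lborel (\<lambda>y. indicator {-1<..<1} y * exp (c * green x y))"
      "\<And>x. (\<integral>y. indicator {-1<..<1} y * exp (c * green x y) \<partial>lborel) \<le> C"
    and v: "bounded_potential K v"
  shows "(1 - \<rho> / (2 * c)) * entropy (gibbs v) - \<rho> / (2 * c) * C \<le> free_energy \<rho> (gibbs v)"
proof -
  note m = borel_measurable_gibbs[OF v] abs_gibbs_le[OF v]
  let ?S = "entropy (gibbs v)"
  have "(\<integral>x. gibbs v x * green_op (gibbs v) x \<partial>lborel) \<le> (\<integral>x. gibbs v x * ((?S + C) / c) \<partial>lborel)"
  proof (intro integral_mono integrable_mult_green_op[OF m m] integrable_mult_left integrable_gibbs[OF v] mult_left_mono gibbs_nonneg[OF v])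
    show "green_op (gibbs v) x \<le> (?S + C) / c" for x
      using green_op_gibbs_le_entropy[OF c C v, of x] c by (simp add: field_simps)
  qed
  also have "\<dots> = (?S + C) / c" using integral_gibbs[OF v] by simp
  finally have "\<rho> / 2 * (\<integral>x. gibbs v x * green_op (gibbs v) x \<partial>lborel) \<le> \<rho> / 2 * ((?S + C) / c)"
    using \<rho> by (intro mult_left_mono) auto
  also have "\<dots> = \<rho> / (2 * c) * ?S + \<rho> / (2 * c) * C" by (simp add: distrib_left add_divide_distrib)
  finally show ?thesis by (simp add: free_energy_def left_diff_distrib)
qed

text \<open>Since the interaction energy is positive definite, the free energy lies below its linearisation
  at \<^term>\<open>gibbs v\<close>, and the linearised functional is minimised by the Gibbs measure of \<^term>\<open>w\<close>.\<close>

lemma free_energy_descent: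
  assumes v: "bounded_potential K v" and w: "bounded_potential L w" and w_eq: "w = (\<lambda>x. \<rho> * green_op (gibbs v) x)"
    and \<rho>: "0 < \<rho>"
  shows "(\<integral>y. (sqrt (gibbs v y) - sqrt (gibbs w y))\<^sup>2 \<partial>lborel) \<le> free_energy \<rho> (gibbs v) - free_energy \<rho> (gibbs w)"
proof -
  let ?\<mu> = "gibbs v" and ?\<nu> = "gibbs w"
  note \<mu> = borel_measurable_gibbs[OF v] abs_gibbs_le[OF v]
  note \<nu> = borel_measurable_gibbs[OF w] abs_gibbs_le[OF w]
  define h where "h = (\<lambda>y. ?\<mu> y - ?\<nu> y)"
  have hm: "h \<in> borel_measurable borel" unfolding h_def using \<mu>(1) \<nu>(1) by measurable
  have hM: "\<bar>h y\<bar> \<le> exp K + exp L" for y using \<mu>(2)[of y] \<nu>(2)[of y] unfolding h_def by linarith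
  have [measurable]: "?\<mu> \<in> borel_measurable borel" "?\<nu> \<in> borel_measurable borel" by (fact \<mu>(1) \<nu>(1))+
  note i = integrable_mult_green_op[OF \<mu> \<mu>] integrable_mult_green_op[OF \<mu> \<nu>]
    integrable_mult_green_op[OF \<nu> \<mu>] integrable_mult_green_op[OF \<nu> \<nu>]
  have "(\<integral>x. h x * green_op h x \<partial>lborel)
     = (\<integral>x. (?\<mu> x * green_op ?\<mu> x - ?\<nu> x * green_op ?\<mu> x) - (?\<mu> x * green_op ?\<nu> x - ?\<nu> x * green_op ?\<nu> x) \<partial>lborel)"
    unfolding h_def green_op_diff[OF \<mu> \<nu>] by (simp add: algebra_simps)
  also have "\<dots> = (\<integral>x. ?\<mu> x * green_op ?\<mu> x \<partial>lborel) - 2 * (\<integral>x. ?\<nu> x * green_op ?\<mu> x \<partial>lborel) + (\<integral>x. ?\<nu> x * green_op ?\<nu> x \<partial>lborel)"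
    using i green_op_selfadjoint[OF \<mu> \<nu>] by simp
  finally have pd: "0 \<le> (\<integral>x. ?\<mu> x * green_op ?\<mu> x \<partial>lborel) - 2 * (\<integral>x. ?\<nu> x * green_op ?\<mu> x \<partial>lborel) + (\<integral>x. ?\<nu> x * green_op ?\<nu> x \<partial>lborel)"
    using green_op_energy_nonneg[OF hm hM] by simp
  have Sw: "entropy ?\<nu> = \<rho> * (\<integral>x. ?\<nu> x * green_op ?\<mu> x \<partial>lborel) - ln (partition_sum w)"
    unfolding entropy_def integral_gibbs_ln[OF w w] by (simp add: w_eq mult.left_commute)
  have cross: "(\<integral>y. ?\<mu> y * ln (?\<nu> y) \<partial>lborel) = \<rho> * (\<integral>x. ?\<mu> x * green_op ?\<mu> x \<partial>lborel) - ln (partition_sum w)"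
    unfolding integral_gibbs_ln[OF v w] by (simp add: w_eq mult.left_commute)
  have "(\<integral>y. (sqrt (?\<mu> y) - sqrt (?\<nu> y))\<^sup>2 \<partial>lborel) \<le> (\<integral>y. ?\<mu> y * ln (?\<mu> y) - ?\<mu> y * ln (?\<nu> y) - ?\<mu> y + ?\<nu> y \<partial>lborel)"
  proof (rule integral_mono)
    show "integrable lborel (\<lambda>y. ?\<mu> y * ln (?\<mu> y) - ?\<mu> y * ln (?\<nu> y) - ?\<mu> y + ?\<nu> y)"
      by (intro Bochner_Integration.integrable_add Bochner_Integration.integrable_diff integrable_gibbs_ln[OF v v]
          integrable_gibbs_ln[OF v w] integrable_gibbs[OF v] integrable_gibbs[OF w])
    show le: "(sqrt (?\<mu> y) - sqrt (?\<nu> y))\<^sup>2 \<le> ?\<mu> y * ln (?\<mu> y) - ?\<mu> y * ln (?\<nu> y) - ?\<mu> y + ?\<nu> y" for y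
      using kullback_ge_hellinger_pointwise[OF gibbs_pos[OF v] gibbs_pos[OF w], of y]
      by (cases "\<bar>y\<bar> < 1") (auto simp: gibbs_outside)
    show "integrable lborel (\<lambda>y. (sqrt (?\<mu> y) - sqrt (?\<nu> y))\<^sup>2)"
      by (rule Bochner_Integration.integrable_bound[where f="\<lambda>y. ?\<mu> y * ln (?\<mu> y) - ?\<mu> y * ln (?\<nu> y) - ?\<mu> y + ?\<nu> y"])
         (use le in \<open>auto intro!: Bochner_Integration.integrable_add Bochner_Integration.integrable_diff integrable_gibbs_ln[OF v v]
          integrable_gibbs_ln[OF v w] integrable_gibbs[OF v] integrable_gibbs[OF w] intro: order_trans[OF _ abs_ge_self]\<close>)
  qed
  also have "\<dots> = entropy ?\<mu> - (\<integral>y. ?\<mu> y * ln (?\<nu> y) \<partial>lborel)"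
    using integrable_gibbs_ln[OF v v] integrable_gibbs_ln[OF v w] integrable_gibbs[OF v] integrable_gibbs[OF w]
      integral_gibbs[OF v] integral_gibbs[OF w] by (simp add: entropy_def)
  also have "\<dots> \<le> free_energy \<rho> ?\<mu> - free_energy \<rho> ?\<nu>"
    unfolding free_energy_def cross Sw using mult_left_mono[OF pd, of "\<rho> / 2"] \<rho> by (simp add: algebra_simps)
  finally show ?thesis .
qed

section \<open>The Gibbs iteration and its limit points\<close>

primrec gibbs_iterate :: "real \<Rightarrow> nat \<Rightarrow> real \<Rightarrow> real" where
  "gibbs_iterate \<rho> 0 = (\<lambda>x. 0)"
| "gibbs_iterate \<rho> (Suc n) = (\<lambda>x. \<rho> * green_op (gibbs (gibbs_iterate \<rho> n)) x)"

lemma bounded_potential_step: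
  assumes v: "bounded_potential K v" and \<rho>: "0 < \<rho>"
  shows "bounded_potential (\<rho> * exp K) (\<lambda>x. \<rho> * green_op (gibbs v) x)"
proof -
  note m = borel_measurable_gibbs[OF v] abs_gibbs_le[OF v]
  note [measurable] = borel_measurable_green_op[OF m]
  have "green_op (gibbs v) x \<le> exp K" for x
  proof -
    have "green_op (gibbs v) x \<le> exp K * semicircle x" by (rule abs_le_D1[OF green_op_bound[OF m]])
    also have "\<dots> \<le> exp K * 1" by (intro mult_left_mono semicircle_le_1) simp
    finally show ?thesis by simp
  qed
  moreover have "0 \<le> green_op (gibbs v) x" for x by (intro green_op_nonneg gibbs_nonneg[OF v])
  ultimately show ?thesis using \<rho> by (simp add: bounded_potential_def)
qed

text \<open>The bound obtained here changes from K to \<rho> e^K at each step. It merely makes every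
  iterate admissible for the preceding lemmas; the uniform bound comes from the free energy.\<close>

lemma gibbs_iterate_bounded_ex:
  assumes "0 < \<rho>" shows "\<exists>K. bounded_potential K (gibbs_iterate \<rho> n)"
proof (induction n)
  case 0
  show ?case by (intro exI[of _ 0]) (simp add: bounded_potential_def)
next
  case (Suc n)
  then show ?case using bounded_potential_step assms by auto
qed

lemma free_energy_gibbs_iterate:
  assumes \<rho>: "0 < \<rho>"
  shows "(\<integral>y. (sqrt (gibbs (gibbs_iterate \<rho> n) y) - sqrt (gibbs (gibbs_iterate \<rho> (Suc n)) y))\<^sup>2 \<partial>lborel)
    \<le> free_energy \<rho> (gibbs (gibbs_iterate \<rho> n)) - free_energy \<rho> (gibbs (gibbs_iterate \<rho> (Suc n)))"
proof -
  obtain K L where "bounded_potential K (gibbs_iterate \<rho> n)" "bounded_potential L (gibbs_iterate \<rho> (Suc n))"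
    using gibbs_iterate_bounded_ex[OF \<rho>] by metis
  then show ?thesis by (rule free_energy_descent) (use \<rho> in auto)
qed

lemma decseq_free_energy_gibbs_iterate:
  assumes \<rho>: "0 < \<rho>"
  shows "decseq (\<lambda>n. free_energy \<rho> (gibbs (gibbs_iterate \<rho> n)))"
proof (rule decseq_SucI)
  fix n
  have "0 \<le> (\<integral>y. (sqrt (gibbs (gibbs_iterate \<rho> n) y) - sqrt (gibbs (gibbs_iterate \<rho> (Suc n)) y))\<^sup>2 \<partial>lborel)"
    by (intro integral_nonneg_AE) auto
  with free_energy_gibbs_iterate[OF \<rho>, of n]
  show "free_energy \<rho> (gibbs (gibbs_iterate \<rho> (Suc n))) \<le> free_energy \<rho> (gibbs (gibbs_iterate \<rho> n))" by linarith
qed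

text \<open>The decreasing free energy bounds the entropy from above, and the entropy bounds the
  potential of each density, that is, the next iterate up to the factor \<rho>.\<close>

lemma gibbs_iterate_uniform_bounds:
  assumes \<rho>: "0 < \<rho>" "\<rho> < 2 * pi"
  obtains K B where "\<And>n. bounded_potential K (gibbs_iterate \<rho> n)" "\<And>n. B \<le> free_energy \<rho> (gibbs (gibbs_iterate \<rho> n))"
proof -
  let ?U = "gibbs_iterate \<rho>"
  \<comment> \<open>The midpoint of \<rho>/2 and \<pi>: below \<pi> for
    \<open>exp_green_bound\<close>, above \<rho>/2 for a positive coefficient of the
    entropy.\<close>
  define c where "c = (\<rho> / 2 + pi) / 2"
  have c: "0 < c" "c < pi" "\<rho> / 2 < c" using \<rho> by (auto simp: c_def)
  obtain C where C: "\<And>x. integrable lborel (\<lambda>y. indicator {-1<..<1} y * exp (c * green x y))"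
    "\<And>x. (\<integral>y. indicator {-1<..<1} y * exp (c * green x y) \<partial>lborel) \<le> C"
    using exp_green_bound[OF c(1,2)] by metis
  define k where "k = 1 - \<rho> / (2 * c)"
  have k: "0 < k" using c by (simp add: k_def field_simps)
  have F: "k * entropy (gibbs (?U n)) - \<rho> / (2 * c) * C \<le> free_energy \<rho> (gibbs (?U n))"
    and S: "- 1 \<le> entropy (gibbs (?U n))" for n
  proof -
    obtain K where K: "bounded_potential K (?U n)" using gibbs_iterate_bounded_ex[OF \<rho>(1)] by blast
    show "k * entropy (gibbs (?U n)) - \<rho> / (2 * c) * C \<le> free_energy \<rho> (gibbs (?U n))"
      unfolding k_def by (rule free_energy_ge[OF c(1) \<rho>(1) C K])
    show "- 1 \<le> entropy (gibbs (?U n))" by (rule entropy_gibbs_ge[OF K])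
  qed
  define S' where "S' = (free_energy \<rho> (gibbs (?U 0)) + \<rho> / (2 * c) * C) / k"
  have S': "entropy (gibbs (?U n)) \<le> S'" for n
  proof -
    have "free_energy \<rho> (gibbs (?U n)) \<le> free_energy \<rho> (gibbs (?U 0))"
      using decseqD[OF decseq_free_energy_gibbs_iterate[OF \<rho>(1)], of 0 n] by simp
    then have "k * entropy (gibbs (?U n)) \<le> free_energy \<rho> (gibbs (?U 0)) + \<rho> / (2 * c) * C" using F[of n] by linarith
    then show ?thesis using k by (simp add: S'_def field_simps)
  qed
  define K where "K = max 0 (\<rho> / c * (S' + C))"
  have "bounded_potential K (?U n)" for n
  proof (cases n)
    case 0
    then show ?thesis by (simp add: bounded_potential_def K_def)
  next
    case (Suc m)
    obtain L where L: "bounded_potential L (?U m)" using gibbs_iterate_bounded_ex[OF \<rho>(1)] by blast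
    have "?U n x \<le> K" for x
    proof -
      have "c * green_op (gibbs (?U m)) x \<le> S' + C"
        using green_op_gibbs_le_entropy[OF c(1) C L, of x] S'[of m] by linarith
      then have "\<rho> / c * (c * green_op (gibbs (?U m)) x) \<le> \<rho> / c * (S' + C)"
        using \<rho> c by (intro mult_left_mono) auto
      then show ?thesis using c(1) by (simp add: Suc K_def)
    qed
    then show ?thesis
      using bounded_potential_step[OF L \<rho>(1)] by (simp add: bounded_potential_def Suc)
  qed
  moreover have "- k - \<rho> / (2 * c) * C \<le> free_energy \<rho> (gibbs (?U n))" for n
    using F[of n] mult_left_mono[OF S[of n], of k] k by linarith
  ultimately show ?thesis by (rule that)
qed

lemma gibbs_tendsto:
  assumes w: "\<And>n. bounded_potential K (w n)" and lim: "\<And>x. (\<lambda>n. w n x) \<longlonglongrightarrow> v x"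
  shows "bounded_potential K v" "(\<lambda>n. gibbs (w n) x) \<longlonglongrightarrow> gibbs v x"
proof -
  note [measurable] = bounded_potentialD(1)[OF w]
  have [measurable]: "v \<in> borel_measurable borel"
    by (rule borel_measurable_LIMSEQ_real[of _ w]) (use lim in auto)
  have "0 \<le> v x" "v x \<le> K" for x
    using bounded_potentialD(2,3)[OF w] by (auto intro: LIMSEQ_le_const[OF lim] LIMSEQ_le_const2[OF lim])
  then show v: "bounded_potential K v" by (simp add: bounded_potential_def)
  have "(\<lambda>n. partition_sum (w n)) \<longlonglongrightarrow> partition_sum v"
    unfolding partition_sum_def
  proof (rule integral_dominated_convergence)
    show "integrable lborel (\<lambda>y. indicator {-1<..<1::real} y * exp K)" by (intro integrable_mult_left) simp
    show "AE y in lborel. (\<lambda>n. indicator {-1<..<1} y * exp (w n y)) \<longlonglongrightarrow> indicator {-1<..<1} y * exp (v y)"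
      by (intro AE_I2 tendsto_intros lim)
    show "AE y in lborel. norm (indicator {-1<..<1} y * exp (w n y)) \<le> indicator {-1<..<1} y * exp K" for n
      using bounded_potentialD(3)[OF w] by (intro AE_I2) (simp add: indicator_def)
  qed measurable
  then have "(\<lambda>n. exp (w n x) / partition_sum (w n)) \<longlonglongrightarrow> exp (v x) / partition_sum v"
    using partition_sum_ge[OF v] by (intro tendsto_intros lim) auto
  then show "(\<lambda>n. gibbs (w n) x) \<longlonglongrightarrow> gibbs v x" by (simp add: gibbs_def)
qed

lemma green_op_tendsto:
  assumes "\<And>n. f n \<in> borel_measurable borel" "\<And>n y. \<bar>f n y\<bar> \<le> M" "g \<in> borel_measurable borel"
    and "\<And>y. (\<lambda>n. f n y) \<longlonglongrightarrow> g y"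
  shows "(\<lambda>n. green_op (f n) x) \<longlonglongrightarrow> green_op g x"
  unfolding green_op_def
proof (rule integral_dominated_convergence)
  note [measurable] = assms(1,3)
  show "(\<lambda>y. green x y * g y) \<in> borel_measurable lborel" "(\<lambda>y. green x y * f n y) \<in> borel_measurable lborel" for n
    by measurable
  show "integrable lborel (\<lambda>y. green x y * M)" by simp
  show "AE y in lborel. (\<lambda>n. green x y * f n y) \<longlonglongrightarrow> green x y * g y"
    by (intro AE_I2 tendsto_intros assms)
  show "AE y in lborel. norm (green x y * f n y) \<le> green x y * M" for n
    using assms(2) by (intro AE_I2) (simp add: abs_mult mult_left_mono)
qed

text \<open>The free energy converges, so squared Hellinger distances of consecutive densities tend
  to 0. Along a convergent subsequence the iterate and its successor have limits v and w, and the
  Gibbs densities of v and w must then agree almost everywhere.\<close>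

theorem mean_field_potential_exists:
  assumes \<rho>: "0 < \<rho>" "\<rho> < 2 * pi"
  obtains K v where "bounded_potential K v" "v = (\<lambda>x. \<rho> * green_op (gibbs v) x)"
proof -
  let ?U = "gibbs_iterate \<rho>"
  obtain K B where K: "\<And>n. bounded_potential K (?U n)" and B: "\<And>n. B \<le> free_energy \<rho> (gibbs (?U n))"
    using gibbs_iterate_uniform_bounds[OF \<rho>] by metis
  note \<mu> = borel_measurable_gibbs[OF K] abs_gibbs_le[OF K]
  define H where "H = \<rho> * (9 * exp K)"
  have H: "0 < H" using \<rho> by (simp add: H_def)
  have holder: "\<bar>?U n x - ?U n y\<bar> \<le> H * sqrt \<bar>x - y\<bar>" for n x y
  proof (cases n)
    case 0
    then show ?thesis using H by simp
  next
    case (Suc m)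
    have "\<bar>?U n x - ?U n y\<bar> = \<rho> * \<bar>green_op (gibbs (?U m)) x - green_op (gibbs (?U m)) y\<bar>"
      using \<rho> by (simp add: Suc abs_mult flip: right_diff_distrib)
    also have "\<dots> \<le> \<rho> * (9 * exp K * sqrt \<bar>x - y\<bar>)"
      using \<rho> by (intro mult_left_mono green_op_holder[OF \<mu>]) auto
    finally show ?thesis by (simp add: H_def mult.assoc)
  qed
  obtain g k where k: "strict_mono (k :: nat \<Rightarrow> nat)"
    and conv: "\<And>e. 0 < e \<Longrightarrow> \<exists>N. \<forall>n x. n \<ge> N \<and> x \<in> {-1..1} \<longrightarrow> norm (?U (k n) x - g x) < e"
  proof (rule Arzela_Ascoli[of "{-1..1::real}" ?U K])
    show "norm (?U n x) \<le> K" for n x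
      using bounded_potentialD(2,3)[OF K] by simp
    show "\<exists>d>0. \<forall>n y. y \<in> {-1..1} \<and> norm (x - y) < d \<longrightarrow> norm (?U n x - ?U n y) < e" if "0 < e" for x e
    proof (intro exI conjI allI impI)
      show "0 < (e / H)\<^sup>2" using that H by simp
      fix n y assume "y \<in> {-1..1} \<and> norm (x - y) < (e / H)\<^sup>2"
      then have "sqrt \<bar>x - y\<bar> < e / H" using that H by (intro real_less_lsqrt) auto
      then have "H * sqrt \<bar>x - y\<bar> < e" using H by (simp add: field_simps)
      then show "norm (?U n x - ?U n y) < e" using holder[of n x y] by simp
    qed
  qed (auto intro: that)
  \<comment> \<open>Arzela-Ascoli is applied on [-1,1]. All iterates vanish outside the open
    interval, so the extension by 0 is the pointwise limit on the whole line.\<close>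
  define v where "v = (\<lambda>x. if x \<in> {-1..1} then g x else 0)"
  have U_out: "?U n x = 0" if "1 \<le> \<bar>x\<bar>" for n x using that by (cases n) (auto simp: green_op_outside)
  have lim: "(\<lambda>n. ?U (k n) x) \<longlonglongrightarrow> v x" for x
  proof (cases "x \<in> {-1..1}")
    case True
    have "(\<lambda>n. ?U (k n) x) \<longlonglongrightarrow> g x"
    proof (rule LIMSEQ_I)
      fix e :: real assume "0 < e"
      with conv[OF this] True show "\<exists>N. \<forall>n\<ge>N. norm (?U (k n) x - g x) < e" by blast
    qed
    then show ?thesis using True by (simp add: v_def)
  next
    case False
    then have "?U (k n) x = 0" for n by (intro U_out) auto
    moreover have "v x = 0" using False by (simp only: v_def if_False)
    ultimately show ?thesis by simp
  qed
  note v = gibbs_tendsto[OF K lim]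
  define w where "w = (\<lambda>x. \<rho> * green_op (gibbs v) x)"
  have lim': "(\<lambda>n. ?U (Suc (k n)) x) \<longlonglongrightarrow> w x" for x
    unfolding gibbs_iterate.simps w_def
    by (intro tendsto_intros green_op_tendsto[where M="exp K"] \<mu> borel_measurable_gibbs[OF v(1)] v(2))
  note w = gibbs_tendsto[OF K lim']
  let ?F = "\<lambda>n. free_energy \<rho> (gibbs (?U n))"
  let ?D = "\<lambda>n. \<integral>y. (sqrt (gibbs (?U n) y) - sqrt (gibbs (?U (Suc n)) y))\<^sup>2 \<partial>lborel"
  obtain l where l: "?F \<longlonglongrightarrow> l"
    by (rule decseq_convergent[OF decseq_free_energy_gibbs_iterate[OF \<rho>(1)], of B]) (use B in auto)
  have "(\<lambda>n. ?F n - ?F (Suc n)) \<longlonglongrightarrow> l - l" by (intro tendsto_diff l LIMSEQ_Suc[OF l])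
  then have z: "(\<lambda>n. ?F n - ?F (Suc n)) \<longlonglongrightarrow> 0" by simp
  have "?D \<longlonglongrightarrow> 0"
  proof (rule tendsto_sandwich[OF _ _ tendsto_const z])
    show "\<forall>\<^sub>F n in sequentially. 0 \<le> ?D n" by (intro always_eventually allI integral_nonneg_AE) auto
    show "\<forall>\<^sub>F n in sequentially. ?D n \<le> ?F n - ?F (Suc n)"
      by (intro always_eventually allI free_energy_gibbs_iterate \<rho>)
  qed
  from LIMSEQ_subseq_LIMSEQ[OF this k] have D0: "(\<lambda>n. ?D (k n)) \<longlonglongrightarrow> 0" by (simp add: o_def)
  have sq_le: "\<bar>(sqrt a - sqrt b)\<^sup>2\<bar> \<le> exp K" if "0 \<le> a" "a \<le> exp K" "0 \<le> b" "b \<le> exp K" for a b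
  proof -
    have "\<bar>sqrt a - sqrt b\<bar> \<le> sqrt (exp K)"
      using that real_sqrt_le_mono[OF that(2)] real_sqrt_le_mono[OF that(4)] real_sqrt_ge_zero[OF that(1)] real_sqrt_ge_zero[OF that(3)]
      by linarith
    then have "\<bar>sqrt a - sqrt b\<bar>\<^sup>2 \<le> (sqrt (exp K))\<^sup>2" by (intro power_mono) auto
    then show ?thesis by simp
  qed
  have "(\<lambda>n. ?D (k n)) \<longlonglongrightarrow> (\<integral>y. (sqrt (gibbs v y) - sqrt (gibbs w y))\<^sup>2 \<partial>lborel)"
  proof (rule integral_dominated_convergence)
    note [measurable] = \<mu>(1) borel_measurable_gibbs[OF v(1)] borel_measurable_gibbs[OF w(1)]
    show "(\<lambda>y. (sqrt (gibbs v y) - sqrt (gibbs w y))\<^sup>2) \<in> borel_measurable lborel"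
      "(\<lambda>y. (sqrt (gibbs (?U (k n)) y) - sqrt (gibbs (?U (Suc (k n))) y))\<^sup>2) \<in> borel_measurable lborel" for n
      by measurable
    show "integrable lborel (\<lambda>y. indicator {-1..1::real} y * exp K)" by (intro integrable_mult_left) simp
    show "AE y in lborel. (\<lambda>n. (sqrt (gibbs (?U (k n)) y) - sqrt (gibbs (?U (Suc (k n))) y))\<^sup>2)
        \<longlonglongrightarrow> (sqrt (gibbs v y) - sqrt (gibbs w y))\<^sup>2"
      by (intro AE_I2 tendsto_intros v(2) w(2))
    show "AE y in lborel. norm ((sqrt (gibbs (?U (k n)) y) - sqrt (gibbs (?U (Suc (k n))) y))\<^sup>2)
        \<le> indicator {-1..1} y * exp K" for n
    proof (intro AE_I2)
      fix y
      show "norm ((sqrt (gibbs (?U (k n)) y) - sqrt (gibbs (?U (Suc (k n))) y))\<^sup>2) \<le> indicator {-1..1} y * exp K"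
      proof (cases "y \<in> {-1..1}")
        case True
        have "\<bar>(sqrt (gibbs (?U (k n)) y) - sqrt (gibbs (?U (Suc (k n))) y))\<^sup>2\<bar> \<le> exp K"
          using abs_le_D1[OF \<mu>(2)] gibbs_nonneg[OF K] by (intro sq_le)
        then show ?thesis using True by (simp del: gibbs_iterate.simps)
      next
        case False
        then show ?thesis by (subst gibbs_outside, force)+ simp
      qed
    qed
  qed
  from LIMSEQ_unique[OF D0 this] have "(\<integral>y. (sqrt (gibbs v y) - sqrt (gibbs w y))\<^sup>2 \<partial>lborel) = 0" by simp
  moreover have "integrable lborel (\<lambda>y. (sqrt (gibbs v y) - sqrt (gibbs w y))\<^sup>2)"
  proof (rule integrable_bounded_on_unit[where M="exp K"])
    note [measurable] = borel_measurable_gibbs[OF v(1)] borel_measurable_gibbs[OF w(1)]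
    show "(\<lambda>y. (sqrt (gibbs v y) - sqrt (gibbs w y))\<^sup>2) \<in> borel_measurable borel" by measurable
    show "\<bar>(sqrt (gibbs v y) - sqrt (gibbs w y))\<^sup>2\<bar> \<le> exp K" for y
      using abs_le_D1[OF abs_gibbs_le[OF v(1)]] abs_le_D1[OF abs_gibbs_le[OF w(1)]] gibbs_nonneg[OF v(1)] gibbs_nonneg[OF w(1)]
      by (intro sq_le)
  qed (simp add: gibbs_outside)
  ultimately have "AE y in lborel. (sqrt (gibbs v y) - sqrt (gibbs w y))\<^sup>2 = 0"
    by (subst (asm) integral_nonneg_eq_0_iff_AE) auto
  then have ae: "AE y in lborel. gibbs v y = gibbs w y" by eventually_elim simp
  \<comment> \<open>By construction w is \<rho> times the potential of \<open>gibbs v\<close>.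
    Equality almost everywhere is enough to replace \<open>gibbs v\<close> by \<open>gibbs w\<close>
    under the integral, so w satisfies the equation at every point.\<close>
  have "w = (\<lambda>x. \<rho> * green_op (gibbs w) x)"
  proof
    fix x
    have "green_op (gibbs v) x = green_op (gibbs w) x"
      unfolding green_op_def
    proof (rule integral_cong_AE)
      note [measurable] = borel_measurable_gibbs[OF v(1)] borel_measurable_gibbs[OF w(1)]
      show "(\<lambda>y. green x y * gibbs v y) \<in> borel_measurable lborel" "(\<lambda>y. green x y * gibbs w y) \<in> borel_measurable lborel"
        by measurable
      show "AE y in lborel. green x y * gibbs v y = green x y * gibbs w y" using ae by eventually_elim simp
    qed
    then show "w x = \<rho> * green_op (gibbs w) x" by (simp add: w_def)
  qed
  with w(1) show ?thesis by (rule that)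
qed

section \<open>Smoothness of the fixed point\<close>

lemma tanh_abs_less: "\<bar>tanh (x::real)\<bar> < 1"
  using tanh_real_lt_1[of x] tanh_real_gt_neg1[of x] by (simp add: abs_less_iff)

definition sech2 :: "real \<Rightarrow> real" where
  "sech2 t = 1 - (tanh t)\<^sup>2"

lemma sech2_bounds: "0 < sech2 t" "sech2 t \<le> 1"
  using tanh_abs_less[of t] by (auto simp: sech2_def abs_square_less_1)

lemma sech2_cosh: "sech2 t = 1 / (cosh t)\<^sup>2"
proof -
  have "cosh t \<noteq> 0" using cosh_real_pos[of t] by linarith
  then have "sech2 t = ((cosh t)\<^sup>2 - (sinh t)\<^sup>2) / (cosh t)\<^sup>2"
    by (simp add: sech2_def tanh_def power_divide diff_divide_distrib)
  then show ?thesis by (simp add: cosh_square_eq)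
qed

lemma continuous_tanh_real: "continuous_on S (tanh :: real \<Rightarrow> real)"
  by (intro continuous_intros) auto

lemma borel_measurable_tanh [measurable]: "(tanh :: real \<Rightarrow> real) \<in> borel_measurable borel"
  by (intro borel_measurable_continuous_onI continuous_tanh_real)

lemma borel_measurable_sech2 [measurable]: "sech2 \<in> borel_measurable borel"
  unfolding sech2_def by measurable

lemma tanh_has_derivative: "(tanh has_real_derivative sech2 t) (at t)"
  unfolding sech2_def by (auto intro!: derivative_eq_intros)

lemma abs_tanh_diff_le: "\<bar>tanh s - tanh t\<bar> \<le> \<bar>s - t :: real\<bar>"
proof -
  have "norm (tanh s - tanh t) \<le> 1 * norm (s - t)"
  proof (rule field_differentiable_bound[of UNIV])
    show "(tanh has_field_derivative sech2 z) (at z within UNIV)" for z using tanh_has_derivative[of z] by simp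
    show "norm (sech2 z) \<le> 1" for z using sech2_bounds[of z] by simp
  qed auto
  then show ?thesis by simp
qed

lemma tanh_artanh_real: "\<bar>x\<bar> < 1 \<Longrightarrow> tanh (artanh x) = (x::real)"
  by (simp add: artanh_def tanh_real_altdef exp_minus abs_less_iff field_simps)

lemma has_bochner_integral_tanh_substitution:
  fixes \<phi> :: "real \<Rightarrow> real"
  assumes int: "integrable lborel \<phi>" and zero: "\<And>y. 1 \<le> \<bar>y\<bar> \<Longrightarrow> \<phi> y = 0"
  shows "has_bochner_integral lborel (\<lambda>t. sech2 t * \<phi> (tanh t)) (\<integral>y. \<phi> y \<partial>lborel)"
proof -
  have [measurable]: "\<phi> \<in> borel_measurable borel" using int by simp
  have range: "range (tanh :: real \<Rightarrow> real) = {-1<..<1}"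
  proof
    show "{-1<..<1} \<subseteq> range (tanh :: real \<Rightarrow> real)"
    proof
      fix x :: real assume "x \<in> {-1<..<1}"
      then have "tanh (artanh x) = x" by (intro tanh_artanh_real) auto
      then show "x \<in> range tanh" by (metis rangeI)
    qed
  qed (auto simp: tanh_real_lt_1 tanh_real_gt_neg1)
  have set: "set_integrable lborel {-1<..<1} \<phi>"
    unfolding set_integrable_def
    by (rule Bochner_Integration.integrable_bound[OF int]) (auto simp: indicator_def)
  have "(LINT y:{-1<..<1}|lborel. \<phi> y) = (\<integral>y. \<phi> y \<partial>lborel)"
    unfolding set_lebesgue_integral_def
  proof (rule Bochner_Integration.integral_cong[OF refl])
    fix y show "indicator {-1<..<1} y *\<^sub>R \<phi> y = \<phi> y"
      using zero[of y] by (cases "\<bar>y\<bar> < 1") (auto simp: indicator_def abs_less_iff)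
  qed
  then have I: "integral {-1<..<1} \<phi> = (\<integral>y. \<phi> y \<partial>lborel)"
    using set_borel_integral_eq_integral(2)[OF set] by simp
  have "\<phi> absolutely_integrable_on {-1<..<1}"
    using set unfolding set_integrable_def
    by (simp add: integrable_completion)
  with I have *: "\<phi> absolutely_integrable_on (tanh ` (UNIV :: real set)) \<and> integral (tanh ` UNIV) \<phi> = (\<integral>y. \<phi> y \<partial>lborel)"
    by (simp add: range)
  have inj: "inj (tanh :: real \<Rightarrow> real)"
    by (rule inj_on_inverseI[of _ artanh]) (rule artanh_tanh_real)
  have der: "(tanh has_field_derivative sech2 x) (at x within UNIV)" for x
    using tanh_has_derivative[of x] by simp
  from has_absolute_integral_change_of_variables_1'[OF _ der inj, of \<phi> "\<integral>y. \<phi> y \<partial>lborel"] *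
  have "(\<lambda>x. \<bar>sech2 x\<bar> * \<phi> (tanh x)) absolutely_integrable_on UNIV"
    "integral UNIV (\<lambda>x. \<bar>sech2 x\<bar> * \<phi> (tanh x)) = (\<integral>y. \<phi> y \<partial>lborel)"
    by auto
  moreover have "\<bar>sech2 x\<bar> = sech2 x" for x using sech2_bounds[of x] by simp
  ultimately have a: "(\<lambda>x. sech2 x * \<phi> (tanh x)) absolutely_integrable_on UNIV"
    "integral UNIV (\<lambda>x. sech2 x * \<phi> (tanh x)) = (\<integral>y. \<phi> y \<partial>lborel)" by simp_all
  have i: "integrable lborel (\<lambda>x. sech2 x * \<phi> (tanh x))"
    using a(1) unfolding set_integrable_def by (simp add: integrable_completion)
  have "(\<integral>x. sech2 x * \<phi> (tanh x) \<partial>lborel) = (\<integral>y. \<phi> y \<partial>lborel)"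
    using has_integral_integral_lborel[OF i] a(2) by (simp add: integral_unique)
  with i show ?thesis by (simp add: has_bochner_integral_iff)
qed

lemma integrable_sech2: "integrable lborel sech2"
proof -
  have "integrable lborel (indicator {-1<..<1::real} :: real \<Rightarrow> real)" by (rule integrable_real_indicator) auto
  moreover have "indicator {-1<..<1} y = (0::real)" if "1 \<le> \<bar>y\<bar>" for y :: real
    using that by (auto simp: indicator_def)
  ultimately have "integrable lborel (\<lambda>t. sech2 t * indicator {-1<..<1} (tanh t))"
    by (rule integrable.intros[OF has_bochner_integral_tanh_substitution])
  then show ?thesis by (simp add: indicator_def tanh_real_lt_1 tanh_real_gt_neg1)
qed

text \<open>This is ln coth (\<bar>t\<bar> / 2) by the half angle formulas, in the shape in which it
  comes out of \<open>green\<close>. At t = 0 division by zero and \<open>ln 0 = 0\<close> give the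
  value 0.\<close>

definition log_coth :: "real \<Rightarrow> real" where
  "log_coth t = ln ((cosh t + 1) / \<bar>sinh t\<bar>)"

lemma continuous_sinh_cosh: "continuous_on S (sinh :: real \<Rightarrow> real)" "continuous_on S (cosh :: real \<Rightarrow> real)"
  by (intro continuous_intros)+

lemma borel_measurable_sinh_cosh [measurable]:
  "(sinh :: real \<Rightarrow> real) \<in> borel_measurable borel" "(cosh :: real \<Rightarrow> real) \<in> borel_measurable borel"
  by (intro borel_measurable_continuous_onI continuous_sinh_cosh)+

lemma borel_measurable_log_coth [measurable]: "log_coth \<in> borel_measurable borel"
  unfolding log_coth_def by measurable

lemma log_coth_even: "log_coth (- t) = log_coth t"
  by (simp add: log_coth_def)

text \<open>As \<open>semicircle (tanh z)\<close> is 1 / cosh z, numerator and denominator of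
  \<open>green\<close> share the factor 1 / (cosh s cosh t), and the addition theorems leave a
  function of s - t alone.\<close>

lemma green_tanh: "green (tanh s) (tanh t) = log_coth (s - t) / pi"
proof -
  define C where "C = cosh s * cosh t"
  have C: "0 < C" by (simp add: C_def)
  have ne: "cosh s \<noteq> 0" "cosh t \<noteq> 0" using cosh_real_pos[of s] cosh_real_pos[of t] by linarith+
  have le: "\<bar>tanh s\<bar> \<le> 1" "\<bar>tanh t\<bar> \<le> 1" using tanh_abs_less less_imp_le by blast+
  have Q: "semicircle (tanh z) = 1 / cosh z" for z
    using semicircle_eq[of "tanh z"] tanh_abs_less[of z] sech2_cosh[of z]
    by (simp add: sech2_def real_sqrt_divide)
  have "1 - tanh s * tanh t + semicircle (tanh s) * semicircle (tanh t) = (cosh (s - t) + 1) / C"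
    unfolding Q unfolding tanh_def cosh_diff C_def using ne by (simp add: field_simps)
  moreover have "tanh s - tanh t = sinh (s - t) / C"
    unfolding tanh_def sinh_diff C_def using ne by (simp add: field_simps)
  ultimately show ?thesis
    using C le by (simp add: green_def log_coth_def abs_divide)
qed

lemma log_coth_nonneg: "0 \<le> log_coth t"
proof -
  have "0 \<le> green (tanh t) (tanh 0)" by (rule green_nonneg)
  then show ?thesis unfolding green_tanh using pi_gt_zero by (simp add: zero_le_divide_iff)
qed

text \<open>This is \<open>green_op\<close> in the variable artanh x; the weight
  \<open>sech2\<close> is the Jacobian.\<close>

definition coth_potential :: "(real \<Rightarrow> real) \<Rightarrow> real \<Rightarrow> real" where
  "coth_potential R s = (\<integral>t. log_coth (s - t) / pi * (sech2 t * R t) \<partial>lborel)"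

lemma
  assumes R[measurable]: "R \<in> borel_measurable borel" and M: "\<And>t. \<bar>R t\<bar> \<le> M"
  shows integrable_coth_potential: "integrable lborel (\<lambda>t. log_coth (s - t) / pi * (sech2 t * R t))"
    and coth_potential_eq: "coth_potential R s = green_op (\<lambda>y. if \<bar>y\<bar> < 1 then R (artanh y) else 0) (tanh s)"
proof -
  let ?h = "\<lambda>y. if \<bar>y\<bar> < 1 then R (artanh y) else 0"
  have [measurable]: "(artanh :: real \<Rightarrow> real) \<in> borel_measurable borel" unfolding artanh_def by measurable
  have hm: "?h \<in> borel_measurable borel" by measurable
  have hM: "\<bar>?h y\<bar> \<le> M" for y using M[of "artanh y"] M[of 0] by auto
  have "has_bochner_integral lborel (\<lambda>t. sech2 t * (green (tanh s) (tanh t) * ?h (tanh t))) (\<integral>y. green (tanh s) y * ?h y \<partial>lborel)"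
    by (rule has_bochner_integral_tanh_substitution[OF integrable_green_mult[OF hm hM]]) (simp add: green_outside')
  moreover have "sech2 t * (green (tanh s) (tanh t) * ?h (tanh t)) = log_coth (s - t) / pi * (sech2 t * R t)" for t
    by (simp add: green_tanh tanh_abs_less artanh_tanh_real)
  ultimately have "has_bochner_integral lborel (\<lambda>t. log_coth (s - t) / pi * (sech2 t * R t)) (green_op ?h (tanh s))"
    by (simp add: green_op_def)
  then show "integrable lborel (\<lambda>t. log_coth (s - t) / pi * (sech2 t * R t))" "coth_potential R s = green_op ?h (tanh s)"
    by (auto simp: has_bochner_integral_iff coth_potential_def)
qed

lemma coth_potential_bound_holder:
  assumes R[measurable]: "R \<in> borel_measurable borel" and M: "\<And>t. \<bar>R t\<bar> \<le> M"
  shows "\<bar>coth_potential R s\<bar> \<le> M" "\<bar>coth_potential R s - coth_potential R t\<bar> \<le> 9 * M * sqrt \<bar>s - t\<bar>"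
proof -
  let ?h = "\<lambda>y. if \<bar>y\<bar> < 1 then R (artanh y) else 0"
  have [measurable]: "(artanh :: real \<Rightarrow> real) \<in> borel_measurable borel" unfolding artanh_def by measurable
  have hm: "?h \<in> borel_measurable borel" by measurable
  have hM: "\<bar>?h y\<bar> \<le> M" for y using M[of "artanh y"] M[of 0] by auto
  have M0: "0 \<le> M" using M[of 0] by linarith
  note eq = coth_potential_eq[OF R M]
  have "\<bar>coth_potential R s\<bar> \<le> M * semicircle (tanh s)" unfolding eq by (rule green_op_bound[OF hm hM])
  also have "\<dots> \<le> M * 1" by (intro mult_left_mono semicircle_le_1 M0)
  finally show "\<bar>coth_potential R s\<bar> \<le> M" by simp
  have "\<bar>coth_potential R s - coth_potential R t\<bar> \<le> 9 * M * sqrt \<bar>tanh s - tanh t\<bar>"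
    unfolding eq by (rule green_op_holder[OF hm hM])
  also have "\<dots> \<le> 9 * M * sqrt \<bar>s - t\<bar>"
    using M0 abs_tanh_diff_le[of s t] by (intro mult_left_mono real_sqrt_le_mono) auto
  finally show "\<bar>coth_potential R s - coth_potential R t\<bar> \<le> 9 * M * sqrt \<bar>s - t\<bar>" .
qed

lemma has_derivative_under_integral:
  fixes H H' :: "real \<Rightarrow> real \<Rightarrow> real"
  assumes int: "\<And>s. integrable lborel (H s)" and w: "integrable lborel w"
    and deriv: "\<And>s t. \<bar>s - s0\<bar> \<le> 1 \<Longrightarrow> ((\<lambda>s. H s t) has_real_derivative H' s t) (at s)"
    and bound: "\<And>s t. \<bar>s - s0\<bar> \<le> 1 \<Longrightarrow> \<bar>H' s t\<bar> \<le> w t"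
    and meas: "H' s0 \<in> borel_measurable borel"
  shows "((\<lambda>s. \<integral>t. H s t \<partial>lborel) has_real_derivative (\<integral>t. H' s0 t \<partial>lborel)) (at s0)"
  unfolding DERIV_def tendsto_at_iff_sequentially
proof (intro allI impI)
  fix X :: "nat \<Rightarrow> real" assume X: "\<forall>i. X i \<in> UNIV - {0}" "X \<longlonglongrightarrow> 0"
  have "\<forall>\<^sub>F n in sequentially. \<bar>X n\<bar> < 1"
    using tendstoD[OF X(2), of 1] by (simp add: dist_real_def)
  then obtain N where N: "\<And>n. N \<le> n \<Longrightarrow> \<bar>X n\<bar> < 1" by (auto simp: eventually_sequentially)
  let ?q = "\<lambda>n t. (H (s0 + X (n + N)) t - H s0 t) / X (n + N)"
  have "(\<lambda>n. \<integral>t. ?q n t \<partial>lborel) \<longlonglongrightarrow> (\<integral>t. H' s0 t \<partial>lborel)"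
  proof (rule integral_dominated_convergence[OF _ _ w])
    show "H' s0 \<in> borel_measurable lborel" using meas by simp
    show "?q n \<in> borel_measurable lborel" for n
      using int[of s0] int[of "s0 + X (n + N)"] by (intro borel_measurable_divide borel_measurable_diff) auto
    show "AE t in lborel. (\<lambda>n. ?q n t) \<longlonglongrightarrow> H' s0 t"
    proof (intro AE_I2)
      fix t
      have "(\<lambda>n. (H (s0 + X n) t - H s0 t) / X n) \<longlonglongrightarrow> H' s0 t"
        using deriv[of s0 t] X unfolding DERIV_def tendsto_at_iff_sequentially by (auto simp: o_def)
      then show "(\<lambda>n. ?q n t) \<longlonglongrightarrow> H' s0 t" by (rule LIMSEQ_ignore_initial_segment)
    qed
    show "AE t in lborel. norm (?q n t) \<le> w t" for n
    proof (intro AE_I2)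
      fix t
      have x: "\<bar>X (n + N)\<bar> < 1" "X (n + N) \<noteq> 0" using N[of "n + N"] X(1) by auto
      have "norm (H (s0 + X (n + N)) t - H s0 t) \<le> w t * norm (s0 + X (n + N) - s0)"
      proof (rule field_differentiable_bound[of "{s0 - 1..s0 + 1}"])
        fix z assume "z \<in> {s0 - 1..s0 + 1}"
        then have z: "\<bar>z - s0\<bar> \<le> 1" by auto
        show "((\<lambda>s. H s t) has_field_derivative H' z t) (at z within {s0 - 1..s0 + 1})"
          using deriv[OF z] by (rule has_field_derivative_at_within)
        show "norm (H' z t) \<le> w t" using bound[OF z] by simp
      qed (use x in auto)
      then show "norm (?q n t) \<le> w t" using x by (simp add: field_simps)
    qed
  qed
  then have "(\<lambda>n. ((\<integral>t. H (s0 + X (n + N)) t \<partial>lborel) - (\<integral>t. H s0 t \<partial>lborel)) / X (n + N)) \<longlonglongrightarrow> (\<integral>t. H' s0 t \<partial>lborel)"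
    using int by simp
  then show "((\<lambda>h. ((\<integral>t. H (s0 + h) t \<partial>lborel) - (\<integral>t. H s0 t \<partial>lborel)) / h) \<circ> X) \<longlonglongrightarrow> (\<integral>t. H' s0 t \<partial>lborel)"
    unfolding o_def by (rule LIMSEQ_offset)
qed

text \<open>From cosh t \<le> 2 cosh s cosh (s - t). Translates of the weight are comparable,
  uniformly for bounded s, which provides the majorant when the translated weight is
  differentiated.\<close>

lemma sech2_translate_le: "sech2 (s - t) \<le> 4 * (cosh s)\<^sup>2 * sech2 t"
proof -
  have "cosh t = cosh s * cosh (s - t) - sinh s * sinh (s - t)"
    using cosh_diff[of s "s - t"] by simp
  also have "\<dots> \<le> cosh s * cosh (s - t) + cosh s * cosh (s - t)"
  proof -
    have a: "\<bar>sinh x\<bar> \<le> cosh x" for x :: real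
      by (metis abs_le_square_iff abs_of_nonneg cosh_real_nonneg cosh_square_eq le_add_same_cancel1 zero_le_one)
    have "- (sinh s * sinh (s - t)) \<le> \<bar>sinh s\<bar> * \<bar>sinh (s - t)\<bar>" by (metis abs_ge_minus_self abs_mult)
    also have "\<dots> \<le> cosh s * cosh (s - t)" by (intro mult_mono a) auto
    finally show ?thesis by simp
  qed
  finally have "cosh t \<le> 2 * (cosh s * cosh (s - t))" by simp
  then have "(cosh t)\<^sup>2 \<le> (2 * (cosh s * cosh (s - t)))\<^sup>2" by (intro power_mono) auto
  then have "(cosh t)\<^sup>2 \<le> 4 * (cosh s)\<^sup>2 * (cosh (s - t))\<^sup>2" by (simp add: power_mult_distrib)
  moreover have "0 < (cosh t)\<^sup>2" "0 < (cosh (s - t))\<^sup>2" by simp_all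
  ultimately show ?thesis unfolding sech2_cosh by (simp add: field_simps)
qed

text \<open>The point s moves from the singular kernel into the smooth weight and the density, so
  that derivatives in s do not hit the logarithm.\<close>

lemma coth_potential_translated:
  "coth_potential R s = (\<integral>t. log_coth t / pi * (sech2 (s - t) * R (s - t)) \<partial>lborel)"
  unfolding coth_potential_def
  by (subst lborel_integral_real_affine[where c="-1" and t=s]) auto

lemma integrable_coth_potential_translated:
  assumes "R \<in> borel_measurable borel" "\<And>t. \<bar>R t\<bar> \<le> M"
  shows "integrable lborel (\<lambda>t. log_coth t / pi * (sech2 (s - t) * R (s - t)))"
  using lborel_integrable_real_affine[OF integrable_coth_potential[OF assms, of s], of "-1" s] by simp

lemma sech2_has_derivative: "(sech2 has_real_derivative - 2 * tanh t * sech2 t) (at t)"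
  unfolding sech2_def[abs_def] using tanh_has_derivative[of t]
  by (auto intro!: derivative_eq_intros simp: sech2_def)

text \<open>Since the derivative of \<open>sech2\<close> is \<open>- 2 * tanh t * sech2 t\<close>,
  the weight can be factored out again and the derivative of a potential is a potential of the same
  kind. This closure drives the inductions on the order of differentiability.\<close>

lemma coth_potential_has_derivative:
  assumes R: "R \<in> borel_measurable borel" "\<And>t. \<bar>R t\<bar> \<le> M"
    and R': "R' \<in> borel_measurable borel" "\<And>t. \<bar>R' t\<bar> \<le> M'"
    and deriv: "\<And>t. (R has_real_derivative R' t) (at t)"
  shows "(coth_potential R has_real_derivative coth_potential (\<lambda>t. R' t - 2 * tanh t * R t) s) (at s)"
proof -
  let ?T = "\<lambda>t. R' t - 2 * tanh t * R t"
  note [measurable] = R(1) R'(1)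
  have T: "\<bar>?T t\<bar> \<le> M' + 2 * M" for t
  proof -
    have "\<bar>2 * tanh t * R t\<bar> \<le> 2 * 1 * M"
      unfolding abs_mult using R(2)[of t] tanh_abs_less[of t] by (intro mult_mono) auto
    then show ?thesis using R'(2)[of t] by linarith
  qed
  \<comment> \<open>Uniform over all z with \<open>\<bar>z - s\<bar> \<le> 1\<close>: there cosh z
    is at most \<open>cosh (\<bar>s\<bar> + 1)\<close>, and \<open>M' + 2 * M\<close> bounds the new
    density.\<close>
  define C where "C = 4 * (cosh (\<bar>s\<bar> + 1))\<^sup>2 * (M' + 2 * M)"
  have "((\<lambda>s. \<integral>t. log_coth t / pi * (sech2 (s - t) * R (s - t)) \<partial>lborel) has_real_derivative
      (\<integral>t. log_coth t / pi * (sech2 (s - t) * ?T (s - t)) \<partial>lborel)) (at s)"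
  proof (rule has_derivative_under_integral[where w="\<lambda>t. C * (log_coth (0 - t) / pi * (sech2 t * 1))"])
    show "integrable lborel (\<lambda>t. log_coth t / pi * (sech2 (s - t) * R (s - t)))" for s
      by (rule integrable_coth_potential_translated[OF R])
    show "integrable lborel (\<lambda>t. C * (log_coth (0 - t) / pi * (sech2 t * 1)))"
      by (intro integrable_mult_right integrable_coth_potential[where M=1]) auto
    fix z t
    have "((\<lambda>z. sech2 (z - t) * R (z - t)) has_real_derivative
        (- 2 * tanh (z - t) * sech2 (z - t) * 1) * R (z - t) + (R' (z - t) * 1) * sech2 (z - t)) (at z)"
      by (intro DERIV_mult DERIV_chain2[OF sech2_has_derivative] DERIV_chain2[OF deriv])
         (auto intro!: derivative_eq_intros)
    from DERIV_cmult[OF this, of "log_coth t / pi"]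
    show "((\<lambda>z. log_coth t / pi * (sech2 (z - t) * R (z - t))) has_real_derivative
        log_coth t / pi * (sech2 (z - t) * ?T (z - t))) (at z)"
      by (simp add: algebra_simps)
    assume z: "\<bar>z - s\<bar> \<le> 1"
    have "sech2 (z - t) \<le> 4 * (cosh z)\<^sup>2 * sech2 t" by (rule sech2_translate_le)
    also have "\<dots> \<le> 4 * (cosh (\<bar>s\<bar> + 1))\<^sup>2 * sech2 t"
    proof -
      have "cosh z = cosh \<bar>z\<bar>" by (simp add: abs_if)
      also have "\<dots> \<le> cosh (\<bar>s\<bar> + 1)" using z by (subst cosh_real_nonneg_le_iff) auto
      finally have "(cosh z)\<^sup>2 \<le> (cosh (\<bar>s\<bar> + 1))\<^sup>2" by (intro power_mono) auto
      then show ?thesis using sech2_bounds[of t] by simp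
    qed
    finally have "sech2 (z - t) * \<bar>?T (z - t)\<bar> \<le> 4 * (cosh (\<bar>s\<bar> + 1))\<^sup>2 * sech2 t * (M' + 2 * M)"
      using T[of "z - t"] sech2_bounds[of t] by (intro mult_mono) auto
    then have "log_coth t / pi * (sech2 (z - t) * \<bar>?T (z - t)\<bar>) \<le> log_coth t / pi * (C * sech2 t)"
      using log_coth_nonneg[of t] by (intro mult_left_mono) (auto simp: C_def mult_ac)
    then show "\<bar>log_coth t / pi * (sech2 (z - t) * ?T (z - t))\<bar> \<le> C * (log_coth (0 - t) / pi * (sech2 t * 1))"
      using log_coth_nonneg[of t] sech2_bounds[of "z - t"] by (simp add: abs_mult log_coth_even mult_ac)
  next
    show "(\<lambda>t. log_coth t / pi * (sech2 (s - t) * ?T (s - t))) \<in> borel_measurable borel"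
      by measurable
  qed
  then show ?thesis unfolding coth_potential_translated[abs_def] .
qed

section \<open>Regularisation of the logarithmic kernel\<close>

lemma integrable_bound_real:
  fixes f g :: "'a \<Rightarrow> real"
  assumes "integrable M f" "g \<in> borel_measurable M" "\<And>x. \<bar>g x\<bar> \<le> f x"
  shows "integrable M g"
proof (rule Bochner_Integration.integrable_bound[OF assms(1,2)])
  show "AE x in M. norm (g x) \<le> norm (f x)"
    using order_trans[OF assms(3) abs_ge_self] by (intro AE_I2) simp
qed

text \<open>For \<open>c \<up> 1\<close> these are the kernel \<open>log_coth\<close> and its derivative, without the singularity at \<open>0\<close>.\<close>

definition log_coth_reg :: "real \<Rightarrow> real \<Rightarrow> real" where
  "log_coth_reg c t = ln ((cosh t + c) / (cosh t - c)) / 2"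

definition log_coth_reg' :: "real \<Rightarrow> real \<Rightarrow> real" where
  "log_coth_reg' c t = - (c * sinh t / ((cosh t)\<^sup>2 - c\<^sup>2))"

lemma borel_measurable_log_coth_reg [measurable]:
  "log_coth_reg c \<in> borel_measurable borel" "log_coth_reg' c \<in> borel_measurable borel"
  unfolding log_coth_reg_def log_coth_reg'_def by measurable

lemma log_coth_reg_has_derivative:
  assumes c: "0 < c" "c < 1"
  shows "(log_coth_reg c has_real_derivative log_coth_reg' c t) (at t)"
proof -
  have p: "0 < cosh t - c" "0 < cosh t + c" using cosh_real_ge_1[of t] c by linarith+
  have eq: "log_coth_reg c = (\<lambda>t. (ln (cosh t + c) - ln (cosh t - c)) / 2)"
  proof
    fix z
    have "0 < cosh z - c" "0 < cosh z + c" using cosh_real_ge_1[of z] c by linarith+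
    then show "log_coth_reg c z = (ln (cosh z + c) - ln (cosh z - c)) / 2" by (simp add: log_coth_reg_def ln_div)
  qed
  have d: "((\<lambda>t. cosh t + c) has_real_derivative sinh t + 0) (at t)" "((\<lambda>t. cosh t - c) has_real_derivative sinh t - 0) (at t)"
    by (auto intro!: derivative_eq_intros)
  have "(log_coth_reg c has_real_derivative
      (inverse (cosh t + c) * (sinh t + 0) - inverse (cosh t - c) * (sinh t - 0)) / 2) (at t)"
    unfolding eq using p by (intro DERIV_cdivide DERIV_diff DERIV_chain2[OF DERIV_ln] d)
  moreover have "(inverse (a + c) * (z + 0) - inverse (a - c) * (z - 0)) / 2 = - (c * z / (a\<^sup>2 - c\<^sup>2))"
    if "0 < a - c" "0 < a + c" for a z
  proof -
    have "(inverse (q + 2 * c) * (z + 0) - inverse q * (z - 0)) / 2 = - (c * z / ((q + 2 * c) * q))"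
      if "0 < q" "0 < q + 2 * c" for q
    proof -
      have "inverse (q + 2 * c) * z - inverse q * z = - 2 * (c * z / ((q + 2 * c) * q))"
        using that by (simp add: field_simps)
      then show ?thesis by simp
    qed
    moreover have "a - c + 2 * c = a + c" "(a + c) * (a - c) = a\<^sup>2 - c\<^sup>2"
      by (simp_all add: power2_eq_square algebra_simps)
    ultimately show ?thesis using that by (metis (no_types))
  qed
  ultimately show ?thesis using p by (simp only: log_coth_reg'_def)
qed

lemma cosh_gt_1: "t \<noteq> 0 \<Longrightarrow> 1 < cosh (t::real)"
  using cosh_real_ge_1[of t] by (simp add: order.strict_iff_order)

lemma log_coth_eq: "t \<noteq> 0 \<Longrightarrow> log_coth t = ln ((cosh t + 1) / (cosh t - 1)) / 2"
proof -
  assume t: "t \<noteq> 0"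
  have p: "0 < cosh t - 1" "0 < cosh t + 1" "0 < \<bar>sinh t\<bar>" using cosh_gt_1[OF t] t by auto
  have "(cosh t + 1) / (cosh t - 1) = ((cosh t + 1) / \<bar>sinh t\<bar>)\<^sup>2"
  proof -
    have "(\<bar>sinh t\<bar>)\<^sup>2 = (cosh t + 1) * (cosh t - 1)"
      using cosh_square_eq[of t] by (simp add: power2_eq_square algebra_simps)
    then show ?thesis using p by (simp add: power_divide) (simp add: power2_eq_square)
  qed
  then show ?thesis using p by (simp add: log_coth_def ln_realpow)
qed

lemma log_coth_reg_bounds:
  assumes c: "0 < c" "c < 1"
  shows "0 \<le> log_coth_reg c t" "log_coth_reg c t \<le> c / (1 - c)" "t \<noteq> 0 \<Longrightarrow> log_coth_reg c t \<le> log_coth t"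
proof -
  have p: "0 < cosh t - c" "0 < cosh t + c" using cosh_real_ge_1[of t] c by linarith+
  show "0 \<le> log_coth_reg c t" using p c by (simp add: log_coth_reg_def)
  have "ln ((cosh t + c) / (cosh t - c)) \<le> (cosh t + c) / (cosh t - c) - 1" using p by (intro ln_le_minus_one) simp
  also have "\<dots> = 2 * c / (cosh t - c)" using p by (simp add: field_simps)
  also have "\<dots> \<le> 2 * c / (1 - c)" using c cosh_real_ge_1[of t] by (intro divide_left_mono) auto
  finally have "ln ((cosh t + c) / (cosh t - c)) / 2 \<le> 2 * c / (1 - c) / 2" by (rule divide_right_mono) simp
  moreover have "2 * (c / (1 - c)) / 2 = c / (1 - c)" by (rule nonzero_mult_div_cancel_left) simp
  then have "2 * c / (1 - c) / 2 = c / (1 - c)" by (simp only: times_divide_eq_right)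
  ultimately show "log_coth_reg c t \<le> c / (1 - c)" by (simp only: log_coth_reg_def)
  assume t: "t \<noteq> 0"
  have q: "0 < cosh t - 1" using cosh_gt_1[OF t] by simp
  have "(cosh t + c) / (cosh t - c) \<le> (cosh t + 1) / (cosh t - 1)"
    using p q c by (intro frac_le) auto
  then have "ln ((cosh t + c) / (cosh t - c)) \<le> ln ((cosh t + 1) / (cosh t - 1))"
    using p by (intro ln_mono) auto
  then show "log_coth_reg c t \<le> log_coth t" by (simp add: log_coth_reg_def log_coth_eq[OF t])
qed

text \<open>The regularised derivative is the singular one, - 1 / sinh t, damped by a factor between
  0 and 1; this yields one majorant for all c.\<close>

lemma log_coth_reg'_factor:
  assumes c: "0 < c" "c < 1" and t: "t \<noteq> 0"
  obtains \<theta> where "0 \<le> \<theta>" "\<theta> \<le> 1" "log_coth_reg' c t = - (\<theta> / sinh t)"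
proof
  have s: "sinh t \<noteq> 0" using t by simp
  have c2: "c\<^sup>2 < 1" using c by (simp add: abs_square_less_1)
  have D: "(cosh t)\<^sup>2 - c\<^sup>2 = (sinh t)\<^sup>2 + (1 - c\<^sup>2)" by (simp add: cosh_square_eq)
  have D0: "0 < (cosh t)\<^sup>2 - c\<^sup>2" unfolding D using c2 by (simp add: add_nonneg_pos)
  show "0 \<le> c * (sinh t)\<^sup>2 / ((cosh t)\<^sup>2 - c\<^sup>2)"
    using c D0 by (intro divide_nonneg_pos mult_nonneg_nonneg) auto
  have "c * (sinh t)\<^sup>2 \<le> 1 * (sinh t)\<^sup>2" using c by (intro mult_right_mono) auto
  also have "\<dots> \<le> (cosh t)\<^sup>2 - c\<^sup>2" unfolding D using c2 by simp
  finally show "c * (sinh t)\<^sup>2 / ((cosh t)\<^sup>2 - c\<^sup>2) \<le> 1" using D0 by simp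
  show "log_coth_reg' c t = - (c * (sinh t)\<^sup>2 / ((cosh t)\<^sup>2 - c\<^sup>2) / sinh t)"
    using s by (simp add: log_coth_reg'_def power2_eq_square)
qed

text \<open>For fixed c the regularised derivative is bounded, so the regularised convolution can be
  differentiated under the integral for any integrable density.\<close>

lemma abs_log_coth_reg'_le:
  assumes c: "0 < c" "c < 1"
  shows "\<bar>log_coth_reg' c t\<bar> \<le> 1 / (1 - c\<^sup>2)"
proof -
  have c2: "c\<^sup>2 < 1" using c by (simp add: abs_square_less_1)
  define s where "s = \<bar>sinh t\<bar>"
  have D: "(cosh t)\<^sup>2 - c\<^sup>2 = s\<^sup>2 + (1 - c\<^sup>2)" by (simp add: cosh_square_eq s_def)
  have s: "0 \<le> s" by (simp add: s_def)
  have D0: "0 < s\<^sup>2 + (1 - c\<^sup>2)" using c2 by (simp add: add_nonneg_pos)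
  have "(1 - c\<^sup>2) * s \<le> s\<^sup>2 + (1 - c\<^sup>2)"
  proof (cases "s \<le> 1")
    case True
    then have "(1 - c\<^sup>2) * s \<le> (1 - c\<^sup>2) * 1" using c2 by (intro mult_left_mono) auto
    also have "\<dots> \<le> s\<^sup>2 + (1 - c\<^sup>2)" by simp
    finally show ?thesis .
  next
    case False
    have "(1 - c\<^sup>2) * s \<le> 1 * s" using s by (intro mult_right_mono) auto
    also have "\<dots> \<le> s * s" using False s by (intro mult_right_mono) auto
    finally show ?thesis using c2 by (simp add: power2_eq_square)
  qed
  moreover have "(1 - c\<^sup>2) * (c * s) \<le> (1 - c\<^sup>2) * s" using c c2 s by (intro mult_left_mono mult_left_le_one_le) auto
  ultimately have "(1 - c\<^sup>2) * (c * s) \<le> s\<^sup>2 + (1 - c\<^sup>2)" by linarith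
  then have "c * s / (s\<^sup>2 + (1 - c\<^sup>2)) \<le> 1 / (1 - c\<^sup>2)" using D0 c2 by (simp add: field_simps)
  then show ?thesis unfolding log_coth_reg'_def D using c D0 by (simp add: abs_mult s_def)
qed

text \<open>For 0 < t \<le> 1, sinh t \<ge> t gives the majorant \<open>t powr - (1/2)\<close>; for
  t > 1, sinh t \<ge> e^t / 4 gives 4 exp (- t / 2). \<open>W\<close> adds the two, and reflection
  covers negative t.\<close>

lemma integrable_sqrt_div_sinh: "integrable lborel (\<lambda>t. sqrt \<bar>t\<bar> / \<bar>sinh t\<bar>)"
proof -
  have pw: "integrable lborel (\<lambda>z::real. indicator {0..1} z * z powr - (1/2))"
    using has_bochner_integral_of_has_integral[OF _ _ has_integral_powr_from_0[of "- (1/2)" 1]]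
    by (auto simp: has_bochner_integral_iff)
  have ex: "integrable lborel (\<lambda>z::real. indicator {0..} z * exp (- (1/2) * z))"
    using has_bochner_integral_of_has_integral[OF _ _ has_integral_exp_minus_to_infinity[of "1/2" 0]]
    by (auto simp: has_bochner_integral_iff)
  define W where "W = (\<lambda>z::real. indicator {0..1} z * z powr - (1/2) + 4 * (indicator {0..} z * exp (- (1/2) * z)))"
  have iW: "integrable lborel W" unfolding W_def by (intro Bochner_Integration.integrable_add integrable_mult_right pw ex)
  have iW': "integrable lborel (\<lambda>z. W (0 + -1 * z))" by (rule lborel_integrable_real_affine[OF iW]) simp
  have W0: "0 \<le> W z" for z by (simp add: W_def)
  have pos: "sqrt t / sinh t \<le> W t" if t: "0 < t" for t
  proof (cases "t \<le> 1")
    case True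
    have "t \<le> sinh t"
    proof -
      have "sinh 0 - 0 \<le> sinh t - t"
      proof (rule DERIV_nonneg_imp_nondecreasing[of 0 t "\<lambda>z. sinh z - z"])
        fix z :: real
        have "((\<lambda>z. sinh z - z) has_real_derivative cosh z - 1) (at z)" by (auto intro!: derivative_eq_intros)
        then show "\<exists>y. ((\<lambda>z. sinh z - z) has_real_derivative y) (at z) \<and> 0 \<le> y" using cosh_real_ge_1[of z] by force
      qed (use t in simp)
      then show ?thesis by simp
    qed
    then have "sqrt t / sinh t \<le> sqrt t / t" using t by (intro divide_left_mono) auto
    also have "\<dots> = t powr - (1/2)"
      using t by (simp add: powr_minus_divide powr_half_sqrt real_div_sqrt field_simps)
    also have "\<dots> \<le> W t" using True t by (simp add: W_def)
    finally show ?thesis .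
  next
    case False
    have "sqrt t \<le> exp (t / 2)"
    proof (rule real_le_lsqrt)
      have "t \<le> exp t" using exp_ge_add_one_self[of t] by linarith
      then show "t \<le> (exp (t / 2))\<^sup>2" by (simp flip: exp_double)
    qed simp
    moreover have "exp t / 4 \<le> sinh t"
    proof -
      have "exp (- t) \<le> 1" using t by simp
      moreover have "2 \<le> exp t" using exp_ge_add_one_self[of t] False by linarith
      ultimately show ?thesis unfolding sinh_field_def by argo
    qed
    ultimately have "sqrt t / sinh t \<le> exp (t / 2) / (exp t / 4)" using t by (intro frac_le) auto
    also have "\<dots> = 4 * exp (- (1/2) * t)"
    proof -
      have "exp (t / 2) * exp (t / 2) = exp t" by (simp flip: exp_add)
      then have "exp t = exp (t / 2) * exp (t / 2)" by simp
      then show ?thesis by (simp add: exp_minus field_simps)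
    qed
    finally show ?thesis using False t by (simp add: W_def)
  qed
  show ?thesis
  proof (rule Bochner_Integration.integrable_bound[OF Bochner_Integration.integrable_add[OF iW iW']])
    show "AE t in lborel. norm (sqrt \<bar>t\<bar> / \<bar>sinh t\<bar>) \<le> norm (W t + W (0 + -1 * t))"
    proof (intro AE_I2)
      fix t :: real
      consider "t = 0" | "0 < t" | "0 < - t" by linarith
      then have "sqrt \<bar>t\<bar> / \<bar>sinh t\<bar> \<le> W t + W (0 + -1 * t)"
      proof cases
        case 2
        then show ?thesis using pos[of t] W0[of "- t"] by simp
      next
        case 3
        then show ?thesis using pos[of "- t"] W0[of t] by simp
      qed (use W0[of 0] in simp)
      then show "norm (sqrt \<bar>t\<bar> / \<bar>sinh t\<bar>) \<le> norm (W t + W (0 + -1 * t))" by simp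
    qed
  qed measurable
qed

text \<open>Convolution with the logarithmically singular kernel gains one derivative on Hoelder continuous
  densities: the derivative of the regularised convolution is symmetrised, which turns the kernel
  singularity \<open>1 / sinh t\<close> into the integrable \<open>sqrt \<bar>t\<bar> / \<bar>sinh t\<bar>\<close>, uniformly in the point.\<close>

lemma log_coth_convolution_differentiable:
  fixes g :: "real \<Rightarrow> real"
  assumes g: "integrable lborel g" and conv: "\<And>s. integrable lborel (\<lambda>t. log_coth (s - t) * g t)"
    and H: "\<And>s t. \<bar>g s - g t\<bar> \<le> H * sqrt \<bar>s - t\<bar>"
  obtains D B where "\<And>s. ((\<lambda>s. \<integral>t. log_coth (s - t) * g t \<partial>lborel) has_real_derivative D s) (at s)" "\<And>s. \<bar>D s\<bar> \<le> B"
proof -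
  have [measurable]: "g \<in> borel_measurable borel" using g by simp
  have H0: "0 \<le> H" using order_trans[OF abs_ge_zero H[of 0 1]] by simp
  define c where "c = (\<lambda>n. 1 - inverse (real (Suc (Suc n))))"
  have c: "0 < c n" "c n < 1" for n by (auto simp: c_def field_simps)
  have c_lim: "c \<longlonglongrightarrow> 1 - 0" unfolding c_def by (intro tendsto_intros LIMSEQ_Suc[OF LIMSEQ_inverse_real_of_nat])
  define V where "V = (\<lambda>n s. \<integral>t. log_coth_reg (c n) (s - t) * g t \<partial>lborel)"
  define V' where "V' = (\<lambda>n s. \<integral>t. log_coth_reg' (c n) (s - t) * g t \<partial>lborel)"
  let ?d = "\<lambda>s t. g (s - t) - g (s + t)"
  let ?w = "\<lambda>t. sqrt \<bar>t\<bar> / \<bar>sinh t\<bar>"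
  have d_le: "\<bar>?d s t\<bar> \<le> 2 * H * sqrt \<bar>t\<bar>" for s t
  proof -
    have "\<bar>?d s t\<bar> \<le> H * sqrt \<bar>(s - t) - (s + t)\<bar>" by (rule H)
    also have "\<dots> = H * (sqrt 2 * sqrt \<bar>t\<bar>)" by (simp add: abs_mult flip: real_sqrt_mult)
    also have "\<dots> \<le> H * (2 * sqrt \<bar>t\<bar>)" using H0 by (intro mult_left_mono mult_right_mono) (auto intro: real_le_lsqrt)
    finally show ?thesis by simp
  qed
  define D where "D = (\<lambda>s. \<integral>t. - (1 / sinh t) * ?d s t / 2 \<partial>lborel)"
  have int_reg': "integrable lborel (\<lambda>t. log_coth_reg' (c n) (s - t) * g t)" for n s
  proof (rule Bochner_Integration.integrable_bound[OF integrable_mult_right[OF g, of "1 / (1 - (c n)\<^sup>2)"]])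
    have c2: "0 < 1 - (c n)\<^sup>2" using c[of n] by (simp add: abs_square_less_1)
    show "AE t in lborel. norm (log_coth_reg' (c n) (s - t) * g t) \<le> norm (1 / (1 - (c n)\<^sup>2) * g t)"
    proof (intro AE_I2)
      fix t
      have "\<bar>log_coth_reg' (c n) (s - t)\<bar> * \<bar>g t\<bar> \<le> 1 / (1 - (c n)\<^sup>2) * \<bar>g t\<bar>"
        by (intro mult_right_mono abs_log_coth_reg'_le c) simp
      then show "norm (log_coth_reg' (c n) (s - t) * g t) \<le> norm (1 / (1 - (c n)\<^sup>2) * g t)"
        using c2 by (simp add: abs_mult)
    qed
  qed measurable
  have int_reg: "integrable lborel (\<lambda>t. log_coth_reg (c n) (s - t) * g t)" for n s
  proof (rule Bochner_Integration.integrable_bound[OF integrable_mult_right[OF g, of "c n / (1 - c n)"]])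
    show "AE t in lborel. norm (log_coth_reg (c n) (s - t) * g t) \<le> norm (c n / (1 - c n) * g t)"
    proof (intro AE_I2)
      fix t
      have "\<bar>log_coth_reg (c n) (s - t)\<bar> * \<bar>g t\<bar> \<le> c n / (1 - c n) * \<bar>g t\<bar>"
        using log_coth_reg_bounds(1,2)[OF c[of n], of "s - t"] by (intro mult_right_mono) auto
      then show "norm (log_coth_reg (c n) (s - t) * g t) \<le> norm (c n / (1 - c n) * g t)"
        using c[of n] by (simp add: abs_mult)
    qed
  qed measurable
  have V'_deriv: "(V n has_real_derivative V' n s) (at s)" for n s
    unfolding V_def V'_def
  proof (rule has_derivative_under_integral[where w="\<lambda>t. 1 / (1 - (c n)\<^sup>2) * \<bar>g t\<bar>"])
    show "integrable lborel (\<lambda>t. 1 / (1 - (c n)\<^sup>2) * \<bar>g t\<bar>)" using g by (intro integrable_mult_right integrable_abs)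
    fix z t
    show "((\<lambda>z. log_coth_reg (c n) (z - t) * g t) has_real_derivative log_coth_reg' (c n) (z - t) * g t) (at z)"
    proof -
      have "((\<lambda>z. log_coth_reg (c n) (z - t)) has_real_derivative log_coth_reg' (c n) (z - t) * 1) (at z)"
        by (rule DERIV_chain2[OF log_coth_reg_has_derivative[OF c]]) (auto intro!: derivative_eq_intros)
      from DERIV_cmult_right[OF this, of "g t"] show ?thesis by simp
    qed
    show "\<bar>log_coth_reg' (c n) (z - t) * g t\<bar> \<le> 1 / (1 - (c n)\<^sup>2) * \<bar>g t\<bar>"
      unfolding abs_mult by (intro mult_right_mono abs_log_coth_reg'_le c) simp
  qed (use int_reg in auto)
  have odd: "log_coth_reg' (c n) (- t) = - log_coth_reg' (c n) t" for n t by (simp add: log_coth_reg'_def)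
  have V'_sym: "V' n s = (\<integral>t. log_coth_reg' (c n) t * ?d s t / 2 \<partial>lborel)"
    and int_sym: "integrable lborel (\<lambda>t. log_coth_reg' (c n) t * ?d s t / 2)" for n s
  proof -
    \<comment> \<open>The substitutions t -> s - t and t -> s + t are averaged. The kernel is odd,
      so only the increment \<open>g (s - t) - g (s + t)\<close> remains, which is O(sqrt
      \<bar>t\<bar>).\<close>
    have 1: "has_bochner_integral lborel (\<lambda>t. log_coth_reg' (c n) (s - (s + -1 * t)) * g (s + -1 * t)) (V' n s /\<^sub>R \<bar>-1\<bar>)"
      unfolding V'_def by (subst lborel_has_bochner_integral_real_affine_iff[symmetric]) (auto intro: has_bochner_integral_integrable int_reg')
    have 2: "has_bochner_integral lborel (\<lambda>t. log_coth_reg' (c n) (s - (s + 1 * t)) * g (s + 1 * t)) (V' n s /\<^sub>R \<bar>1\<bar>)"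
      unfolding V'_def by (subst lborel_has_bochner_integral_real_affine_iff[symmetric]) (auto intro: has_bochner_integral_integrable int_reg')
    have "has_bochner_integral lborel (\<lambda>t. (log_coth_reg' (c n) t * g (s - t) + - log_coth_reg' (c n) t * g (s + t)) / 2) ((V' n s + V' n s) / 2)"
      using has_bochner_integral_divide[OF has_bochner_integral_add[OF 1 2], of 2] by (simp add: odd)
    then have "has_bochner_integral lborel (\<lambda>t. log_coth_reg' (c n) t * ?d s t / 2) (V' n s)"
      by (simp add: right_diff_distrib)
    then show "V' n s = (\<integral>t. log_coth_reg' (c n) t * ?d s t / 2 \<partial>lborel)" "integrable lborel (\<lambda>t. log_coth_reg' (c n) t * ?d s t / 2)"
      by (auto simp: has_bochner_integral_iff)
  qed
  have int_D: "integrable lborel (\<lambda>t. - (1 / sinh t) * ?d s t / 2)" and D_le: "\<bar>D s\<bar> \<le> (\<integral>t. H * ?w t \<partial>lborel)" for s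
  proof -
    have le: "\<bar>- (1 / sinh t) * ?d s t / 2\<bar> \<le> H * ?w t" for t
    proof -
      have "1 / \<bar>sinh t\<bar> * \<bar>?d s t\<bar> \<le> 1 / \<bar>sinh t\<bar> * (2 * H * sqrt \<bar>t\<bar>)" by (intro mult_left_mono d_le) simp
      moreover have "\<bar>- (1 / sinh t) * ?d s t / 2\<bar> = 1 / \<bar>sinh t\<bar> * \<bar>?d s t\<bar> / 2" by (simp add: abs_mult)
      moreover have "1 / \<bar>sinh t\<bar> * (2 * H * sqrt \<bar>t\<bar>) = 2 * (H * ?w t)" by simp
      moreover have "l \<le> z" if "x \<le> y" "l = x / 2" "y = 2 * z" for l x y z :: real using that by linarith
      ultimately show ?thesis by blast
    qed
    show i: "integrable lborel (\<lambda>t. - (1 / sinh t) * ?d s t / 2)"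
      by (rule integrable_bound_real[OF integrable_mult_right[OF integrable_sqrt_div_sinh, of H] _ le]) measurable
    have "\<bar>D s\<bar> \<le> (\<integral>t. \<bar>- (1 / sinh t) * ?d s t / 2\<bar> \<partial>lborel)" unfolding D_def by (rule integral_abs_bound)
    also have "\<dots> \<le> (\<integral>t. H * ?w t \<partial>lborel)"
      by (intro integral_mono integrable_abs i integrable_mult_right integrable_sqrt_div_sinh le)
    finally show "\<bar>D s\<bar> \<le> (\<integral>t. H * ?w t \<partial>lborel)" .
  qed
  \<comment> \<open>The Hoelder bound of \<open>g\<close> is already inserted, so \<open>e n\<close>
    does not depend on s: the derivatives converge uniformly, as the passage to the derivative of
    the limit requires.\<close>
  define e where "e = (\<lambda>n. \<integral>t. \<bar>log_coth_reg' (c n) t + 1 / sinh t\<bar> * (H * sqrt \<bar>t\<bar>) \<partial>lborel)"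
  have e_dom: "\<bar>log_coth_reg' (c n) t + 1 / sinh t\<bar> * (H * sqrt \<bar>t\<bar>) \<le> H * ?w t" for n t
  proof (cases "t = 0")
    case False
    obtain \<theta> where \<theta>: "0 \<le> \<theta>" "\<theta> \<le> 1" "log_coth_reg' (c n) t = - (\<theta> / sinh t)"
      by (rule log_coth_reg'_factor[OF c False])
    have "log_coth_reg' (c n) t + 1 / sinh t = (1 - \<theta>) / sinh t" by (simp add: \<theta> diff_divide_distrib)
    then have "\<bar>log_coth_reg' (c n) t + 1 / sinh t\<bar> \<le> 1 / \<bar>sinh t\<bar>" using \<theta> by (simp add: abs_divide divide_right_mono)
    then have "\<bar>log_coth_reg' (c n) t + 1 / sinh t\<bar> * (H * sqrt \<bar>t\<bar>) \<le> 1 / \<bar>sinh t\<bar> * (H * sqrt \<bar>t\<bar>)"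
      using H0 by (intro mult_right_mono) auto
    then show ?thesis by simp
  qed simp
  have e_int: "integrable lborel (\<lambda>t. \<bar>log_coth_reg' (c n) t + 1 / sinh t\<bar> * (H * sqrt \<bar>t\<bar>))" for n
    by (rule integrable_bound_real[OF integrable_mult_right[OF integrable_sqrt_div_sinh, of H]])
       (use e_dom[of n] H0 in \<open>auto simp: abs_mult\<close>)
  have e_lim: "e \<longlonglongrightarrow> 0"
  proof -
    have "e \<longlonglongrightarrow> (\<integral>t. 0 \<partial>(lborel :: real measure))"
      unfolding e_def
    proof (rule integral_dominated_convergence[OF _ _ integrable_mult_right[OF integrable_sqrt_div_sinh, of H]])
      show "AE t in lborel. (\<lambda>n. \<bar>log_coth_reg' (c n) t + 1 / sinh t\<bar> * (H * sqrt \<bar>t\<bar>)) \<longlonglongrightarrow> 0"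
      proof (intro AE_I2)
        fix t
        show "(\<lambda>n. \<bar>log_coth_reg' (c n) t + 1 / sinh t\<bar> * (H * sqrt \<bar>t\<bar>)) \<longlonglongrightarrow> 0"
        proof (cases "t = 0")
          case False
          have ne: "(cosh t)\<^sup>2 - (1 - 0)\<^sup>2 \<noteq> 0" using False by (simp add: cosh_square_eq)
          have "(\<lambda>n. \<bar>log_coth_reg' (c n) t + 1 / sinh t\<bar> * (H * sqrt \<bar>t\<bar>))
            \<longlonglongrightarrow> \<bar>- ((1 - 0) * sinh t / ((cosh t)\<^sup>2 - (1 - 0)\<^sup>2)) + 1 / sinh t\<bar> * (H * sqrt \<bar>t\<bar>)"
            unfolding log_coth_reg'_def by (intro tendsto_intros c_lim ne)
          moreover have "- ((1 - 0) * sinh t / ((cosh t)\<^sup>2 - (1 - 0)\<^sup>2)) + 1 / sinh t = 0"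
          proof -
            have "(cosh t)\<^sup>2 - (1 - 0)\<^sup>2 = (sinh t)\<^sup>2" by (simp add: cosh_square_eq)
            then show ?thesis using False by (simp only:) (simp add: power2_eq_square)
          qed
          ultimately show ?thesis by simp
        qed simp
      qed
      show "AE t in lborel. norm (\<bar>log_coth_reg' (c n) t + 1 / sinh t\<bar> * (H * sqrt \<bar>t\<bar>)) \<le> H * ?w t" for n
        using e_dom H0 by (intro AE_I2) simp
    qed measurable
    then show ?thesis by simp
  qed
  have V'_D: "\<bar>V' n s - D s\<bar> \<le> e n" for n s
  proof -
    have diff: "V' n s - D s = (\<integral>t. log_coth_reg' (c n) t * ?d s t / 2 - - (1 / sinh t) * ?d s t / 2 \<partial>lborel)"
      unfolding V'_sym D_def by (rule Bochner_Integration.integral_diff[symmetric, OF int_sym int_D])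
    have "\<bar>V' n s - D s\<bar> \<le> (\<integral>t. \<bar>log_coth_reg' (c n) t * ?d s t / 2 - - (1 / sinh t) * ?d s t / 2\<bar> \<partial>lborel)"
      unfolding diff by (rule integral_abs_bound)
    also have "\<dots> \<le> e n"
      unfolding e_def
    proof (rule integral_mono)
      have "integrable lborel (\<lambda>t. log_coth_reg' (c n) t * ?d s t / 2 - - (1 / sinh t) * ?d s t / 2)"
        by (rule Bochner_Integration.integrable_diff) (rule int_sym, rule int_D)
      then show "integrable lborel (\<lambda>t. \<bar>log_coth_reg' (c n) t * ?d s t / 2 - - (1 / sinh t) * ?d s t / 2\<bar>)"
        by (rule integrable_abs)
      show "integrable lborel (\<lambda>t. \<bar>log_coth_reg' (c n) t + 1 / sinh t\<bar> * (H * sqrt \<bar>t\<bar>))" by (rule e_int)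
      fix t
      have gen: "a * d / 2 - - b * d / 2 = (a + b) * (d / 2)" for a b d :: real
        by (simp add: distrib_right add_divide_distrib)
      show "\<bar>log_coth_reg' (c n) t * ?d s t / 2 - - (1 / sinh t) * ?d s t / 2\<bar> \<le> \<bar>log_coth_reg' (c n) t + 1 / sinh t\<bar> * (H * sqrt \<bar>t\<bar>)"
        unfolding gen abs_mult[of _ "?d s t / 2"] using d_le[of s t] by (intro mult_left_mono) auto
    qed
    finally show ?thesis .
  qed
  have V_lim: "(\<lambda>n. V n s) \<longlonglongrightarrow> (\<integral>t. log_coth (s - t) * g t \<partial>lborel)" for s
    unfolding V_def
  proof (rule integral_dominated_convergence[OF _ _ integrable_abs[OF conv[of s]]])
    have ne: "AE t in lborel. t \<noteq> s" by (rule AE_lborel_singleton)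
    then show "AE t in lborel. (\<lambda>n. log_coth_reg (c n) (s - t) * g t) \<longlonglongrightarrow> log_coth (s - t) * g t"
    proof eventually_elim
      case (elim t)
      then have st: "s - t \<noteq> 0" by simp
      have "(\<lambda>n. log_coth_reg (c n) (s - t)) \<longlonglongrightarrow> ln ((cosh (s - t) + (1 - 0)) / (cosh (s - t) - (1 - 0))) / 2"
        unfolding log_coth_reg_def using cosh_gt_1[OF st] by (intro tendsto_intros c_lim) auto
      then have "(\<lambda>n. log_coth_reg (c n) (s - t)) \<longlonglongrightarrow> log_coth (s - t)" by (simp add: log_coth_eq[OF st])
      then show ?case by (rule tendsto_mult_right)
    qed
    show "AE t in lborel. norm (log_coth_reg (c n) (s - t) * g t) \<le> \<bar>log_coth (s - t) * g t\<bar>" for n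
      using ne
    proof eventually_elim
      case (elim t)
      then show ?case
        using log_coth_reg_bounds(1,3)[OF c[of n], of "s - t"] log_coth_nonneg[of "s - t"] by (auto simp: abs_mult intro!: mult_right_mono)
    qed
  qed measurable
  have "\<exists>G. \<forall>x\<in>UNIV. (\<lambda>n. V n x) \<longlonglongrightarrow> G x \<and> (G has_derivative (\<lambda>h. h * D x)) (at x within UNIV)"
  proof (rule has_derivative_sequence[where f'="\<lambda>n x h. h * V' n x"])
    show "(V n has_derivative (\<lambda>h. h * V' n x)) (at x within UNIV)" for n x
      using V'_deriv[of n x] by (simp add: has_field_derivative_def mult_commute_abs)
    fix \<epsilon> :: real assume "0 < \<epsilon>"
    then have "\<forall>\<^sub>F n in sequentially. e n < \<epsilon>" using order_tendstoD(2)[OF e_lim] by simp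
    then show "\<forall>\<^sub>F n in sequentially. \<forall>x\<in>UNIV. \<forall>h. norm (h * V' n x - h * D x) \<le> \<epsilon> * norm h"
    proof eventually_elim
      case (elim n)
      show ?case
      proof (intro ballI allI)
        fix x h
        have "norm (h * V' n x - h * D x) = \<bar>h\<bar> * \<bar>V' n x - D x\<bar>" by (simp add: abs_mult flip: right_diff_distrib)
        also have "\<dots> \<le> \<bar>h\<bar> * \<epsilon>" using V'_D[of n x] elim by (intro mult_left_mono) auto
        finally show "norm (h * V' n x - h * D x) \<le> \<epsilon> * norm h" by (simp add: mult.commute)
      qed
    qed
  qed (use V_lim in auto)
  then obtain G where G: "\<And>x. (\<lambda>n. V n x) \<longlonglongrightarrow> G x" "\<And>x. (G has_derivative (\<lambda>h. h * D x)) (at x)" by auto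
  have "G = (\<lambda>s. \<integral>t. log_coth (s - t) * g t \<partial>lborel)"
    using LIMSEQ_unique[OF G(1) V_lim] by auto
  moreover have "(G has_real_derivative D s) (at s)" for s
    using G(2)[of s] by (simp add: has_field_derivative_def mult_commute_abs)
  ultimately have "((\<lambda>s. \<integral>t. log_coth (s - t) * g t \<partial>lborel) has_real_derivative D s) (at s)" for s by simp
  then show ?thesis using D_le by (rule that)
qed

text \<open>\<open>diff_class X n g\<close>: \<open>g\<close> is \<open>n\<close> times differentiable and lies in \<open>X\<close> together with these derivatives.\<close>

primrec diff_class :: "((real \<Rightarrow> real) \<Rightarrow> bool) \<Rightarrow> nat \<Rightarrow> (real \<Rightarrow> real) \<Rightarrow> bool" where
  "diff_class X 0 g \<longleftrightarrow> X g"
| "diff_class X (Suc n) g \<longleftrightarrow> X g \<and> (\<exists>g'. (\<forall>t. (g has_real_derivative g' t) (at t)) \<and> diff_class X n g')"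

lemma diff_class_SucI:
  "X g \<Longrightarrow> (\<And>t. (g has_real_derivative g' t) (at t)) \<Longrightarrow> diff_class X n g' \<Longrightarrow> diff_class X (Suc n) g"
  by auto

lemma diff_class_base: "diff_class X n g \<Longrightarrow> X g"
  by (cases n) auto

lemma diff_class_SucD: "diff_class X (Suc n) g \<Longrightarrow> diff_class X n g"
proof (induction n arbitrary: g)
  case (Suc n)
  then obtain g' where "X g" "\<forall>t. (g has_real_derivative g' t) (at t)" "diff_class X (Suc n) g'"
    unfolding diff_class.simps(2)[of X "Suc n"] by blast
  with Suc.IH[of g'] show ?case by auto
qed simp

lemma diff_class_weaken: "diff_class X n g \<Longrightarrow> (\<And>h. X h \<Longrightarrow> Y h) \<Longrightarrow> diff_class Y n g"
  by (induction n arbitrary: g) auto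

text \<open>The instances are the bounded measurable, the bounded Hoelder and all functions; the
  closure rules for \<open>diff_class\<close> are proved once for the three of them.\<close>

locale function_algebra =
  fixes X :: "(real \<Rightarrow> real) \<Rightarrow> bool"
  assumes X_const: "X (\<lambda>_. c)"
    and X_add: "X f \<Longrightarrow> X g \<Longrightarrow> X (\<lambda>t. f t + g t)"
    and X_mult: "X f \<Longrightarrow> X g \<Longrightarrow> X (\<lambda>t. f t * g t)"
begin

lemma diff_class_const: "diff_class X n (\<lambda>_. c)"
proof (induction n arbitrary: c)
  case (Suc n)
  have "\<forall>t. ((\<lambda>_. c) has_real_derivative 0) (at t)" by simp
  with Suc[of 0] show ?case by (auto simp: X_const intro!: exI[of _ "\<lambda>_. 0"])
qed (simp add: X_const)

lemma diff_class_add: "diff_class X n f \<Longrightarrow> diff_class X n g \<Longrightarrow> diff_class X n (\<lambda>t. f t + g t)"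
proof (induction n arbitrary: f g)
  case (Suc n)
  obtain f' where f: "X f" "\<And>t. (f has_real_derivative f' t) (at t)" "diff_class X n f'" using Suc.prems(1) by auto
  obtain g' where g: "X g" "\<And>t. (g has_real_derivative g' t) (at t)" "diff_class X n g'" using Suc.prems(2) by auto
  show ?case
    by (rule diff_class_SucI[where X=X, OF X_add[OF f(1) g(1)] DERIV_add[OF f(2) g(2)] Suc.IH[OF f(3) g(3)]])
qed (simp add: X_add)

lemma diff_class_mult: "diff_class X n f \<Longrightarrow> diff_class X n g \<Longrightarrow> diff_class X n (\<lambda>t. f t * g t)"
proof (induction n arbitrary: f g)
  case (Suc n)
  obtain f' where f: "X f" "\<And>t. (f has_real_derivative f' t) (at t)" "diff_class X n f'" using Suc.prems(1) by auto
  obtain g' where g: "X g" "\<And>t. (g has_real_derivative g' t) (at t)" "diff_class X n g'" using Suc.prems(2) by auto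
  have "diff_class X n (\<lambda>t. f' t * g t + g' t * f t)"
    by (intro diff_class_add Suc.IH f(3) g(3) diff_class_SucD[OF Suc.prems(1)] diff_class_SucD[OF Suc.prems(2)])
  then show ?case by (rule diff_class_SucI[where X=X, OF X_mult[OF f(1) g(1)] DERIV_mult[OF f(2) g(2)]])
qed (simp add: X_mult)

lemma diff_class_tanh:
  assumes "X tanh" shows "diff_class X n tanh"
proof (induction n)
  case (Suc n)
  have "(tanh has_real_derivative 1 + (-1) * (tanh t * tanh t)) (at t)" for t
    using tanh_has_derivative[of t] by (simp add: sech2_def power2_eq_square)
  moreover have "diff_class X n (\<lambda>t. 1 + (-1) * (tanh t * tanh t))"
    by (intro diff_class_add diff_class_mult diff_class_const Suc)
  ultimately show ?case
    by (rule diff_class_SucI[where X=X and g=tanh and g'="\<lambda>t. 1 + (-1) * (tanh t * tanh t)", OF assms])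
qed (simp add: assms)

lemma diff_class_exp:
  assumes exp: "\<And>g. X g \<Longrightarrow> X (\<lambda>t. exp (g t))" and g: "diff_class X n g"
  shows "diff_class X n (\<lambda>t. exp (g t))"
  using g
proof (induction n)
  case (Suc n)
  obtain g' where g: "X g" "\<And>t. (g has_real_derivative g' t) (at t)" "diff_class X n g'" using Suc.prems by auto
  have "diff_class X n (\<lambda>t. exp (g t) * g' t)"
    by (intro diff_class_mult Suc.IH g(3) diff_class_SucD[OF Suc.prems])
  then show ?case by (rule diff_class_SucI[where X=X, OF exp[OF g(1)] DERIV_fun_exp[OF g(2)]])
qed (simp add: exp)

end

section \<open>Bootstrapping in bounded and Hoelder classes\<close>

definition bounded_measurable :: "(real \<Rightarrow> real) \<Rightarrow> bool" where
  "bounded_measurable g \<longleftrightarrow> g \<in> borel_measurable borel \<and> (\<exists>M. \<forall>t. \<bar>g t\<bar> \<le> M)"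

definition bounded_holder :: "(real \<Rightarrow> real) \<Rightarrow> bool" where
  "bounded_holder g \<longleftrightarrow> (\<exists>M. \<forall>t. \<bar>g t\<bar> \<le> M) \<and> (\<exists>H. \<forall>s t. \<bar>g s - g t\<bar> \<le> H * sqrt \<bar>s - t\<bar>)"

lemma bounded_add_mult:
  fixes f g :: "real \<Rightarrow> real"
  assumes "\<exists>M. \<forall>t. \<bar>f t\<bar> \<le> M" "\<exists>M. \<forall>t. \<bar>g t\<bar> \<le> M"
  shows "\<exists>M. \<forall>t. \<bar>f t + g t\<bar> \<le> M" "\<exists>M. \<forall>t. \<bar>f t * g t\<bar> \<le> M" "\<exists>M. \<forall>t. \<bar>exp (f t)\<bar> \<le> M"
proof -
  obtain M N where M: "\<And>t. \<bar>f t\<bar> \<le> M" and N: "\<And>t. \<bar>g t\<bar> \<le> N" using assms by blast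
  have "\<bar>f t + g t\<bar> \<le> M + N" for t using M[of t] N[of t] by linarith
  then show "\<exists>M. \<forall>t. \<bar>f t + g t\<bar> \<le> M" by blast
  have "\<bar>f t * g t\<bar> \<le> M * N" for t unfolding abs_mult using M[of t] N[of t] by (intro mult_mono) auto
  then show "\<exists>M. \<forall>t. \<bar>f t * g t\<bar> \<le> M" by blast
  have "\<bar>exp (f t)\<bar> \<le> exp M" for t using abs_le_D1[OF M[of t]] by simp
  then show "\<exists>M. \<forall>t. \<bar>exp (f t)\<bar> \<le> M" by blast
qed

interpretation bounded_measurable: function_algebra bounded_measurable
proof
  show "bounded_measurable (\<lambda>_. c)" for c by (auto simp: bounded_measurable_def)
  fix f g assume fg: "bounded_measurable f" "bounded_measurable g"
  then have [measurable]: "f \<in> borel_measurable borel" "g \<in> borel_measurable borel" by (auto simp: bounded_measurable_def)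
  have "(\<lambda>t. f t + g t) \<in> borel_measurable borel" "(\<lambda>t. f t * g t) \<in> borel_measurable borel" by measurable
  with bounded_add_mult[of f g] fg
  show "bounded_measurable (\<lambda>t. f t + g t)" "bounded_measurable (\<lambda>t. f t * g t)" by (simp_all add: bounded_measurable_def)
qed

interpretation bounded_holder: function_algebra bounded_holder
proof
  show "bounded_holder (\<lambda>_. c)" for c unfolding bounded_holder_def by (intro conjI exI[of _ "\<bar>c\<bar>"] exI[of _ 0]) auto
  fix f g assume fg: "bounded_holder f" "bounded_holder g"
  obtain M N F G where M: "\<And>t. \<bar>f t\<bar> \<le> M" and N: "\<And>t. \<bar>g t\<bar> \<le> N"
    and F: "\<And>s t. \<bar>f s - f t\<bar> \<le> F * sqrt \<bar>s - t\<bar>" and G: "\<And>s t. \<bar>g s - g t\<bar> \<le> G * sqrt \<bar>s - t\<bar>"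
    using fg unfolding bounded_holder_def by metis
  have "\<bar>(f s + g s) - (f t + g t)\<bar> \<le> (F + G) * sqrt \<bar>s - t\<bar>" for s t
    using F[of s t] G[of s t] unfolding distrib_right by linarith
  with bounded_add_mult(1)[of f g] fg show "bounded_holder (\<lambda>t. f t + g t)" unfolding bounded_holder_def by blast
  have "\<bar>f s * g s - f t * g t\<bar> \<le> (M * G + N * F) * sqrt \<bar>s - t\<bar>" for s t
  proof -
    have "f s * g s - f t * g t = f s * (g s - g t) + g t * (f s - f t)" by (simp add: algebra_simps)
    also have "\<bar>\<dots>\<bar> \<le> \<bar>f s\<bar> * \<bar>g s - g t\<bar> + \<bar>g t\<bar> * \<bar>f s - f t\<bar>"
      by (metis abs_mult abs_triangle_ineq)
    also have "\<dots> \<le> M * (G * sqrt \<bar>s - t\<bar>) + N * (F * sqrt \<bar>s - t\<bar>)"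
      using M[of s] N[of t] by (intro add_mono mult_mono F G) auto
    finally show ?thesis by (simp add: algebra_simps)
  qed
  with bounded_add_mult(2)[of f g] fg show "bounded_holder (\<lambda>t. f t * g t)" unfolding bounded_holder_def by blast
qed

interpretation all_functions: function_algebra "\<lambda>_. True"
  by unfold_locales auto

lemma bounded_holder_imp_measurable:
  assumes "bounded_holder g" shows "bounded_measurable g"
proof -
  obtain H where H: "\<And>s t. \<bar>g s - g t\<bar> \<le> H * sqrt \<bar>s - t\<bar>" using assms unfolding bounded_holder_def by blast
  have "g \<in> borel_measurable borel" by (rule borel_measurable_continuous_onI[OF continuous_on_of_holder[OF H]])
  with assms show ?thesis unfolding bounded_holder_def bounded_measurable_def by blast
qed

lemma bounded_measurable_exp: "bounded_measurable g \<Longrightarrow> bounded_measurable (\<lambda>t. exp (g t))"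
  using bounded_add_mult(3)[of g g] by (auto simp: bounded_measurable_def)

lemma bounded_holder_exp:
  assumes "bounded_holder g" shows "bounded_holder (\<lambda>t. exp (g t))"
proof -
  obtain M H where M: "\<And>t. \<bar>g t\<bar> \<le> M" and H: "\<And>s t. \<bar>g s - g t\<bar> \<le> H * sqrt \<bar>s - t\<bar>"
    using assms unfolding bounded_holder_def by metis
  have "\<bar>exp (g s) - exp (g t)\<bar> \<le> exp M * H * sqrt \<bar>s - t\<bar>" for s t
  proof -
    have "\<bar>exp (g s) - exp (g t)\<bar> \<le> exp M * \<bar>g s - g t\<bar>"
      by (rule abs_exp_diff_le) (use abs_le_D1[OF M] in auto)
    also have "\<dots> \<le> exp M * (H * sqrt \<bar>s - t\<bar>)" by (intro mult_left_mono H) simp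
    finally show ?thesis by simp
  qed
  with bounded_add_mult(3)[of g g] assms show ?thesis unfolding bounded_holder_def by blast
qed

lemma bounded_holder_tanh: "bounded_holder tanh"
  unfolding bounded_holder_def
proof (intro conjI exI allI)
  show "\<bar>tanh t\<bar> \<le> 1" for t :: real using tanh_abs_less[of t] by simp
  fix s t :: real
  define a where "a = \<bar>tanh s - tanh t\<bar>"
  have a: "0 \<le> a" "a \<le> 2" "a \<le> \<bar>s - t\<bar>"
    using tanh_abs_less[of s] tanh_abs_less[of t] abs_tanh_diff_le[of s t] by (auto simp: a_def)
  have "a\<^sup>2 \<le> 4 * \<bar>s - t\<bar>"
    using mult_mono[OF a(2,3)] a by (simp add: power2_eq_square)
  then have "a \<le> sqrt (4 * \<bar>s - t\<bar>)" by (rule real_le_rsqrt)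
  then show "\<bar>tanh s - tanh t\<bar> \<le> 2 * sqrt \<bar>s - t\<bar>" by (simp add: a_def real_sqrt_mult)
qed

text \<open>A derivative is the pointwise limit of difference quotients of a continuous function.
  The lemma serves the D of the convolution lemma, which comes with a bound but without
  continuity.\<close>

lemma borel_measurable_derivative:
  assumes deriv: "\<And>s. (V has_real_derivative D s) (at s)"
  shows "D \<in> borel_measurable borel"
proof (rule borel_measurable_LIMSEQ_real)
  have "continuous_on UNIV V" using deriv DERIV_isCont continuous_at_imp_continuous_on by blast
  then have [measurable]: "V \<in> borel_measurable borel" by (rule borel_measurable_continuous_onI)
  show "(\<lambda>s. (V (s + inverse (real (Suc n))) - V s) / inverse (real (Suc n))) \<in> borel_measurable borel" for n
    by measurable
  fix s
  have "filterlim (\<lambda>n. inverse (real (Suc n))) (at 0) sequentially"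
    unfolding filterlim_at using LIMSEQ_inverse_real_of_nat by (auto intro!: always_eventually)
  from filterlim_compose[OF deriv[unfolded DERIV_def] this]
  show "(\<lambda>n. (V (s + inverse (real (Suc n))) - V s) / inverse (real (Suc n))) \<longlonglongrightarrow> D s" .
qed

lemma coth_potential_has_derivative':
  assumes "bounded_measurable R" "bounded_measurable R'" "\<And>t. (R has_real_derivative R' t) (at t)"
  shows "(coth_potential R has_real_derivative coth_potential (\<lambda>t. R' t + (-2) * (tanh t * R t)) s) (at s)"
proof -
  obtain M M' where "\<And>t. \<bar>R t\<bar> \<le> M" "\<And>t. \<bar>R' t\<bar> \<le> M'" using assms unfolding bounded_measurable_def by blast
  from coth_potential_has_derivative[OF _ this(1) _ this(2) assms(3), of s] assms(1,2)
  have "(coth_potential R has_real_derivative coth_potential (\<lambda>t. R' t - 2 * tanh t * R t) s) (at s)"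
    by (simp add: bounded_measurable_def)
  moreover have "(\<lambda>t. R' t - 2 * tanh t * R t) = (\<lambda>t. R' t + (-2) * (tanh t * R t))" by (simp add: mult.assoc)
  ultimately show ?thesis by simp
qed

lemma coth_potential_bounded_holder:
  assumes "bounded_measurable R" shows "bounded_holder (coth_potential R)"
proof -
  obtain M where R: "R \<in> borel_measurable borel" "\<And>t. \<bar>R t\<bar> \<le> M" using assms unfolding bounded_measurable_def by blast
  from coth_potential_bound_holder[OF R] show ?thesis unfolding bounded_holder_def by blast
qed

text \<open>First half of the bootstrap: a potential of a bounded density is Hoelder, and
  \<open>coth_potential_has_derivative'\<close> passes derivatives on to the density, where this
  applies again.\<close>

lemma coth_potential_diff_class_holder:
  "diff_class bounded_measurable n R \<Longrightarrow> diff_class bounded_holder n (coth_potential R)"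
proof (induction n arbitrary: R)
  case 0
  then show ?case by (simp add: coth_potential_bounded_holder)
next
  case (Suc n)
  obtain R' where R: "bounded_measurable R" "\<And>t. (R has_real_derivative R' t) (at t)" "diff_class bounded_measurable n R'"
    using Suc.prems by auto
  have tanh: "bounded_measurable tanh" by (rule bounded_holder_imp_measurable[OF bounded_holder_tanh])
  have "diff_class bounded_measurable n (\<lambda>t. R' t + (-2) * (tanh t * R t))"
    by (intro bounded_measurable.diff_class_add bounded_measurable.diff_class_mult
        bounded_measurable.diff_class_const bounded_measurable.diff_class_tanh tanh R(3) diff_class_SucD[OF Suc.prems])
  from Suc.IH[OF this] show ?case
    by (rule diff_class_SucI[where X=bounded_holder, OF coth_potential_bounded_holder[OF R(1)]
          coth_potential_has_derivative'[OF R(1) diff_class_base[OF R(3)] R(2)]])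
qed

text \<open>Second half: for a Hoelder density the singular convolution has one more derivative, but
  this is only known to be bounded and measurable, hence the change of class in the
  conclusion.\<close>

lemma coth_potential_gains_derivative:
  "diff_class bounded_holder n R \<Longrightarrow> diff_class bounded_measurable (Suc n) (coth_potential R)"
proof (induction n arbitrary: R)
  case 0
  then have R: "bounded_holder R" by simp
  have Rm: "bounded_measurable R" by (rule bounded_holder_imp_measurable[OF R])
  obtain M where M: "R \<in> borel_measurable borel" "\<And>t. \<bar>R t\<bar> \<le> M" using Rm unfolding bounded_measurable_def by blast
  note [measurable] = M(1)
  \<comment> \<open>The weight \<open>sech2\<close> is written as a polynomial in
    \<open>tanh\<close>, so that the closure rules of \<open>bounded_holder\<close> apply to the
    product.\<close>
  define g where "g = (\<lambda>t. (1 + (-1) * (tanh t * tanh t)) * R t * (1 / pi))"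
  have g_eq: "g t = sech2 t * R t / pi" for t by (simp add: g_def sech2_def power2_eq_square)
  have "bounded_holder g"
    unfolding g_def by (intro bounded_holder.X_add bounded_holder.X_mult bounded_holder.X_const bounded_holder_tanh R)
  then obtain H where H: "\<And>s t. \<bar>g s - g t\<bar> \<le> H * sqrt \<bar>s - t\<bar>" unfolding bounded_holder_def by blast
  have M0: "0 \<le> M" using M(2)[of 0] by linarith
  have g_int: "integrable lborel g"
  proof (rule integrable_bound_real[OF integrable_mult_left[OF integrable_sech2, of M]])
    show "g \<in> borel_measurable lborel" unfolding g_def by measurable
    fix t
    have "\<bar>g t\<bar> = sech2 t * \<bar>R t\<bar> / pi" using sech2_bounds(1)[of t] by (simp add: g_eq abs_mult)
    also have "\<dots> \<le> sech2 t * M / 1"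
      using sech2_bounds(1)[of t] M(2)[of t] M0 pi_gt3 by (intro frac_le mult_left_mono) auto
    finally show "\<bar>g t\<bar> \<le> sech2 t * M" by simp
  qed
  have cp: "log_coth (s - t) * g t = log_coth (s - t) / pi * (sech2 t * R t)" for s t by (simp add: g_eq)
  have "\<And>s. integrable lborel (\<lambda>t. log_coth (s - t) * g t)"
    unfolding cp by (rule integrable_coth_potential[OF M])
  from log_coth_convolution_differentiable[OF g_int this H]
  obtain D B where D: "\<And>s. ((\<lambda>s. \<integral>t. log_coth (s - t) * g t \<partial>lborel) has_real_derivative D s) (at s)" "\<And>s. \<bar>D s\<bar> \<le> B"
    by metis
  have "(\<lambda>s. \<integral>t. log_coth (s - t) * g t \<partial>lborel) = coth_potential R"
    unfolding cp coth_potential_def ..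
  with D(1) have deriv: "\<And>s. (coth_potential R has_real_derivative D s) (at s)" by simp
  have "bounded_measurable D"
    using borel_measurable_derivative[OF deriv] D(2) unfolding bounded_measurable_def by blast
  then show ?case
    by (intro diff_class_SucI[where X=bounded_measurable, OF bounded_holder_imp_measurable[OF coth_potential_bounded_holder[OF Rm]] deriv]) simp
next
  case (Suc n)
  obtain R' where R: "bounded_holder R" "\<And>t. (R has_real_derivative R' t) (at t)" "diff_class bounded_holder n R'"
    using Suc.prems by auto
  have Rm: "bounded_measurable R" "bounded_measurable R'"
    using bounded_holder_imp_measurable R(1) diff_class_base[OF R(3)] by auto
  have "diff_class bounded_holder n (\<lambda>t. R' t + (-2) * (tanh t * R t))"
    by (intro bounded_holder.diff_class_add bounded_holder.diff_class_mult
        bounded_holder.diff_class_const bounded_holder.diff_class_tanh bounded_holder_tanh R(3) diff_class_SucD[OF Suc.prems])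
  from Suc.IH[OF this] show ?case
    by (rule diff_class_SucI[where X=bounded_measurable, OF bounded_holder_imp_measurable[OF coth_potential_bounded_holder[OF Rm(1)]]
          coth_potential_has_derivative'[OF Rm R(2)]])
qed

text \<open>Each round uses both halves: n bounded derivatives of U become n Hoelder ones, and these
  yield n + 1 bounded ones. Composition with exp preserves either class.\<close>

lemma coth_potential_exp_fixpoint_smooth:
  assumes U: "bounded_measurable U" and eq: "U = coth_potential (\<lambda>t. lam * exp (U t))"
  shows "diff_class bounded_measurable n U"
proof (induction n)
  case 0
  then show ?case using U by simp
next
  case (Suc n)
  have "diff_class bounded_measurable n (\<lambda>t. lam * exp (U t))"
    by (intro bounded_measurable.diff_class_mult bounded_measurable.diff_class_const
        bounded_measurable.diff_class_exp bounded_measurable_exp Suc)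
  then have "diff_class bounded_holder n U" by (subst eq) (rule coth_potential_diff_class_holder)
  then have "diff_class bounded_holder n (\<lambda>t. lam * exp (U t))"
    by (intro bounded_holder.diff_class_mult bounded_holder.diff_class_const
        bounded_holder.diff_class_exp bounded_holder_exp)
  then show ?case by (subst eq) (rule coth_potential_gains_derivative)
qed

section \<open>Transfer of smoothness to the interval and existence of solutions\<close>

definition smooth_real :: "(real \<Rightarrow> real) \<Rightarrow> bool" where
  "smooth_real g \<longleftrightarrow> (\<forall>n. diff_class (\<lambda>_. True) n g)"

lemma smooth_real_deriv:
  assumes "smooth_real g"
  shows "(g has_real_derivative deriv g t) (at t)" "smooth_real (deriv g)"
proof -
  have *: "\<exists>g'. (\<forall>t. (g has_real_derivative g' t) (at t)) \<and> diff_class (\<lambda>_. True) n g'" for n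
    using assms[unfolded smooth_real_def, rule_format, of "Suc n"] by simp
  have "diff_class (\<lambda>_. True) n (deriv g)" for n
  proof -
    obtain g' where g': "\<And>t. (g has_real_derivative g' t) (at t)" "diff_class (\<lambda>_. True) n g'" using * by blast
    have "deriv g = g'" using DERIV_imp_deriv[OF g'(1)] by blast
    with g' show ?thesis by simp
  qed
  then show "smooth_real (deriv g)" by (simp add: smooth_real_def)
  show "(g has_real_derivative deriv g t) (at t)" using *[of 0] DERIV_imp_deriv by metis
qed

lemma smooth_real_mult: "smooth_real f \<Longrightarrow> smooth_real g \<Longrightarrow> smooth_real (\<lambda>t. f t * g t)"
  by (simp add: smooth_real_def all_functions.diff_class_mult)

lemma smooth_real_cosh: "smooth_real cosh"
proof -
  have "diff_class (\<lambda>_. True) n cosh \<and> diff_class (\<lambda>_. True) n sinh" for n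
  proof (induction n)
    case (Suc n)
    have "\<forall>t::real. (cosh has_real_derivative sinh t) (at t)" "\<forall>t::real. (sinh has_real_derivative cosh t) (at t)"
      by (auto intro!: derivative_eq_intros)
    with Suc show ?case unfolding diff_class.simps by blast
  qed simp
  then show ?thesis by (simp add: smooth_real_def)
qed

text \<open>The derivative 1 / (1 - x^2) of artanh x is the square of cosh (artanh x). Hence
  differentiation in x takes \<open>W (artanh x)\<close> to \<open>deriv W * cosh * cosh\<close>
  evaluated at artanh x, again a smooth function of artanh x, and the iterated derivatives keep this
  form.\<close>

lemma smooth_on_open_artanh:
  assumes U: "smooth_real U" and u: "\<And>x. \<bar>x\<bar> < 1 \<Longrightarrow> u x = U (artanh x)"
  shows "smooth_on_open {-1<..<1} u"
proof -
  have deriv: "(v has_real_derivative deriv W (artanh x) * (cosh (artanh x) * cosh (artanh x))) (at x)"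
    if W: "smooth_real W" and v: "\<And>x. \<bar>x\<bar> < 1 \<Longrightarrow> v x = W (artanh x)" and x: "\<bar>x\<bar> < 1" for v W x
  proof -
    have "(artanh has_real_derivative 1 / (1 - x\<^sup>2)) (at x)"
      by (rule artanh_real_has_field_derivative) (use x in auto)
    moreover have "1 / (1 - x\<^sup>2) = cosh (artanh x) * cosh (artanh x)"
    proof -
      have "1 - x\<^sup>2 = 1 / (cosh (artanh x))\<^sup>2"
        using sech2_cosh[of "artanh x"] unfolding sech2_def tanh_artanh_real[OF x] .
      then show ?thesis by (simp add: power2_eq_square)
    qed
    ultimately have "((\<lambda>x. W (artanh x)) has_real_derivative deriv W (artanh x) * (cosh (artanh x) * cosh (artanh x))) (at x)"
      by (intro DERIV_chain2[OF smooth_real_deriv(1)[OF W]]) simp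
    then show ?thesis
      by (rule has_field_derivative_transform_within_open[of _ _ _ "{-1<..<1}"]) (use v x in auto)
  qed
  have *: "\<exists>W. smooth_real W \<and> (\<forall>x. \<bar>x\<bar> < 1 \<longrightarrow> (deriv ^^ k) u x = W (artanh x))" for k
  proof (induction k)
    case 0
    then show ?case using U u by auto
  next
    case (Suc k)
    then obtain W where W: "smooth_real W" "\<And>x. \<bar>x\<bar> < 1 \<Longrightarrow> (deriv ^^ k) u x = W (artanh x)" by blast
    have "smooth_real (\<lambda>t. deriv W t * (cosh t * cosh t))"
      by (intro smooth_real_mult smooth_real_deriv(2) smooth_real_cosh W(1))
    moreover have "(deriv ^^ Suc k) u x = deriv W (artanh x) * (cosh (artanh x) * cosh (artanh x))" if "\<bar>x\<bar> < 1" for x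
      using DERIV_imp_deriv[OF deriv[OF W that]] by simp
    ultimately show ?case by blast
  qed
  show ?thesis
    unfolding smooth_on_open_def
  proof (intro allI ballI)
    fix k and x :: real assume "x \<in> {-1<..<1}"
    then have x: "\<bar>x\<bar> < 1" by auto
    obtain W where W: "smooth_real W" "\<And>x. \<bar>x\<bar> < 1 \<Longrightarrow> (deriv ^^ k) u x = W (artanh x)" using * by blast
    show "(deriv ^^ k) u field_differentiable at x"
      using deriv[OF W x] unfolding field_differentiable_def by blast
  qed
qed

lemma nontrivial_nonneg_solution_exists:
  assumes \<rho>: "0 < \<rho>" "\<rho> < 2 * pi"
  shows "\<exists>u. nontrivial_nonneg_solution \<rho> u"
proof -
  obtain K v where v: "bounded_potential K v" and v_eq: "v = (\<lambda>x. \<rho> * green_op (gibbs v) x)"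
    by (rule mean_field_potential_exists[OF \<rho>])
  define lam where "lam = \<rho> / partition_sum v"
  define f where "f = (\<lambda>x. if \<bar>x\<bar> < 1 then lam * exp (v x) else 0)"
  have Z: "2 \<le> partition_sum v" by (rule partition_sum_ge[OF v])
  have lam: "0 < lam" using Z \<rho> by (simp add: lam_def)
  have f_gibbs: "f = (\<lambda>x. \<rho> * gibbs v x)" by (auto simp: f_def gibbs_def lam_def)
  have v_green: "v = green_op f" by (subst v_eq) (simp add: f_gibbs green_op_cmult fun_eq_iff)
  note [measurable] = bounded_potentialD(1)[OF v]
  have f: "f \<in> borel_measurable borel" unfolding f_def by measurable
  have fM: "\<bar>f x\<bar> \<le> lam * exp K" for x using bounded_potentialD(3)[OF v, of x] lam by (simp add: f_def)
  have holder: "\<bar>v x - v y\<bar> \<le> 9 * (lam * exp K) * sqrt \<bar>x - y\<bar>" for x y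
    using green_op_holder[OF f fM, of x y] unfolding v_green[symmetric] .
  define U where "U = (\<lambda>s. v (tanh s))"
  have UK: "\<bar>U s\<bar> \<le> K" for s using bounded_potentialD(2,3)[OF v] by (simp add: U_def)
  have Um: "U \<in> borel_measurable borel" unfolding U_def by measurable
  have "U s = coth_potential (\<lambda>t. lam * exp (U t)) s" for s
  proof -
    have "coth_potential (\<lambda>t. lam * exp (U t)) s = green_op (\<lambda>y. if \<bar>y\<bar> < 1 then lam * exp (U (artanh y)) else 0) (tanh s)"
    proof (rule coth_potential_eq)
      show "(\<lambda>t. lam * exp (U t)) \<in> borel_measurable borel" using Um by measurable
      show "\<bar>lam * exp (U t)\<bar> \<le> lam * exp K" for t using abs_le_D1[OF UK[of t]] lam by simp
    qed
    also have "(\<lambda>y. if \<bar>y\<bar> < 1 then lam * exp (U (artanh y)) else 0) = f"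
      by (auto simp: f_def U_def tanh_artanh_real fun_eq_iff)
    finally show ?thesis by (simp add: U_def v_green[symmetric])
  qed
  then have eq: "U = coth_potential (\<lambda>t. lam * exp (U t))" by blast
  have "bounded_measurable U" using Um UK unfolding bounded_measurable_def by blast
  from coth_potential_exp_fixpoint_smooth[OF this eq] have "diff_class bounded_measurable n U" for n .
  then have "smooth_real U" unfolding smooth_real_def by (auto intro: diff_class_weaken)
  then have smooth: "smooth_on_open {-1<..<1} v"
    by (rule smooth_on_open_artanh) (simp add: U_def tanh_artanh_real)
  have half: "has_half_laplacian v x (\<rho> * (exp (v x) / (LINT y:{-1<..<1}|lborel. exp (v y))))" if xI: "x \<in> {-1<..<1}" for x
  proof -
    have x: "\<bar>x\<bar> < 1" using xI by auto
    obtain D where D: "(v has_real_derivative D) (at x)"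
      using smooth[unfolded smooth_on_open_def, rule_format, OF xI, of 0] by (auto simp: field_differentiable_def)
    have "((\<lambda>x. lam * exp (v x)) has_real_derivative lam * (exp (v x) * D)) (at x)"
      by (intro DERIV_cmult DERIV_fun_exp D)
    then have "(f has_real_derivative lam * (exp (v x) * D)) (at x)"
      by (rule has_field_derivative_transform_within_open[of _ _ _ "{-1<..<1}"])
         (use x in \<open>auto simp: f_def\<close>)
    from differentiable_imp_global_linear_bound[OF this, of "lam * exp K"] fM
    obtain C where "\<And>y. \<bar>f y - f x\<bar> \<le> C * \<bar>y - x\<bar>" by blast
    then have "has_half_laplacian (green_op f) x (f x)" by (rule has_half_laplacian_green_op[OF x f fM])
    then have "has_half_laplacian v x (f x)" by (simp only: v_green[symmetric])
    then show ?thesis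
      using x by (simp add: f_def lam_def partition_sum_def set_lebesgue_integral_def)
  qed
  have "v \<in> hoelder_space (1/2)"
  proof -
    have "bounded (range v)" using bounded_potentialD(2,3)[OF v] by (auto simp: bounded_iff intro!: exI[of _ K])
    moreover have "\<forall>x y. \<bar>v x - v y\<bar> \<le> 9 * (lam * exp K) * \<bar>x - y\<bar> powr (1/2)"
      using holder by (simp add: powr_half_sqrt)
    ultimately show ?thesis unfolding hoelder_space_def by blast
  qed
  moreover have "v x = 0" if "x \<notin> {-1<..<1}" for x
    unfolding v_green by (rule green_op_outside) (use that in auto)
  moreover have "v 0 \<noteq> 0"
  proof -
    \<comment> \<open>Nontriviality: f is at least \<open>lam\<close> on the interval because v is
      nonnegative, and the constant density \<open>lam\<close> has the potential
      \<open>lam * semicircle 0\<close> at 0.\<close>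
    have "green_op (\<lambda>_. lam) 0 \<le> green_op f 0"
      by (rule green_op_mono[OF _ _ f fM, of _ lam]) (use lam bounded_potentialD(2)[OF v] in \<open>auto simp: f_def\<close>)
    moreover have "semicircle 0 = 1" by (simp add: semicircle_def)
    ultimately have "lam \<le> v 0" by (simp add: green_op_const v_green[symmetric])
    then show ?thesis using lam by linarith
  qed
  ultimately have "nontrivial_nonneg_solution \<rho> v"
    using smooth half bounded_potentialD(2)[OF v] unfolding nontrivial_nonneg_solution_def liouville_solution_def by blast
  then show ?thesis by blast
qed

theorem theorem2:
  shows "(\<forall>\<rho>::real. \<rho> > 0 \<longrightarrow>
            ((\<exists>u. nontrivial_nonneg_solution \<rho> u) \<longleftrightarrow> \<rho> \<in> {0<..<2*pi})) \<and>
         (\<forall>u :: real \<Rightarrow> real \<Rightarrow> real.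
            (\<forall>\<rho>\<in>{0<..<2*pi}. nontrivial_nonneg_solution \<rho> (u \<rho>)) \<longrightarrow>
            filterlim (\<lambda>\<rho>. u \<rho> 0) at_top (at_left (2*pi)))"
proof (intro conjI allI impI iffI)
  fix \<rho> :: real assume \<rho>: "\<rho> > 0"
  show "\<rho> \<in> {0<..<2*pi}" if "\<exists>u. nontrivial_nonneg_solution \<rho> u"
    using that nontrivial_nonneg_solution_mass_less \<rho> by auto
  show "\<exists>u. nontrivial_nonneg_solution \<rho> u" if "\<rho> \<in> {0<..<2*pi}"
    using that by (intro nontrivial_nonneg_solution_exists) auto
next
  fix u :: "real \<Rightarrow> real \<Rightarrow> real"
  assume "\<forall>\<rho>\<in>{0<..<2*pi}. nontrivial_nonneg_solution \<rho> (u \<rho>)"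
  then show "filterlim (\<lambda>\<rho>. u \<rho> 0) at_top (at_left (2*pi))" by (intro center_values_at_top) blast
qed

end
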